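(* Let $d\ge2$ and $\Sigma_\mu,\Sigma_\nu\in\mathcal S_d^+$ with $\Sigma_\nu$ of rank $d'\in\{1,\dots,d-1\}$, so that $\Sigma_\nu=O\,\mathrm{diag}(\lambda_1,\dots,\lambda_{d'},0,\dots,0)\,O^*$ for some $\lambda_1,\dots,\lambda_{d'}>0$ and some $O\in\mathcal O_d$. Let $\Gamma\in\mathcal S_{d'}^+$ denote the covariance matrix of $\mathcal J_2\big(\mathcal N_{d'}(0,\mathrm{diag}(\lambda_1,\dots,\lambda_{d'})),\mathcal N_{d'}(0,(O^*\Sigma_\mu O)_{1:d',1:d'})\big)$, and let $\Sigma_\star\in\mathbb R^{d\times d}$ denote the matrix such that $(O^*\Sigma_\star O)_{1:d',1:d'}=\Gamma$ and all other entries of $O^*\Sigma_\star O$ are equal to those of $O^*\Sigma_\mu O$. Then $\mathcal N_d(0,\Sigma_\star)$ is the unique $\mathcal W_2$-projection of $\mathcal N_d(0,\Sigma_\nu)$ on the set of distributions dominating $\mathcal N_d(0,\Sigma_\mu)$ in the convex order if and only if $$\operatorname{rk}(\Sigma_\star)=\operatorname{rk}(\Sigma_\nu)\quad\text{or}\quad\Sigma_\nu\le(\Sigma_\nu^{1/2}\Sigma_\mu\Sigma_\nu^{1/2})^{1/2}.$$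
   Context: $\mathcal S_d^+$ is the set of real symmetric positive semi-definite $d\times d$ matrices, $\mathcal O_d$ the group of $d\times d$ orthogonal matrices, $O^*$ the transpose, $\operatorname{rk}$ the rank, $M^{1/2}$ the positive semi-definite square root, and $\le$ between symmetric matrices is the positive semi-definite (Loewner) order. For a matrix $M$, $(M)_{i_1:i_2,j_1:j_2}$ is the submatrix of rows $i_1,\dots,i_2$ and columns $j_1,\dots,j_2$. $\mathcal N_d(m,\Sigma)$ is the (possibly degenerate) Gaussian distribution on $\mathbb R^d$. $\mathcal P_2(\mathbb R^d)$ is the set of probability measures with finite second moment and $\mathcal W_2$ the quadratic Wasserstein distance. The convex order is defined by $\mu\le_{cx}\nu$ iff $\int f\,d\mu\le\int f\,d\nu$ for every convex $f$. A $\mathcal W_2$-projection of $\nu$ on the set of distributions dominating $\mu$ in the convex order is a minimizer of $\eta\mapsto\mathcal W_2(\nu,\eta)$ over $\{\eta\in\mathcal P_2(\mathbb R^d):\mu\le_{cx}\eta\}$; when $\nu$ is absolutely continuous with respect to the Lebesgue measure it is known to exist and be unique and is denoted $\mathcal J_2(\nu,\mu)$ (this applies in dimension $d'$ to $\nu=\mathcal N_{d'}(0,\mathrm{diag}(\lambda_1,\dots,\lambda_{d'}))$). *)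

theory Defs
  imports "HOL-Probability.Probability"
begin

section \<open>Positive semi-definite matrices\<close>

definition psd :: "real^'n^'n \<Rightarrow> bool" where
  "psd M \<longleftrightarrow> transpose M = M \<and> (\<forall>x. 0 \<le> x \<bullet> (M *v x))"

definition loewner_le :: "real^'n^'n \<Rightarrow> real^'n^'n \<Rightarrow> bool" where
  "loewner_le A B \<longleftrightarrow> psd (B - A)"

definition psd_sqrt :: "real^'n^'n \<Rightarrow> real^'n^'n" where
  "psd_sqrt M = (THE S. psd S \<and> S ** S = M)"

definition diag_matrix :: "('n \<Rightarrow> real) \<Rightarrow> real^'n^'n" where
  "diag_matrix l = (\<chi> i j. if i = j then l i else 0)"

(* The principal submatrix of M on the coordinates e i.  For an injection e, the range of e
   plays the part of the first d' = CARD('m) coordinates out of d = CARD('n). *)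
definition principal_submatrix :: "('m \<Rightarrow> 'n) \<Rightarrow> real^'n^'n \<Rightarrow> real^'m^'m" where
  "principal_submatrix e M = (\<chi> i j. M $ e i $ e j)"


section \<open>Gaussian distributions and covariance\<close>

(* The law of m + S^(1/2) Z, where Z has independent standard normal coordinates.
   S may be singular. *)
definition gaussian :: "real^'n::finite \<Rightarrow> real^'n^'n \<Rightarrow> (real^'n) measure" where
  "gaussian m S =
     distr (\<Pi>\<^sub>M i\<in>UNIV. std_normal_distribution) borel (\<lambda>z. m + psd_sqrt S *v (\<chi> i. z i))"

definition covariance_matrix :: "(real^'n::finite) measure \<Rightarrow> real^'n^'n" where
  "covariance_matrix M =
     (let m = (LINT x|M. x) in \<chi> i j. LINT x|M. (x $ i - m $ i) * (x $ j - m $ j))"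


section \<open>Quadratic Wasserstein distance and convex order\<close>

definition P2 :: "'a::euclidean_space measure set" where
  "P2 = {M. prob_space M \<and> sets M = sets borel \<and> integrable M (\<lambda>x. (norm x)\<^sup>2)}"

definition couplings ::
    "'a::euclidean_space measure \<Rightarrow> 'a measure \<Rightarrow> ('a \<times> 'a) measure set" where
  "couplings \<mu> \<nu> = {\<pi>. sets \<pi> = sets borel \<and> distr \<pi> borel fst = \<mu> \<and> distr \<pi> borel snd = \<nu>}"

(* Meant for arguments in P2: the cost is then integrable for every coupling. *)
definition W2 :: "'a::euclidean_space measure \<Rightarrow> 'a measure \<Rightarrow> real" where
  "W2 \<mu> \<nu> = sqrt (INF \<pi>\<in>couplings \<mu> \<nu>. LINT (x, y)|\<pi>. (norm (x - y))\<^sup>2)"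

(* The integral of f with values in the extended reals, positive part minus negative part.
   The Bochner integral is not suitable for the convex order, because it is 0 for non-integrable f.
   A convex f has an affine minorant, so under a law with finite first moment its negative part
   has finite integral and the value is either finite or plus infinity. *)
definition ext_integral :: "'a measure \<Rightarrow> ('a \<Rightarrow> real) \<Rightarrow> ereal" where
  "ext_integral M f =
     enn2ereal (\<integral>\<^sup>+ x. ennreal (f x) \<partial>M) - enn2ereal (\<integral>\<^sup>+ x. ennreal (- f x) \<partial>M)"

definition convex_order :: "'a::euclidean_space measure \<Rightarrow> 'a measure \<Rightarrow> bool" where
  "convex_order \<mu> \<nu> \<longleftrightarrow>
     (\<forall>f. convex_on UNIV f \<longrightarrow> ext_integral \<mu> f \<le> ext_integral \<nu> f)"

(* The W2-projections of \<nu> on the set of laws dominating \<mu> in the convex order. *)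
definition W2_projections ::
    "'a::euclidean_space measure \<Rightarrow> 'a measure \<Rightarrow> 'a measure set" where
  "W2_projections \<nu> \<mu> =
     {\<eta> \<in> P2. convex_order \<mu> \<eta> \<and> (\<forall>\<rho>\<in>P2. convex_order \<mu> \<rho> \<longrightarrow> W2 \<nu> \<eta> \<le> W2 \<nu> \<rho>)}"

(* Used only where the projection exists and is unique, as for absolutely continuous \<nu>. *)
definition J2 :: "'a::euclidean_space measure \<Rightarrow> 'a measure \<Rightarrow> 'a measure" where
  "J2 \<nu> \<mu> = (THE \<eta>. \<eta> \<in> W2_projections \<nu> \<mu>)"

end

theory Submission
  imports Defs
begin

text \<open>Let \<open>V\<close> be the isometry from \<open>\<real>\<^sup>m\<close> onto the range of \<open>\<Sigma>\<^sub>\<nu>\<close>, so that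
  \<open>\<Sigma>\<^sub>\<nu> = V L V\<^sup>T\<close>, and let \<open>S = V\<^sup>T \<Sigma>\<^sub>\<mu> V\<close>. Minimising \<open>tr (T L) + tr (T\<^sup>-\<^sup>1 S)\<close> over \<open>T \<ge> I\<close> gives a dual
  certificate: \<open>\<Gamma> = T L T\<close> satisfies \<open>\<Gamma> \<ge> S\<close> and \<open>(I - T\<^sup>-\<^sup>1) (\<Gamma> - S) = 0\<close>. With \<open>T\<close> and its
  pseudo-inverse \<open>W\<close> transported to \<open>\<real>\<^sup>n\<close>, every \<open>x\<close> in the range of \<open>\<Sigma>\<^sub>\<nu>\<close> satisfies
  \<open>|x - y|\<^sup>2 = x \<bullet> (I - T) x + (x - W y) \<bullet> T (x - W y) + y \<bullet> (I - W) y\<close>, and the last term is convex in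
  \<open>y\<close>. Hence a law \<open>\<eta>\<close> dominating \<open>N(0, \<Sigma>\<^sub>\<mu>)\<close> is a projection iff \<open>W\<close> maps it to \<open>N(0, \<Sigma>\<^sub>\<nu>)\<close> and its second
  moment is \<open>\<Sigma>\<^sub>s\<close>.

  If \<open>rk \<Sigma>\<^sub>s = rk \<Sigma>\<^sub>\<nu>\<close>, then \<open>y\<close> is a linear function of \<open>W y\<close> on the support of \<open>\<eta>\<close>, so \<open>\<eta>\<close> is determined.
  If \<open>\<Sigma>\<^sub>s = \<Sigma>\<^sub>\<mu>\<close>, which is the Loewner condition, then \<open>\<eta>\<close> dominates \<open>N(0, \<Sigma>\<^sub>\<mu>)\<close> and has the same second moment,
  hence equals it. Otherwise a rank-one part \<open>v v\<^sup>T\<close> of \<open>\<Sigma>\<^sub>s - \<Sigma>\<^sub>\<mu>\<close> can be realised by a shift along \<open>v\<close>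
  with a random sign and a size proportional to a Gaussian that is independent of \<open>W x\<close>; this yields
  a second projection, which is a mixture of two Gaussians.\<close>

text \<open>In terms of Kantorovich duality, x . T x / 2 and y . W y / 2 are conjugate quadratic
  potentials. The optimal map therefore runs from the dominating law back to the target, as y -> W
  y, and the constraint T >= 1 says that this map is a contraction. That is what makes the remainder
  term convex and so monotone in the convex order. What remains free is the conditional law of y
  given W y. In dimension m the equation T W = 1 leaves no freedom there; in dimension n the kernel
  of W does, and the rank condition measures whether the candidate has any mass in that direction.
  \<open>W2\<close> is an infimum, so the equality case is read off from couplings whose excess cost
  tends to 0, with the limit taken in characteristic functions. These also identify Gaussian laws
  and distinguish the mixture from the Gaussian. The dual problem is used a second time, with L = 1
  and an inactive constraint, to construct the positive semi-definite square root.\<close>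

declare transpose_matrix_vector [simp del]

section \<open>Algebra of real matrices, transposes and traces\<close>

lemma matrix_add_rdistrib: "(A + B) ** C = A ** C + B ** (C :: real^'p^'n)"
  for A B :: "real^'n^'m"
  by (simp add: matrix_matrix_mult_def vec_eq_iff sum.distrib distrib_right)

lemma matrix_diff_ldistrib: "A ** (B - C) = A ** B - A ** (C :: real^'p^'n)"
  for A :: "real^'n^'m"
  by (simp add: matrix_matrix_mult_def vec_eq_iff sum_subtractf right_diff_distrib)

lemma matrix_diff_rdistrib: "(A - B) ** C = A ** C - B ** (C :: real^'p^'n)"
  for A B :: "real^'n^'m"
  by (simp add: matrix_matrix_mult_def vec_eq_iff sum_subtractf left_diff_distrib)

lemma matrix_scaleR_left: "(c *\<^sub>R A) ** B = c *\<^sub>R (A ** B)"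
  and matrix_scaleR_right: "A ** (c *\<^sub>R B) = c *\<^sub>R (A ** B)"
  for A :: "real^'n^'m" and B :: "real^'p^'n"
  by (simp_all add: matrix_scalar_ac scalar_matrix_assoc)

lemma transpose_add: "transpose (A + B) = transpose A + transpose (B :: real^'n^'m)"
  and transpose_diff: "transpose (A - B) = transpose A - transpose (B :: real^'n^'m)"
  by (simp_all add: transpose_def vec_eq_iff)

lemma inner_matrix_left: "(A *v x) \<bullet> y = x \<bullet> (transpose A *v y)"
  for A :: "real^'n^'m"
  by (metis dot_lmul_matrix vector_transpose_matrix)

lemma trace_scaleR: "trace (c *\<^sub>R A) = c * trace A" for A :: "real^'n^'n"
  by (simp add: trace_def sum_distrib_left)

lemma inner_axis_matrix: "axis i 1 \<bullet> (A *v axis j 1) = A $ i $ j" for A :: "real^'n^'m"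
  by (simp add: inner_axis' matrix_vector_mul_component inner_axis)

text \<open>For positive semi-definite \<open>A\<close> every summand is nonnegative, so a vanishing
  trace becomes termwise vanishing on the columns of \<open>C\<close>.\<close>

lemma trace_congruence:
  "trace (transpose C ** A ** C) = (\<Sum>i\<in>UNIV. (C *v axis i 1) \<bullet> (A *v (C *v axis i 1)))"
  for A :: "real^'n^'n" and C :: "real^'m^'n"
proof -
  have "(transpose C ** A ** C) $ i $ i = (C *v axis i 1) \<bullet> (A *v (C *v axis i 1))" for i
    unfolding inner_axis_matrix[symmetric]
    by (simp add: inner_matrix_left matrix_vector_mul_assoc matrix_mul_assoc)
  then show ?thesis by (simp add: trace_def)
qed

lemma matrix_eq_0_axis: "A = 0 \<longleftrightarrow> (\<forall>i. A *v axis i 1 = 0)" for A :: "real^'n^'m"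
  by (metis inner_axis_matrix inner_zero_right matrix_vector_mult_0 vec_eq_iff zero_index)

subsection \<open>Positive semi-definite matrices\<close>

lemma psd_transpose: "psd A \<Longrightarrow> transpose A = A"
  and psd_nonneg: "psd A \<Longrightarrow> 0 \<le> x \<bullet> (A *v x)"
  by (auto simp: psd_def)

lemma psd_inner_sym: "psd A \<Longrightarrow> x \<bullet> (A *v y) = y \<bullet> (A *v x)"
  by (metis inner_commute inner_matrix_left psd_transpose)

lemma psd_0: "psd 0"
  by (simp add: psd_def transpose_def vec_eq_iff)

lemma psd_mat1: "psd (mat 1)"
  by (simp add: psd_def)

lemma psd_add: "psd A \<Longrightarrow> psd B \<Longrightarrow> psd (A + B)"
  by (simp add: psd_def transpose_add matrix_vector_mult_add_rdistrib inner_add_right)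

lemma psd_scaleR: "psd A \<Longrightarrow> 0 \<le> c \<Longrightarrow> psd (c *\<^sub>R A)"
  by (simp add: psd_def transpose_scalar scaleR_matrix_vector_assoc[symmetric])

lemma psd_congruence: "psd A \<Longrightarrow> psd (transpose C ** A ** C)"
  for A :: "real^'n^'n" and C :: "real^'m^'n"
proof -
  assume A: "psd A"
  have "x \<bullet> ((transpose C ** A ** C) *v x) = (C *v x) \<bullet> (A *v (C *v x))" for x
    by (simp add: inner_matrix_left matrix_vector_mul_assoc matrix_mul_assoc)
  then show ?thesis
    using psd_nonneg[OF A] psd_transpose[OF A]
    by (simp add: psd_def matrix_transpose_mul matrix_mul_assoc)
qed

text \<open>Along the line x + t A x the form is a polynomial in t with value 0 and slope 2 |A x|^2
  at t = 0; nonnegativity for small negative t forces the slope to vanish.\<close>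

lemma psd_diagonal_zero: "psd A \<Longrightarrow> x \<bullet> (A *v x) = 0 \<Longrightarrow> A *v x = 0"
proof -
  assume A: "psd A" and x: "x \<bullet> (A *v x) = 0"
  define y where "y = A *v x"
  define c where "c = y \<bullet> (A *v y)"
  have q: "0 \<le> 2 * t * (y \<bullet> y) + t\<^sup>2 * c" for t
  proof -
    have "0 \<le> (x + t *\<^sub>R y) \<bullet> (A *v (x + t *\<^sub>R y))" by (rule psd_nonneg[OF A])
    also have "\<dots> = 2 * t * (y \<bullet> (A *v x)) + t\<^sup>2 * c"
      using x psd_inner_sym[OF A, of x y]
      by (simp add: c_def matrix_vector_right_distrib matrix_vector_mult_scaleR inner_add_left
          inner_add_right power2_eq_square algebra_simps)
    finally show ?thesis by (simp add: y_def)
  qed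
  have c: "0 \<le> c" unfolding c_def by (rule psd_nonneg[OF A])
  have "y \<bullet> y = 0"
  proof (rule ccontr)
    assume "y \<bullet> y \<noteq> 0"
    then have p: "0 < y \<bullet> y" by simp
    \<comment> \<open>The \<open>+ 1\<close> keeps the denominator positive when \<open>c\<close> is
      0; the choice gives t * c >= - (y . y), so the linear term dominates.\<close>
    define t where "t = - (y \<bullet> y) / (c + 1)"
    have "t < 0" using p c by (simp add: t_def divide_neg_pos)
    moreover have "2 * t * (y \<bullet> y) + t\<^sup>2 * c = t * (2 * (y \<bullet> y) + t * c)"
      by (simp add: power2_eq_square algebra_simps)
    moreover have "t * c \<ge> - (y \<bullet> y)"
      using p c by (simp add: t_def field_simps)
    ultimately have "2 * t * (y \<bullet> y) + t\<^sup>2 * c < 0"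
      using p mult_neg_pos[of t "2 * (y \<bullet> y) + t * c"] by linarith
    with q[of t] show False by simp
  qed
  then show ?thesis by (simp add: y_def)
qed

lemma rank_one_mult: "(\<chi> i j. v $ i * w $ j) *v x = (w \<bullet> x) *\<^sub>R v"
  for v :: "real^'n" and w x :: "real^'m"
  by (simp add: vec_eq_iff matrix_vector_mult_def inner_vec_def sum_distrib_left mult_ac)

lemma psd_rank_one: "psd (\<chi> i j. v $ i * v $ j)"
proof -
  have "0 \<le> x \<bullet> ((v \<bullet> x) *\<^sub>R v)" for x by (simp add: inner_commute[of x v])
  then show ?thesis
    by (simp add: psd_def rank_one_mult) (simp add: transpose_def vec_eq_iff mult.commute)
qed

lemma trace_mult_rank_one: "trace (A ** (\<chi> i j. v $ i * v $ j)) = v \<bullet> (A *v v)"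
  for A :: "real^'n^'n"
  by (simp add: trace_def matrix_matrix_mult_def inner_vec_def matrix_vector_mult_def
      sum_distrib_left mult_ac)

text \<open>The test vectors e_i + e_j and e_i - e_j bound the entry by the mean of two diagonal
  entries. Together with \<open>norm_matrix_le\<close> this turns a bound on the trace into a bound
  on the norm, which makes the domain of the dual problem compact.\<close>

lemma psd_entry_le:
  assumes "psd A" shows "\<bar>A $ i $ j\<bar> \<le> trace A"
proof -
  have d: "0 \<le> A $ k $ k" for k
    using psd_nonneg[OF assms, of "axis k 1"] by (simp only: inner_axis_matrix)
  have s: "A $ i $ j = A $ j $ i"
    using psd_inner_sym[OF assms, of "axis i 1" "axis j 1"] by (simp only: inner_axis_matrix)
  have "0 \<le> A $ i $ i + A $ j $ j + 2 * A $ i $ j"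
    using psd_nonneg[OF assms, of "axis i 1 + axis j 1"] s
    by (simp add: matrix_vector_right_distrib inner_add_left inner_add_right inner_axis_matrix)
  moreover have "0 \<le> A $ i $ i + A $ j $ j - 2 * A $ i $ j"
    using psd_nonneg[OF assms, of "axis i 1 - axis j 1"] s
    by (simp add: matrix_vector_mult_diff_distrib inner_diff_left inner_diff_right inner_axis_matrix)
  moreover have "A $ k $ k \<le> trace A" for k
    unfolding trace_def using d by (intro member_le_sum) auto
  from this[of i] this[of j] have "A $ i $ i + A $ j $ j \<le> 2 * trace A" by simp
  ultimately show ?thesis by simp
qed

lemma norm_matrix_le:
  fixes A :: "real^'n^'m"
  assumes "\<And>i j. \<bar>A $ i $ j\<bar> \<le> c"
  shows "norm A \<le> real CARD('m) * (real CARD('n) * c)"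
proof -
  have "norm A \<le> (\<Sum>i\<in>UNIV. norm (A $ i))" unfolding norm_vec_def by (rule L2_set_le_sum) simp
  also have "\<dots> \<le> (\<Sum>i\<in>(UNIV::'m set). real CARD('n) * c)"
  proof (rule sum_mono)
    fix i
    have "norm (A $ i) \<le> (\<Sum>j\<in>UNIV. \<bar>A $ i $ j\<bar>)" by (rule norm_le_l1_cart)
    also have "\<dots> \<le> (\<Sum>j\<in>(UNIV::'n set). c)" by (rule sum_mono) (rule assms)
    finally show "norm (A $ i) \<le> real CARD('n) * c" by simp
  qed
  finally show ?thesis by simp
qed

section \<open>Continuity of matrix operations, and inverses of matrices above the identity\<close>

lemma continuous_matrix_vector [continuous_intros]:
  "continuous_on S f \<Longrightarrow> continuous_on S (\<lambda>z. f z *v x)" for f :: "'a::topological_space \<Rightarrow> real^'n^'m"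
  unfolding matrix_vector_mult_def by (intro continuous_intros)

lemma continuous_matrix_mult [continuous_intros]:
  "continuous_on S f \<Longrightarrow> continuous_on S g \<Longrightarrow> continuous_on S (\<lambda>z. f z ** g z)"
  for f :: "'a::topological_space \<Rightarrow> real^'n^'m" and g :: "'a \<Rightarrow> real^'p^'n"
  unfolding matrix_matrix_mult_def by (intro continuous_intros)

lemma continuous_trace [continuous_intros]:
  "continuous_on S f \<Longrightarrow> continuous_on S (\<lambda>z. trace (f z))"
  for f :: "'a::topological_space \<Rightarrow> real^'n^'n"
  unfolding trace_def by (intro continuous_intros)

text \<open>The shift \<open>B\<close> lets one lemma cover both the cone itself (\<open>B\<close>
  zero) and the dual constraint set (\<open>B\<close> the identity).\<close>

lemma closed_psd: "closed {A. psd (A - B)}"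
proof -
  have "closed {A. \<forall>i j. A $ j $ i - B $ j $ i = A $ i $ j - B $ i $ j}"
    by (intro closed_Collect_all closed_Collect_eq continuous_intros)
  moreover have "closed {A. \<forall>x. 0 \<le> x \<bullet> ((A - B) *v x)}"
    by (intro closed_Collect_all closed_Collect_le continuous_intros)
  moreover have "{A. psd (A - B)} = {A. \<forall>i j. A $ j $ i - B $ j $ i = A $ i $ j - B $ i $ j}
      \<inter> {A. \<forall>x. 0 \<le> x \<bullet> ((A - B) *v x)}"
    by (auto simp: psd_def transpose_def vec_eq_iff)
  ultimately show ?thesis by auto
qed

lemma psd_norm_le_mult:
  assumes "psd (A - mat 1)" shows "norm x \<le> norm (A *v x)"
proof (cases "x = 0")
  case False
  have "0 \<le> x \<bullet> (A *v x) - x \<bullet> x"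
    using psd_nonneg[OF assms, of x] by (simp add: matrix_vector_mult_diff_rdistrib inner_diff_right)
  then have "norm x * norm x \<le> x \<bullet> (A *v x)" by (simp add: norm_eq_square power2_eq_square dot_square_norm)
  also have "\<dots> \<le> norm x * norm (A *v x)" by (rule norm_cauchy_schwarz)
  finally show ?thesis using False by simp
qed simp

text \<open>By \<open>psd_norm_le_mult\<close> the matrix is expanding, hence injective, hence
  invertible in finite dimension, and its inverse is a contraction.\<close>

lemma psd_ge_1_inverse:
  fixes A :: "real^'n^'n"
  assumes "psd (A - mat 1)"
  shows "A ** matrix_inv A = mat 1" "matrix_inv A ** A = mat 1"
    "norm (matrix_inv A *v x) \<le> norm x"
proof -
  have "inj ((*v) A)"
  proof (rule injI)
    fix x y assume "A *v x = A *v y"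
    then have "A *v (x - y) = 0" by (simp add: matrix_vector_mult_diff_distrib)
    with psd_norm_le_mult[OF assms, of "x - y"] show "x = y" by simp
  qed
  then have "\<exists>B. B ** A = mat 1" by (simp add: matrix_left_invertible_injective)
  then have "\<exists>B. A ** B = mat 1 \<and> B ** A = mat 1" using matrix_left_right_inverse by blast
  from someI_ex[OF this] show *: "A ** matrix_inv A = mat 1" "matrix_inv A ** A = mat 1"
    unfolding matrix_inv_def by auto
  show "norm (matrix_inv A *v x) \<le> norm x"
    using psd_norm_le_mult[OF assms, of "matrix_inv A *v x"] by (simp add: matrix_vector_mul_assoc *)
qed

lemma continuous_on_matrix_inv:
  fixes S :: "(real^'n^'n) set"
  assumes "\<And>A. A \<in> S \<Longrightarrow> psd (A - mat 1)"
  shows "continuous_on S matrix_inv"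
  unfolding continuous_on_def
proof
  fix A assume A: "A \<in> S"
  show "(matrix_inv \<longlongrightarrow> matrix_inv A) (at A within S)"
  proof (intro vec_tendstoI)
    fix i j
    let ?w = "matrix_inv A *v axis j 1"
    have ev: "\<forall>\<^sub>F B in at A within S. norm (matrix_inv B $ i $ j - matrix_inv A $ i $ j)
        \<le> norm (A *v ?w - B *v ?w)"
      unfolding eventually_at_filter
    proof (rule always_eventually, intro allI impI)
      fix B assume "B \<in> S"
      then have B: "psd (B - mat 1)" by (rule assms)
      have "matrix_inv B *v (A *v ?w - B *v ?w) = matrix_inv B *v axis j 1 - ?w"
        by (simp add: matrix_vector_mult_diff_distrib matrix_vector_mul_assoc matrix_mul_assoc
            psd_ge_1_inverse[OF B] psd_ge_1_inverse[OF assms[OF A]])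
      then have "norm (matrix_inv B *v axis j 1 - ?w) \<le> norm (A *v ?w - B *v ?w)"
        by (metis psd_ge_1_inverse(3)[OF B])
      moreover have "norm (matrix_inv B $ i $ j - matrix_inv A $ i $ j)
          \<le> norm (matrix_inv B *v axis j 1 - ?w)"
        using component_le_norm_cart[of "matrix_inv B *v axis j 1 - ?w" i]
        by (simp add: matrix_vector_mul_component inner_axis)
      ultimately show "norm (matrix_inv B $ i $ j - matrix_inv A $ i $ j)
          \<le> norm (A *v ?w - B *v ?w)" by simp
    qed
    have "continuous_on S (\<lambda>B. norm (A *v ?w - B *v ?w))"
      by (intro continuous_intros)
    then have "((\<lambda>B. norm (A *v ?w - B *v ?w)) \<longlongrightarrow> 0) (at A within S)"
      using A by (force simp: continuous_on_def)
    then have "((\<lambda>B. matrix_inv B $ i $ j - matrix_inv A $ i $ j) \<longlongrightarrow> 0) (at A within S)"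
      by (rule Lim_null_comparison[OF ev])
    then show "((\<lambda>B. matrix_inv B $ i $ j) \<longlongrightarrow> matrix_inv A $ i $ j) (at A within S)"
      by (rule LIM_zero_cancel)
  qed
qed

lemma trace_diag_matrix: "trace (A ** diag_matrix l) = (\<Sum>i\<in>UNIV. A $ i $ i * l i)"
  by (simp add: trace_def matrix_matrix_mult_def diag_matrix_def if_distrib cong: if_cong)

lemma diag_matrix_mult_vec: "(diag_matrix l *v x) $ i = l i * x $ i"
  by (simp add: diag_matrix_def matrix_vector_mult_def if_distrib if_distribR cong: if_cong)

lemma psd_diag_matrix:
  assumes "\<And>i. 0 \<le> l i" shows "psd (diag_matrix l)"
proof -
  have "0 \<le> x \<bullet> (diag_matrix l *v x)" for x
    unfolding inner_vec_def diag_matrix_mult_vec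
    by (intro sum_nonneg) (use assms in \<open>auto simp: mult.left_commute[of _ "l _"]\<close>)
  then show ?thesis by (auto simp: psd_def diag_matrix_def transpose_def vec_eq_iff)
qed

subsection \<open>Dual certificates and square roots\<close>

lemma psd_cauchy_schwarz:
  assumes A: "psd A" shows "(x \<bullet> (A *v y))\<^sup>2 \<le> (x \<bullet> (A *v x)) * (y \<bullet> (A *v y))"
proof (cases "y \<bullet> (A *v y) = 0")
  case True
  then show ?thesis using psd_diagonal_zero[OF A True] by simp
next
  case False
  define a b where "a = y \<bullet> (A *v y)" and "b = x \<bullet> (A *v y)"
  have a: "0 < a" using False psd_nonneg[OF A, of y] by (simp add: a_def)
  \<comment> \<open>This vector is \<open>a\<close> times the part of \<open>x\<close> that is
    orthogonal to \<open>y\<close> for the form of \<open>A\<close>.\<close>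
  have "0 \<le> (a *\<^sub>R x - b *\<^sub>R y) \<bullet> (A *v (a *\<^sub>R x - b *\<^sub>R y))" by (rule psd_nonneg[OF A])
  also have "\<dots> = a * (a * (x \<bullet> (A *v x)) - b\<^sup>2)"
    using psd_inner_sym[OF A, of y x]
    by (simp add: matrix_vector_mult_diff_distrib matrix_vector_mult_scaleR inner_diff_left
        inner_diff_right a_def b_def power2_eq_square algebra_simps)
  finally show ?thesis using a by (simp add: zero_le_mult_iff a_def b_def mult.commute)
qed

text \<open>Cholesky: subtracting \<open>w w\<^sup>T\<close> with \<open>w = A e\<^sub>j / \<surd>A\<^sub>j\<^sub>j\<close> puts \<open>e\<^sub>j\<close> into the
  kernel and keeps what is already there.\<close>

lemma psd_sum_rank_one:
  fixes A :: "real^'n^'n"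
  assumes "psd A"
  obtains w :: "'n \<Rightarrow> real^'n" where "A = (\<Sum>k\<in>UNIV. \<chi> i j. w k $ i * w k $ j)"
proof -
  let ?R = "\<lambda>v. (\<chi> i j. v $ i * v $ j) :: real^'n^'n"
  have "\<exists>w. psd (A - (\<Sum>k\<in>F. ?R (w k))) \<and> (\<forall>k\<in>F. (A - (\<Sum>k\<in>F. ?R (w k))) *v axis k 1 = 0)"
    if "finite F" for F :: "'n set"
    using that
  proof induction
    case empty
    then show ?case using assms by simp
  next
    case (insert j F)
    then obtain w where w: "psd (A - (\<Sum>k\<in>F. ?R (w k)))"
      "\<And>k. k \<in> F \<Longrightarrow> (A - (\<Sum>k\<in>F. ?R (w k))) *v axis k 1 = 0" by blast
    define B where "B = A - (\<Sum>k\<in>F. ?R (w k))"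
    note w = w[folded B_def]
    define a where "a = axis j 1 \<bullet> (B *v axis j 1)"
    define v where "v = (1 / sqrt a) *\<^sub>R (B *v axis j 1)"
    have a: "0 \<le> a" unfolding a_def by (rule psd_nonneg[OF w(1)])
    have v_inner: "v \<bullet> x = (axis j 1 \<bullet> (B *v x)) / sqrt a" for x
      using psd_inner_sym[OF w(1), of x "axis j 1"] by (simp add: v_def inner_commute)
    have "psd (B - ?R v)"
    proof -
      have "(v \<bullet> x)\<^sup>2 \<le> x \<bullet> (B *v x)" for x
      proof (cases "a = 0")
        case False
        then have "(v \<bullet> x)\<^sup>2 = (axis j 1 \<bullet> (B *v x))\<^sup>2 / a"
          using a by (simp add: v_inner power_divide)
        also have "\<dots> \<le> x \<bullet> (B *v x)"
          using psd_cauchy_schwarz[OF w(1), of "axis j 1" x] False a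
          by (simp add: a_def field_simps)
        finally show ?thesis .
      qed (simp add: v_def psd_nonneg[OF w(1)])
      then show ?thesis
        using psd_transpose[OF w(1)] psd_transpose[OF psd_rank_one[of v]]
        by (simp add: psd_def transpose_diff matrix_vector_mult_diff_rdistrib rank_one_mult
            inner_diff_right power2_eq_square inner_commute[of _ v])
    qed
    moreover have "(B - ?R v) *v axis j 1 = 0"
    proof (cases "a = 0")
      case True
      then have "B *v axis j 1 = 0" using psd_diagonal_zero[OF w(1)] by (simp add: a_def)
      then show ?thesis
        by (subst matrix_vector_mult_diff_rdistrib, subst rank_one_mult) (simp add: v_def)
    next
      case False
      then show ?thesis using a
        by (simp add: matrix_vector_mult_diff_rdistrib rank_one_mult v_inner)
           (simp add: v_def a_def[symmetric] real_div_sqrt)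
    qed
    moreover have "(B - ?R v) *v axis k 1 = 0" if "k \<in> F" for k
      using w(2)[OF that] by (simp add: matrix_vector_mult_diff_rdistrib rank_one_mult v_inner)
    moreover have "A - (\<Sum>k\<in>insert j F. ?R ((w(j := v)) k)) = B - ?R v"
    proof -
      have "(\<Sum>k\<in>F. ?R ((w(j := v)) k)) = (\<Sum>k\<in>F. ?R (w k))"
        using insert.hyps by (intro sum.cong) auto
      then show ?thesis using insert.hyps by (simp add: B_def)
    qed
    ultimately show ?case
      by (intro exI[of _ "w(j := v)"]) auto
  qed
  from this[OF finite[of UNIV]] obtain w :: "'n \<Rightarrow> real^'n" where
    "psd (A - (\<Sum>k\<in>UNIV. ?R (w k))) \<and> (\<forall>k\<in>UNIV. (A - (\<Sum>k\<in>UNIV. ?R (w k))) *v axis k 1 = 0)"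
    by blast
  then have "A - (\<Sum>k\<in>UNIV. ?R (w k)) = 0" unfolding matrix_eq_0_axis by blast
  then show ?thesis using that[of w] by simp
qed

text \<open>With B a sum of w_k w_k^T, the trace is a sum of nonnegative numbers w_k . A w_k. If it
  vanishes, each A w_k vanishes and so does the product: complementary slackness in matrix
  form.\<close>

lemma psd_trace_mult:
  fixes A B :: "real^'n^'n"
  assumes A: "psd A" and B: "psd B"
  shows "0 \<le> trace (A ** B)" and "trace (A ** B) = 0 \<Longrightarrow> A ** B = 0"
proof -
  obtain w :: "'n \<Rightarrow> real^'n" where w: "B = (\<Sum>k\<in>UNIV. \<chi> i j. w k $ i * w k $ j)"
    using psd_sum_rank_one[OF B] .
  have sum: "A ** sum f S = (\<Sum>k\<in>S. A ** f k)" if "finite S" for S :: "'n set" and f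
    using that by induction (auto simp: matrix_add_ldistrib)
  have tr_sum: "trace (sum f S) = (\<Sum>k\<in>S. trace (f k :: real^'n^'n))" if "finite S" for S :: "'n set" and f
    unfolding trace_def by (simp, rule sum.swap)
  have tr: "trace (A ** B) = (\<Sum>k\<in>UNIV. w k \<bullet> (A *v w k))"
    unfolding w by (simp add: sum tr_sum trace_mult_rank_one)
  show "0 \<le> trace (A ** B)"
    unfolding tr by (intro sum_nonneg psd_nonneg[OF A])
  assume "trace (A ** B) = 0"
  then have "w k \<bullet> (A *v w k) = 0" for k
    unfolding tr using psd_nonneg[OF A] by (simp add: sum_nonneg_eq_0_iff)
  then have "A *v w k = 0" for k by (intro psd_diagonal_zero[OF A])
  moreover have "A ** (\<chi> i j. w k $ i * w k $ j) = (\<chi> i j. (A *v w k) $ i * w k $ j)" for k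
    by (simp add: vec_eq_iff matrix_matrix_mult_def matrix_vector_mult_def sum_distrib_left mult_ac)
  ultimately show "A ** B = 0"
    unfolding w by (simp add: sum vec_eq_iff)
qed

text \<open>The dual of minimising the transport cost from the covariance \<open>L\<close> over all covariances
  \<open>\<ge> S\<close>. The conclusion is its first-order optimality condition: the optimal covariance is
  \<open>T ** L ** T\<close>.\<close>

lemma dual_optimum:
  fixes S :: "real^'n^'n" and l :: "'n \<Rightarrow> real"
  assumes S: "psd S" and l: "\<And>i. 0 < l i"
  defines "L \<equiv> diag_matrix l"
  obtains T W where "psd (T - mat 1)" "T ** W = mat 1" "W ** T = mat 1"
    "psd (L - W ** S ** W)" "(T - mat 1) ** (L - W ** S ** W) = 0"
proof -
  define H where "H T = trace (T ** L) + trace (matrix_inv T ** S)" for T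
  \<comment> \<open>Outside \<open>X\<close> the value of \<open>H\<close> exceeds
    \<open>H (mat 1)\<close>, because the other trace is nonnegative; so a minimum over
    \<open>X\<close> is one over all T >= 1. \<open>X\<close> is bounded because L >= c controls the
    trace of T.\<close>
  define X where "X = {T. psd (T - mat 1)} \<inter> {T. trace (T ** L) \<le> H (mat 1)}"
  define c where "c = Min (range l)"
  have c: "0 < c" "\<And>i. c \<le> l i" using l by (auto simp: c_def)
  have inv1: "matrix_inv (mat 1 :: real^'n^'n) = mat 1"
    using psd_ge_1_inverse(1)[of "mat 1 :: real^'n^'n"] psd_0 by simp
  have pos: "psd T" if "psd (T - mat 1)" for T :: "real^'n^'n"
    using psd_add[OF that psd_mat1] by simp
  have inv_sym: "transpose (matrix_inv T) = matrix_inv T" if T: "psd (T - mat 1)" for T :: "real^'n^'n"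
  proof -
    have "transpose (matrix_inv T) ** T = mat 1"
      using arg_cong[OF psd_ge_1_inverse(1)[OF T], of transpose] psd_transpose[OF pos[OF T]]
      by (simp add: matrix_transpose_mul)
    then show ?thesis
      by (metis psd_ge_1_inverse(1)[OF T] matrix_mul_assoc matrix_mul_lid matrix_mul_rid)
  qed
  have inv_S: "0 \<le> trace (matrix_inv T ** S)" if T: "psd (T - mat 1)" for T :: "real^'n^'n"
  proof -
    let ?W = "matrix_inv T"
    have "psd (transpose ?W ** T ** ?W)" by (rule psd_congruence[OF pos[OF T]])
    then have "psd ?W" by (simp add: inv_sym[OF T] psd_ge_1_inverse[OF T])
    then show ?thesis using S by (rule psd_trace_mult)
  qed
  have bnd: "norm T \<le> real CARD('n) * (real CARD('n) * (H (mat 1) / c))" if "T \<in> X" for T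
  proof (rule norm_matrix_le)
    fix i j
    have T: "psd T" "trace (T ** L) \<le> H (mat 1)" using that pos by (auto simp: X_def)
    have d: "0 \<le> T $ k $ k" for k
      using psd_nonneg[OF T(1), of "axis k 1"] by (simp only: inner_axis_matrix)
    have "c * trace T \<le> trace (T ** L)"
      unfolding L_def trace_diag_matrix unfolding trace_def sum_distrib_left
      by (intro sum_mono) (metis c(2) d mult.commute mult_right_mono)
    then have "trace T \<le> H (mat 1) / c" using T(2) c(1) by (simp add: field_simps)
    with psd_entry_le[OF T(1), of i j] show "\<bar>T $ i $ j\<bar> \<le> H (mat 1) / c" by simp
  qed
  have "closed X" unfolding X_def
    by (intro closed_Int closed_psd closed_Collect_le continuous_intros)
  moreover have "bounded X" unfolding bounded_iff using bnd by blast
  ultimately have "compact X" by (simp add: compact_eq_bounded_closed)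
  moreover have "mat 1 \<in> X"
    using psd_trace_mult(1)[OF psd_mat1 S] psd_0 by (simp add: X_def H_def inv1)
  moreover have "continuous_on X H"
    unfolding H_def by (intro continuous_intros continuous_on_matrix_inv) (auto simp: X_def)
  ultimately obtain T where T: "T \<in> X" "\<And>T'. T' \<in> X \<Longrightarrow> H T \<le> H T'"
    using continuous_attains_inf[of X H] by blast
  have T1: "psd (T - mat 1)" using T(1) by (simp add: X_def)
  have opt: "H T \<le> H T'" if T': "psd (T' - mat 1)" for T'
  proof (cases "T' \<in> X")
    case False
    then have "H (mat 1) < trace (T' ** L)" using T' by (simp add: X_def)
    then show ?thesis using T(2)[OF \<open>mat 1 \<in> X\<close>] inv_S[OF T'] by (simp add: H_def)
  qed (rule T(2))
  define W where "W = matrix_inv T"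
  note TW = psd_ge_1_inverse(1,2)[OF T1, folded W_def]
  define N where "N = L - W ** S ** W"
  \<comment> \<open>\<open>N\<close> is the gradient of \<open>H\<close> at \<open>T\<close>. The
    derivative has a sign only in directions along which T + t E stays feasible for small t.\<close>
  have foc: "0 \<le> trace (E ** N)"
    if E: "\<And>t. 0 \<le> t \<Longrightarrow> t \<le> d \<Longrightarrow> psd (T + t *\<^sub>R E - mat 1)" and "0 < d" for E d
  proof -
    \<comment> \<open>For positive t this is the difference quotient of \<open>H\<close> in
      direction \<open>E\<close>, rewritten by the resolvent identity so that it extends
      continuously to t = 0.\<close>
    define f where "f t = trace (E ** L) - trace (W ** E ** matrix_inv (T + t *\<^sub>R E) ** S)" for t
    have f0: "f 0 = trace (E ** N)"
      using trace_mul_sym[of "W" "E ** W ** S"] trace_mul_sym[of "E ** W ** S" W]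
      by (simp add: f_def N_def W_def[symmetric] matrix_diff_ldistrib trace_sub matrix_mul_assoc)
    have f_nonneg: "0 \<le> f t" if t: "0 < t" "t \<le> d" for t
    proof -
      let ?T = "T + t *\<^sub>R E"
      let ?W = "matrix_inv ?T"
      have T': "psd (?T - mat 1)" using E t by simp
      note TW' = psd_ge_1_inverse(1,2)[OF T']
      have "W ** (A - T) ** B = W - B" if "A ** B = mat 1" for A B
        using that by (simp add: matrix_diff_ldistrib matrix_diff_rdistrib TW)
           (simp add: matrix_mul_assoc[symmetric])
      from this[OF TW'(1)] have "?W = W - t *\<^sub>R (W ** E ** ?W)"
        by (simp add: matrix_scaleR_left matrix_scaleR_right)
      then have "trace (?W ** S) = trace (W ** S) - t * trace (W ** E ** ?W ** S)"
        by (metis matrix_diff_rdistrib matrix_scaleR_left trace_scaleR trace_sub)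
      then have "H ?T - H T = t * f t"
        by (simp add: H_def f_def matrix_add_rdistrib matrix_scaleR_left trace_add trace_scaleR
            W_def[symmetric] algebra_simps)
      moreover have "H T \<le> H ?T" by (rule opt[OF T'])
      ultimately have "0 \<le> t * f t" by linarith
      then show ?thesis using t by (simp add: zero_le_mult_iff)
    qed
    have "continuous_on {0..d} f" unfolding f_def
    proof (intro continuous_intros continuous_on_compose2[OF continuous_on_matrix_inv])
      show "(\<lambda>t. T + t *\<^sub>R E) ` {0..d} \<subseteq> {A. psd (A - mat 1)}" using E by auto
    qed auto
    then have "(f \<longlongrightarrow> f 0) (at 0 within {0..d})"
      using \<open>0 < d\<close> by (auto simp: continuous_on_def)
    moreover have "\<forall>\<^sub>F t in at 0 within {0..d}. 0 \<le> f t"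
      unfolding eventually_at_filter using f_nonneg by (intro always_eventually) auto
    moreover have "at 0 within {0..d} \<noteq> bot"
      using \<open>0 < d\<close> by (simp add: trivial_limit_within islimpt_Icc)
    ultimately have "0 \<le> f 0" by (metis tendsto_lowerbound)
    then show ?thesis by (simp add: f0)
  qed
  have foc_psd: "0 \<le> trace (E ** N)" if E: "psd E" for E
  proof (rule foc)
    show "psd (T + t *\<^sub>R E - mat 1)" if "0 \<le> t" "t \<le> 1" for t
      using psd_add[OF T1 psd_scaleR[OF E that(1)]] by (simp add: algebra_simps)
  qed simp
  have W_sym: "transpose W = W" unfolding W_def by (rule inv_sym[OF T1])
  have N_psd: "psd N"
    unfolding psd_def
  proof (intro conjI allI)
    show "transpose N = N"
      using psd_diag_matrix[of l] l psd_transpose[OF S]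
      by (simp add: N_def transpose_diff matrix_transpose_mul W_sym L_def psd_transpose less_imp_le
          matrix_mul_assoc)
    show "0 \<le> x \<bullet> (N *v x)" for x
      using foc_psd[OF psd_rank_one, of x] trace_mul_sym[of N "\<chi> i j. x $ i * x $ j"]
      by (simp add: trace_mult_rank_one)
  qed
  have TN: "(T - mat 1) ** N = 0"
  proof -
    let ?P = "T - mat 1"
    \<comment> \<open>Shrinking \<open>T\<close> towards the identity stays feasible. This gives the
      sign opposite to that of \<open>psd_trace_mult\<close>, so the trace of the product is
      0.\<close>
    have "0 \<le> trace (- ?P ** N)"
    proof (rule foc)
      show "psd (T + t *\<^sub>R - ?P - mat 1)" if "0 \<le> t" "t \<le> 1" for t
        using psd_scaleR[OF T1, of "1 - t"] that by (simp add: algebra_simps)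
    qed simp
    moreover have "trace (- ?P ** N) = - trace (?P ** N)"
      using trace_scaleR[of "- 1" "?P ** N"] matrix_scaleR_left[of "- 1" ?P N]
      by (simp del: minus_diff_eq)
    ultimately have le: "trace (?P ** N) \<le> 0" by simp
    with psd_trace_mult[OF T1 N_psd] show ?thesis by simp
  qed
  show ?thesis using that[OF T1 TW] N_psd TN by (simp add: N_def)
qed

section \<open>Existence and uniqueness of the positive semi-definite square root\<close>

lemma psd_sqrt_exists_shift:
  fixes M :: "real^'n^'n"
  assumes M: "psd M" and d: "0 < d"
  shows "\<exists>R. psd R \<and> R ** R = M + d *\<^sub>R mat 1"
proof -
  \<comment> \<open>After this scaling S >= 2. At the dual optimum with L = 1 the matrix T T - S is
    positive semi-definite, so T x = x would give |x|^2 >= 2 |x|^2. Hence T - 1 is invertible and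
    complementary slackness yields T T = S; the factor \<open>sqrt (d / 2)\<close> undoes the
    scaling.\<close>
  define S where "S = (2 / d) *\<^sub>R (M + d *\<^sub>R mat 1)"
  have S2: "psd (S - 2 *\<^sub>R mat 1)"
  proof -
    have "S - 2 *\<^sub>R mat 1 = (2 / d) *\<^sub>R M"
      using d by (simp add: S_def scaleR_add_right)
    then show ?thesis using psd_scaleR[OF M, of "2 / d"] d by simp
  qed
  have S: "psd S" using psd_add[OF S2 psd_scaleR[OF psd_mat1, of 2]] by simp
  have L: "diag_matrix (\<lambda>_. 1) = (mat 1 :: real^'n^'n)"
    by (simp add: diag_matrix_def mat_def)
  obtain T W where T: "psd (T - mat 1)" "T ** W = mat 1" "W ** T = mat 1"
    and N: "psd (mat 1 - W ** S ** W)" "(T - mat 1) ** (mat 1 - W ** S ** W) = 0"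
    using dual_optimum[OF S, of "\<lambda>_. 1"] unfolding L by auto
  let ?N = "mat 1 - W ** S ** W"
  have T0: "psd T" using psd_add[OF T(1) psd_mat1] by simp
  have TNT: "T ** ?N ** T = T ** T - S"
  proof -
    have "T ** (W ** S ** W) ** T = (T ** W) ** S ** (W ** T)" by (simp add: matrix_mul_assoc)
    then show ?thesis by (simp add: matrix_diff_ldistrib matrix_diff_rdistrib T)
  qed
  have "inj ((*v) (T - mat 1))"
  proof -
    have "x = 0" if "(T - mat 1) *v x = 0" for x
    proof -
      have x: "T *v x = x" using that by (simp add: matrix_vector_mult_diff_rdistrib)
      have "0 \<le> x \<bullet> ((T ** ?N ** T) *v x)"
        using psd_nonneg[OF psd_congruence[OF N(1), of T], of x] psd_transpose[OF T0] by simp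
      also have "\<dots> = x \<bullet> x - x \<bullet> (S *v x)"
        unfolding TNT
        by (simp add: matrix_vector_mult_diff_rdistrib matrix_vector_mul_assoc[symmetric] x inner_diff_right)
      also have "\<dots> \<le> x \<bullet> x - 2 * (x \<bullet> x)"
        using psd_nonneg[OF S2, of x]
        by (simp add: matrix_vector_mult_diff_rdistrib scaleR_matrix_vector_assoc[symmetric] inner_diff_right)
      finally have "x \<bullet> x \<le> 0" by simp
      then show ?thesis by (metis inner_gt_zero_iff not_less)
    qed
    then show ?thesis
      by (auto simp: linear_injective_0)
  qed
  then have "\<exists>B. B ** (T - mat 1) = mat 1" by (simp add: matrix_left_invertible_injective)
  then have "?N = 0"
    using N(2) by (metis matrix_mul_assoc matrix_mul_lid times0_right)
  then have TT: "T ** T = S" using TNT by simp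
  define R where "R = sqrt (d / 2) *\<^sub>R T"
  have "R ** R = (d / 2) *\<^sub>R S"
    using d by (simp add: R_def matrix_scaleR_left matrix_scaleR_right TT)
  also have "\<dots> = M + d *\<^sub>R mat 1" using d by (simp add: S_def)
  finally show ?thesis using psd_scaleR[OF T0, of "sqrt (d / 2)"] d by (auto simp: R_def)
qed

text \<open>The roots of M + d are bounded as d tends to 0, since the squared norms of the columns
  of R are the diagonal entries of R R. A limit point is a root of M, and it stays in the cone
  because the cone is closed.\<close>

lemma psd_sqrt_exists:
  fixes M :: "real^'n^'n"
  assumes M: "psd M"
  shows "\<exists>R. psd R \<and> R ** R = M"
proof -
  define d where "d k = inverse (real (Suc k))" for k
  have "\<exists>R. psd R \<and> R ** R = M + d k *\<^sub>R mat 1" for k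
    by (rule psd_sqrt_exists_shift[OF M]) (simp add: d_def)
  then obtain R where R: "\<And>k. psd (R k)" "\<And>k. R k ** R k = M + d k *\<^sub>R mat 1" by metis
  define c where "c = 1 + trace M + real CARD('n)"
  have "\<bar>R k $ i $ j\<bar> \<le> c" for k i j
  proof -
    have "(R k $ i $ j)\<^sup>2 \<le> (\<Sum>i\<in>UNIV. (R k $ i $ j)\<^sup>2)"
      by (rule member_le_sum[of i UNIV "\<lambda>i. (R k $ i $ j)\<^sup>2"]) auto
    also have "\<dots> = axis j 1 \<bullet> ((R k ** R k) *v axis j 1)"
      using psd_transpose[OF R(1)[of k]] unfolding inner_axis_matrix
      by (simp add: matrix_matrix_mult_def power2_eq_square transpose_def vec_eq_iff)
    also have "\<dots> = M $ j $ j + d k"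
      unfolding R(2) inner_axis_matrix by (simp add: mat_def)
    also have "\<dots> \<le> c"
    proof -
      have "d k \<le> 1" by (simp add: d_def inverse_le_1_iff)
      then show ?thesis using psd_entry_le[OF M, of j j] by (simp add: c_def)
    qed
    finally have "(R k $ i $ j)\<^sup>2 \<le> c" .
    moreover have "1 \<le> c" using psd_entry_le[OF M, of j j] by (simp add: c_def)
    then have "c \<le> c\<^sup>2" by (simp add: power2_eq_square)
    ultimately have "(R k $ i $ j)\<^sup>2 \<le> c\<^sup>2" by simp
    then show ?thesis using \<open>1 \<le> c\<close> abs_le_square_iff[of "R k $ i $ j" c] by simp
  qed
  then have "norm (R k) \<le> real CARD('n) * (real CARD('n) * c)" for k by (rule norm_matrix_le)
  moreover have "closed {A :: real^'n^'n. psd A}" using closed_psd[of 0] by simp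
  ultimately have "compact ({A :: real^'n^'n. psd A} \<inter> cball 0 (real CARD('n) * (real CARD('n) * c)))"
    and "range R \<subseteq> {A. psd A} \<inter> cball 0 (real CARD('n) * (real CARD('n) * c))"
    using R(1) by (auto intro!: closed_Int_compact)
  then obtain r s where r: "psd r" "strict_mono s" "(R \<circ> s) \<longlonglongrightarrow> r"
    unfolding compact_def by blast
  have "continuous_on UNIV (\<lambda>A :: real^'n^'n. A ** A)"
    by (intro continuous_matrix_mult continuous_on_id)
  then have "isCont (\<lambda>A :: real^'n^'n. A ** A) r"
    by (simp add: continuous_on_eq_continuous_at)
  from isCont_tendsto_compose[OF this r(3)]
  have "(\<lambda>k. R (s k) ** R (s k)) \<longlonglongrightarrow> r ** r" by (simp add: o_def)
  moreover have "(\<lambda>k. M + d (s k) *\<^sub>R mat 1) \<longlonglongrightarrow> M + 0 *\<^sub>R mat 1"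
  proof -
    have "d \<longlonglongrightarrow> 0" unfolding d_def by (rule LIMSEQ_inverse_real_of_nat)
    from LIMSEQ_subseq_LIMSEQ[OF this r(2)] show ?thesis
      by (intro tendsto_intros) (simp add: o_def)
  qed
  ultimately have "r ** r = M" unfolding R(2) by (simp add: LIMSEQ_unique)
  with r(1) show ?thesis by blast
qed

lemma psd_sqrt_unique:
  fixes R S :: "real^'n^'n"
  assumes R: "psd R" and S: "psd S" and eq: "R ** R = S ** S"
  shows "R = S"
proof -
  define D where "D = R - S"
  have tD: "transpose D = D" by (simp add: D_def transpose_diff psd_transpose R S)
  \<comment> \<open>R R - S S splits in this way. Multiplying by \<open>D\<close> and taking the
    trace gives two nonnegative terms with sum 0, whence R D = S D = 0 and finally D D = 0.\<close>
  have "R ** D + D ** S = 0" using eq by (simp add: D_def matrix_diff_ldistrib matrix_diff_rdistrib)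
  then have "trace (D ** (R ** D + D ** S)) = 0" by (simp add: trace_def)
  then have "trace (D ** R ** D) + trace (D ** S ** D) = 0"
    using trace_mul_sym[of "D ** S" D]
    by (simp add: matrix_add_ldistrib trace_add matrix_mul_assoc trace_mul_sym[of D "D ** S"])
  then have s: "(\<Sum>i\<in>UNIV. (D *v axis i 1) \<bullet> (R *v (D *v axis i 1)))
      + (\<Sum>i\<in>UNIV. (D *v axis i 1) \<bullet> (S *v (D *v axis i 1))) = 0"
    using trace_congruence[of D R] trace_congruence[of D S] by (simp add: tD)
  have nn: "0 \<le> (\<Sum>i\<in>UNIV. (D *v axis i 1) \<bullet> (A *v (D *v axis i 1)))" if "psd A" for A
    by (intro sum_nonneg psd_nonneg[OF that])
  have "A ** D = 0" if A: "psd A" and "(\<Sum>i\<in>UNIV. (D *v axis i 1) \<bullet> (A *v (D *v axis i 1))) = 0" for A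
  proof -
    have "(D *v axis i 1) \<bullet> (A *v (D *v axis i 1)) = 0" for i
      using that(2) psd_nonneg[OF A] by (simp add: sum_nonneg_eq_0_iff)
    then have "A *v (D *v axis i 1) = 0" for i by (intro psd_diagonal_zero[OF A])
    then show ?thesis unfolding matrix_eq_0_axis by (simp add: matrix_vector_mul_assoc)
  qed
  then have "R ** D = 0" "S ** D = 0"
    using R S s nn[OF R] nn[OF S] by (simp_all add: add_nonneg_eq_0_iff)
  then have "transpose D ** mat 1 ** D = 0" by (simp add: tD) (simp add: D_def matrix_diff_rdistrib)
  then have "(\<Sum>i\<in>UNIV. (D *v axis i 1) \<bullet> (mat 1 *v (D *v axis i 1))) = 0"
    unfolding trace_congruence[symmetric] by (simp add: trace_def)
  then have "D *v axis i 1 = 0" for i by (simp add: sum_nonneg_eq_0_iff)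
  then have "D = 0" unfolding matrix_eq_0_axis by blast
  then show ?thesis by (simp add: D_def)
qed

lemma psd_sqrt_eqI: "psd R \<Longrightarrow> R ** R = M \<Longrightarrow> psd_sqrt M = R"
  unfolding psd_sqrt_def by (rule the_equality) (auto intro: psd_sqrt_unique)

lemma
  assumes "psd M"
  shows psd_psd_sqrt: "psd (psd_sqrt M)" and psd_sqrt_mult: "psd_sqrt M ** psd_sqrt M = M"
  using psd_sqrt_exists[OF assms] by (metis psd_sqrt_eqI)+

subsection \<open>Characteristic functions on Euclidean space\<close>

definition std_gaussian :: "(real^'n) measure" where
  "std_gaussian = distr (\<Pi>\<^sub>M i\<in>UNIV. std_normal_distribution) borel (\<lambda>z. \<chi> i. z i)"

definition charfun :: "(real^'n) measure \<Rightarrow> real^'n \<Rightarrow> complex" where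
  "charfun M t = (CLINT x|M. iexp (t \<bullet> x))"

lemma prob_space_std_normal: "prob_space std_normal_distribution"
  by (rule prob_space_normal_density) simp

lemma measurable_vec_lambda_PiM [measurable]:
  "(\<lambda>z. \<chi> i. z i) \<in> (\<Pi>\<^sub>M i\<in>(UNIV::'n::finite set). std_normal_distribution) \<rightarrow>\<^sub>M borel"
proof (subst borel_measurable_euclidean_space, intro ballI)
  fix b :: "real^'n" assume "b \<in> Basis"
  then obtain i where b: "b = axis i 1" by (auto simp: Basis_vec_def)
  have "(\<lambda>z. z i) \<in> (\<Pi>\<^sub>M i\<in>(UNIV::'n set). std_normal_distribution) \<rightarrow>\<^sub>M std_normal_distribution"
    by (rule measurable_component_singleton) simp
  then show "(\<lambda>z. (\<chi> i. z i) \<bullet> b) \<in> borel_measurable (\<Pi>\<^sub>M i\<in>(UNIV::'n set). std_normal_distribution)"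
    by (simp add: b inner_axis)
qed

lemma prob_space_PiM_std_normal:
  "prob_space (\<Pi>\<^sub>M i\<in>(UNIV::'n::finite set). std_normal_distribution)"
  by (intro prob_space_PiM prob_space_std_normal)

lemma prob_space_std_gaussian: "prob_space std_gaussian"
  unfolding std_gaussian_def
  by (rule prob_space.prob_space_distr[OF prob_space_PiM_std_normal]) simp

lemma sets_std_gaussian [measurable_cong, simp]: "sets std_gaussian = sets borel"
  by (simp add: std_gaussian_def)

lemma space_std_gaussian [simp]: "space std_gaussian = UNIV"
  by (simp add: std_gaussian_def)

lemma borel_measurable_iexp [measurable]: "iexp \<in> borel_measurable borel"
  by (intro borel_measurable_continuous_onI continuous_intros)

lemma iexp_add: "iexp (x + y) = iexp x * iexp y"
  by (simp add: distrib_left exp_add)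

lemma charfun_std_gaussian: "charfun std_gaussian t = complex_of_real (exp (- (t \<bullet> t) / 2))"
proof -
  interpret product_sigma_finite "\<lambda>_::'n. std_normal_distribution"
    by (simp add: product_sigma_finite_def prob_space_imp_sigma_finite prob_space_std_normal)
  have "charfun std_gaussian t = (CLINT z|(\<Pi>\<^sub>M i\<in>UNIV. std_normal_distribution). iexp (t \<bullet> (\<chi> i. z i)))"
    unfolding charfun_def std_gaussian_def by (subst integral_distr) auto
  also have "\<dots> = (CLINT z|(\<Pi>\<^sub>M i\<in>UNIV. std_normal_distribution). (\<Prod>i\<in>UNIV. iexp (t $ i * z i)))"
    by (simp add: inner_vec_def exp_sum sum_distrib_left)
  also have "\<dots> = (\<Prod>i\<in>UNIV. CLINT x|std_normal_distribution. iexp (t $ i * x))"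
  proof (rule product_integral_prod)
    fix i
    show "integrable std_normal_distribution (\<lambda>x. iexp (t $ i * x))"
      by (intro prob_space.integrable_iexp[OF prob_space_std_normal]) auto
  qed simp
  also have "\<dots> = (\<Prod>i\<in>UNIV. complex_of_real (exp (- ((t $ i)\<^sup>2) / 2)))"
    using char_std_normal_distribution by (intro prod.cong refl) (metis char_def)
  also have "\<dots> = complex_of_real (exp (- (t \<bullet> t) / 2))"
    by (simp add: inner_vec_def exp_sum[symmetric] of_real_prod[symmetric] power2_eq_square
        sum_negf sum_divide_distrib del: of_real_prod)
  finally show ?thesis .
qed

text \<open>Fubini, and the fact that a Gaussian has a Gaussian characteristic function. For s > 0
  the right side is, up to a constant, the density at y of \<open>M\<close> smoothed by Gaussian
  noise of standard deviation 1 / s, so the smoothed law depends on the characteristic function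
  alone.\<close>

lemma charfun_smoothing:
  fixes M :: "(real^'n) measure"
  assumes M: "prob_space M" "sets M = sets borel"
  shows "(CLINT u|std_gaussian. charfun M (s *\<^sub>R u) * iexp (- s * (u \<bullet> y)))
    = complex_of_real (LINT x|M. exp (- (s\<^sup>2 * (norm (x - y))\<^sup>2) / 2))"
proof -
  interpret M: prob_space M by fact
  interpret G: prob_space "std_gaussian :: (real^'n) measure" by (rule prob_space_std_gaussian)
  interpret P: pair_prob_space M "std_gaussian :: (real^'n) measure" ..
  note [measurable_cong] = M(2)
  have "(CLINT u|std_gaussian. charfun M (s *\<^sub>R u) * iexp (- s * (u \<bullet> y)))
      = (CLINT u|std_gaussian. CLINT x|M. iexp (s * (u \<bullet> (x - y))))"
    unfolding charfun_def
  proof (rule Bochner_Integration.integral_cong[OF refl])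
    fix u :: "real^'n"
    have "iexp (s * (u \<bullet> (x - y))) = iexp (s *\<^sub>R u \<bullet> x) * iexp (- s * (u \<bullet> y))" for x
      unfolding iexp_add[symmetric] by (simp add: inner_diff_right algebra_simps)
    then show "(CLINT x|M. iexp (s *\<^sub>R u \<bullet> x)) * iexp (- s * (u \<bullet> y))
        = (CLINT x|M. iexp (s * (u \<bullet> (x - y))))" by simp
  qed
  also have "\<dots> = (CLINT x|M. CLINT u|std_gaussian. iexp (s * (u \<bullet> (x - y))))"
  proof (rule P.Fubini_integral)
    show "integrable (M \<Otimes>\<^sub>M std_gaussian) (\<lambda>(x, u). iexp (s * (u \<bullet> (x - y))))"
      by (rule P.P.integrable_const_bound[where B = 1]) auto
  qed
  also have "\<dots> = (CLINT x|M. complex_of_real (exp (- (s\<^sup>2 * (norm (x - y))\<^sup>2) / 2)))"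
  proof (rule Bochner_Integration.integral_cong[OF refl])
    fix x :: "real^'n"
    have "(CLINT u|std_gaussian. iexp (s * (u \<bullet> (x - y)))) = charfun std_gaussian (s *\<^sub>R (x - y))"
      by (simp add: charfun_def inner_commute)
    then show "(CLINT u|std_gaussian. iexp (s * (u \<bullet> (x - y))))
        = complex_of_real (exp (- (s\<^sup>2 * (norm (x - y))\<^sup>2) / 2))"
      unfolding charfun_std_gaussian by (simp add: dot_square_norm power_mult_distrib)
  qed
  finally show ?thesis by simp
qed

text \<open>These two facts allow the mass of the kernel to be cancelled in
  \<open>charfun_unique\<close>. The integral factorises over the coordinates.\<close>

lemma nn_integral_gaussian_kernel:
  defines "k \<equiv> \<lambda>u :: 'a::euclidean_space. exp (- (norm u)\<^sup>2 / 2)"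
  shows "(\<integral>\<^sup>+u. ennreal (k u) \<partial>lborel) \<noteq> 0" and "(\<integral>\<^sup>+u. ennreal (k u) \<partial>lborel) < \<infinity>"
proof -
  have "k u = (\<Prod>b\<in>Basis. exp (- (u \<bullet> b)\<^sup>2 / 2))" for u
  proof -
    have "(norm u)\<^sup>2 = (\<Sum>b\<in>Basis. (u \<bullet> b)\<^sup>2)"
      unfolding power2_norm_eq_inner euclidean_inner[of u u] by (simp add: power2_eq_square)
    then show ?thesis by (simp add: k_def exp_sum[symmetric] sum_negf sum_divide_distrib)
  qed
  then have "(\<integral>\<^sup>+u. ennreal (k u) \<partial>lborel)
      = (\<integral>\<^sup>+u. (\<Prod>b\<in>Basis. ennreal (exp (- (u \<bullet> b)\<^sup>2 / 2))) \<partial>(lborel :: 'a measure))"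
    by (simp add: prod_ennreal)
  also have "\<dots> = (\<Prod>b\<in>(Basis::'a set). (\<integral>\<^sup>+x. ennreal (exp (- x\<^sup>2 / 2)) \<partial>lborel))"
    by (rule nn_integral_lborel_prod) auto
  also have "(\<integral>\<^sup>+x. ennreal (exp (- x\<^sup>2 / 2)) \<partial>lborel) = ennreal (sqrt (2 * pi))"
  proof -
    have "(\<integral>\<^sup>+x. ennreal (exp (- x\<^sup>2 / 2)) \<partial>lborel)
        = (\<integral>\<^sup>+x. ennreal (sqrt (2 * pi)) * ennreal (std_normal_density x) \<partial>lborel)"
      by (intro nn_integral_cong) (simp add: std_normal_density_def ennreal_mult[symmetric])
    also have "\<dots> = ennreal (sqrt (2 * pi)) * (\<integral>\<^sup>+x. ennreal (std_normal_density x) \<partial>lborel)"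
      by (rule nn_integral_cmult) simp
    also have "(\<integral>\<^sup>+x. ennreal (std_normal_density x) \<partial>lborel) = 1"
      using prob_space.emeasure_space_1[OF prob_space_std_normal] by (simp add: emeasure_density)
    finally show ?thesis by simp
  qed
  finally have *: "(\<integral>\<^sup>+u. ennreal (k u) \<partial>lborel) = ennreal (sqrt (2 * pi) ^ DIM('a))"
    by (simp add: ennreal_power)
  show "(\<integral>\<^sup>+u. ennreal (k u) \<partial>lborel) \<noteq> 0" and "(\<integral>\<^sup>+u. ennreal (k u) \<partial>lborel) < \<infinity>"
    unfolding * by (simp_all add: ennreal_eq_0_iff not_le)
qed

text \<open>Dominated convergence twice: for fixed x the noise disappears by continuity of f, then
  the limit is taken under \<open>M\<close>. The scale uses \<open>Suc j\<close> to avoid a division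
  by 0.\<close>

lemma smoothing_tendsto:
  fixes M :: "'a::euclidean_space measure" and f :: "'a \<Rightarrow> real"
  assumes M: "prob_space M" "sets M = sets borel"
    and f: "continuous_on UNIV f" "\<And>x. 0 \<le> f x" "\<And>x. f x \<le> 1"
  defines "k \<equiv> \<lambda>u :: 'a. exp (- (norm u)\<^sup>2 / 2)"
  shows "(\<lambda>j. \<integral>\<^sup>+x. (\<integral>\<^sup>+u. ennreal (f (x + (1 / real (Suc j)) *\<^sub>R u) * k u) \<partial>lborel) \<partial>M)
    \<longlonglongrightarrow> (\<integral>\<^sup>+u. ennreal (k u) \<partial>lborel) * (\<integral>\<^sup>+x. ennreal (f x) \<partial>M)"
proof -
  interpret M: prob_space M by fact
  note [measurable_cong] = M(2)
  have [measurable]: "f \<in> borel_measurable borel"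
    using f(1) by (rule borel_measurable_continuous_onI)
  have [measurable]: "k \<in> borel_measurable borel" unfolding k_def by measurable
  define c where "c = (\<integral>\<^sup>+u. ennreal (k u) \<partial>lborel)"
  have c: "c < \<infinity>" unfolding c_def k_def by (rule nn_integral_gaussian_kernel)
  have k: "0 \<le> k u" for u by (simp add: k_def)
  have bound: "ennreal (f x * k u) \<le> ennreal (k u)" for x u
    using mult_right_mono[OF f(3) k, of x u] by (intro ennreal_leI) simp
  have inner: "(\<lambda>j. \<integral>\<^sup>+u. ennreal (f (x + (1 / real (Suc j)) *\<^sub>R u) * k u) \<partial>lborel)
      \<longlonglongrightarrow> (\<integral>\<^sup>+u. ennreal (f x * k u) \<partial>lborel)" for x
  proof (rule nn_integral_dominated_convergence[where w = "\<lambda>u. ennreal (k u)"])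
    show "AE u in lborel. (\<lambda>j. ennreal (f (x + (1 / real (Suc j)) *\<^sub>R u) * k u))
        \<longlonglongrightarrow> ennreal (f x * k u)"
    proof (intro AE_I2 tendsto_ennrealI tendsto_mult tendsto_const)
      fix u
      have "(\<lambda>j. x + (1 / real (Suc j)) *\<^sub>R u) \<longlonglongrightarrow> x + 0 *\<^sub>R u"
        using LIMSEQ_inverse_real_of_nat
        by (intro tendsto_add tendsto_scaleR tendsto_const) (simp add: inverse_eq_divide)
      then show "(\<lambda>j. f (x + (1 / real (Suc j)) *\<^sub>R u)) \<longlonglongrightarrow> f x"
        using f(1) by (intro isCont_tendsto_compose[of x f]) (auto simp: continuous_on_eq_continuous_at)
    qed
  qed (use c bound in \<open>auto simp: c_def\<close>)
  have "(\<lambda>j. \<integral>\<^sup>+x. (\<integral>\<^sup>+u. ennreal (f (x + (1 / real (Suc j)) *\<^sub>R u) * k u) \<partial>lborel) \<partial>M)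
      \<longlonglongrightarrow> (\<integral>\<^sup>+x. (\<integral>\<^sup>+u. ennreal (f x * k u) \<partial>lborel) \<partial>M)"
  proof (rule nn_integral_dominated_convergence[where w = "\<lambda>_. c"])
    show "AE x in M. (\<integral>\<^sup>+u. ennreal (f (x + (1 / real (Suc j)) *\<^sub>R u) * k u) \<partial>lborel) \<le> c" for j
      unfolding c_def by (intro AE_I2 nn_integral_mono bound)
  qed (use c inner in \<open>auto simp: M.emeasure_space_1\<close>)
  also have "(\<integral>\<^sup>+x. (\<integral>\<^sup>+u. ennreal (f x * k u) \<partial>lborel) \<partial>M) = c * (\<integral>\<^sup>+x. ennreal (f x) \<partial>M)"
    by (simp add: c_def ennreal_mult k f(2) nn_integral_cmult nn_integral_multc mult.commute)
  finally show ?thesis by (simp add: c_def)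
qed

text \<open>The substitution y = x + u / s moves the smoothing from f to the law, and Fubini then
  exposes the integral computed in \<open>charfun_smoothing\<close>.\<close>

lemma smoothing_rescale:
  fixes M :: "'a::euclidean_space measure" and f :: "'a \<Rightarrow> real"
  assumes M: "prob_space M" "sets M = sets borel"
    and f: "continuous_on UNIV f" "\<And>x. 0 \<le> f x" and s: "0 < s"
  shows "(\<integral>\<^sup>+x. (\<integral>\<^sup>+u. ennreal (f (x + (1 / s) *\<^sub>R u) * exp (- (norm u)\<^sup>2 / 2)) \<partial>lborel) \<partial>M)
    = ennreal (s ^ DIM('a)) *
      (\<integral>\<^sup>+y. ennreal (f y) * ennreal (LINT x|M. exp (- (s\<^sup>2 * (norm (x - y))\<^sup>2) / 2)) \<partial>lborel)"
proof -
  interpret M: prob_space M by fact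
  interpret P: pair_sigma_finite M "lborel :: 'a measure" ..
  note [measurable_cong] = M(2)
  have [measurable]: "f \<in> borel_measurable borel"
    using f(1) by (rule borel_measurable_continuous_onI)
  let ?k = "\<lambda>x y. exp (- (s\<^sup>2 * (norm (x - y))\<^sup>2) / 2)"
  have "(\<integral>\<^sup>+u. ennreal (f (x + (1 / s) *\<^sub>R u) * exp (- (norm u)\<^sup>2 / 2)) \<partial>lborel)
      = ennreal (s ^ DIM('a)) * (\<integral>\<^sup>+y. ennreal (f y * ?k x y) \<partial>lborel)" for x
  proof -
    have "(\<integral>\<^sup>+y. ennreal (f y * ?k x y) \<partial>lborel)
        = (\<integral>\<^sup>+y. ennreal (f y * ?k x y) \<partial>density (distr lborel borel (\<lambda>u. x + (1 / s) *\<^sub>R u)) (\<lambda>_. \<bar>1 / s\<bar> ^ DIM('a)))"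
      using lborel_affine[of "1 / s" x] s by simp
    also have "\<dots> = (\<integral>\<^sup>+u. ennreal (\<bar>1 / s\<bar> ^ DIM('a)) *
        ennreal (f (x + (1 / s) *\<^sub>R u) * ?k x (x + (1 / s) *\<^sub>R u)) \<partial>lborel)"
      by (simp add: nn_integral_density nn_integral_distr)
    also have "\<dots> = ennreal ((1 / s) ^ DIM('a)) *
        (\<integral>\<^sup>+u. ennreal (f (x + (1 / s) *\<^sub>R u) * exp (- (norm u)\<^sup>2 / 2)) \<partial>lborel)"
      using s by (simp add: nn_integral_cmult power_divide)
    finally have "ennreal (s ^ DIM('a)) * (\<integral>\<^sup>+y. ennreal (f y * ?k x y) \<partial>lborel) =
        (ennreal (s ^ DIM('a)) * ennreal ((1 / s) ^ DIM('a))) *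
        (\<integral>\<^sup>+u. ennreal (f (x + (1 / s) *\<^sub>R u) * exp (- (norm u)\<^sup>2 / 2)) \<partial>lborel)"
      by (simp add: mult.assoc)
    then show ?thesis using s by (simp add: ennreal_mult[symmetric] power_mult_distrib[symmetric])
  qed
  then have "(\<integral>\<^sup>+x. (\<integral>\<^sup>+u. ennreal (f (x + (1 / s) *\<^sub>R u) * exp (- (norm u)\<^sup>2 / 2)) \<partial>lborel) \<partial>M)
      = ennreal (s ^ DIM('a)) * (\<integral>\<^sup>+x. (\<integral>\<^sup>+y. ennreal (f y * ?k x y) \<partial>lborel) \<partial>M)"
    by (simp add: nn_integral_cmult)
  also have "(\<integral>\<^sup>+x. (\<integral>\<^sup>+y. ennreal (f y * ?k x y) \<partial>lborel) \<partial>M)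
      = (\<integral>\<^sup>+y. (\<integral>\<^sup>+x. ennreal (f y * ?k x y) \<partial>M) \<partial>lborel)"
    by (rule P.Fubini'[symmetric]) measurable
  also have "\<dots> = (\<integral>\<^sup>+y. ennreal (f y) * ennreal (LINT x|M. ?k x y) \<partial>lborel)"
  proof (rule nn_integral_cong)
    fix y
    have "integrable M (\<lambda>x. ?k x y)"
      by (rule M.integrable_const_bound[where B = 1]) auto
    then have "(\<integral>\<^sup>+x. ennreal (?k x y) \<partial>M) = ennreal (LINT x|M. ?k x y)"
      by (rule nn_integral_eq_integral) simp
    then show "(\<integral>\<^sup>+x. ennreal (f y * ?k x y) \<partial>M) = ennreal (f y) * ennreal (LINT x|M. ?k x y)"
      by (simp add: ennreal_mult f(2) nn_integral_cmult)
  qed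
  finally show ?thesis .
qed

text \<open>Closed sets form an intersection-stable generator of the Borel sets, and the indicator
  of a nonempty closed set is the decreasing limit of the continuous functions max 0 (1 - k *
  infdist x C).\<close>

lemma measure_eqI_continuous:
  fixes M N :: "'a::euclidean_space measure"
  assumes M: "prob_space M" "sets M = sets borel" and N: "prob_space N" "sets N = sets borel"
    and eq: "\<And>f :: 'a \<Rightarrow> real. continuous_on UNIV f \<Longrightarrow> (\<And>x. 0 \<le> f x) \<Longrightarrow> (\<And>x. f x \<le> 1) \<Longrightarrow>
      (\<integral>\<^sup>+x. ennreal (f x) \<partial>M) = (\<integral>\<^sup>+x. ennreal (f x) \<partial>N)"
  shows "M = N"
proof -
  have spaces: "space M = UNIV" "space N = UNIV"
    using M(2) N(2) by (auto dest: sets_eq_imp_space_eq)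
  have lim: "(\<lambda>k. \<integral>\<^sup>+x. ennreal (max 0 (1 - real k * infdist x C)) \<partial>K) \<longlonglongrightarrow> emeasure K C"
    if C: "closed C" "C \<noteq> {}" and K: "prob_space K" "sets K = sets borel" for C :: "'a set" and K
  proof -
    interpret K: prob_space K by fact
    note [measurable_cong] = K(2)
    have "(\<lambda>k. \<integral>\<^sup>+x. ennreal (max 0 (1 - real k * infdist x C)) \<partial>K)
        \<longlonglongrightarrow> (\<integral>\<^sup>+x. indicator C x \<partial>K)"
    proof (rule nn_integral_dominated_convergence[where w = "\<lambda>_. 1"])
      show "(\<lambda>x. ennreal (max 0 (1 - real k * infdist x C))) \<in> borel_measurable K" for k
      proof -
        have "(\<lambda>x. infdist x C) \<in> borel_measurable borel"
          by (intro borel_measurable_continuous_onI continuous_intros)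
        then show ?thesis by measurable
      qed
      show "AE x in K. (\<lambda>k. ennreal (max 0 (1 - real k * infdist x C))) \<longlonglongrightarrow> indicator C x"
      proof (rule AE_I2)
        fix x
        show "(\<lambda>k. ennreal (max 0 (1 - real k * infdist x C))) \<longlonglongrightarrow> indicator C x"
        proof (cases "x \<in> C")
          case False
          then have d: "0 < infdist x C"
            using C infdist_pos_not_in_closed by blast
          obtain m :: nat where m: "1 / infdist x C < real m" using reals_Archimedean2 by blast
          have "\<forall>\<^sub>F k in sequentially. ennreal (max 0 (1 - real k * infdist x C)) = 0"
            using eventually_ge_at_top[of m]
          proof eventually_elim
            case (elim k)
            then have "1 \<le> real k * infdist x C"
              using m d by (smt (verit) divide_less_eq mult_right_mono of_nat_le_iff)
            then show ?case by simp
          qed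
          then show ?thesis using False by (simp add: tendsto_eventually)
        qed simp
      qed
      show "indicator C \<in> borel_measurable K"
        using C(1) K(2) by (intro borel_measurable_indicator) simp
      show "AE x in K. ennreal (max 0 (1 - real k * infdist x C)) \<le> 1" for k
        by (intro AE_I2) (simp add: infdist_nonneg)
    qed (simp_all add: K.emeasure_space_1)
    then show ?thesis using C K(2) by simp
  qed
  show ?thesis
  proof (rule measure_eqI_generator_eq[where E = "Collect closed" and \<Omega> = UNIV and A = "\<lambda>_. UNIV"])
    show "Int_stable (Collect closed :: 'a set set)" by (auto simp: Int_stable_def)
    show "sets M = sigma_sets UNIV (Collect closed)" "sets N = sigma_sets UNIV (Collect closed)"
      using M(2) N(2) by (simp_all add: borel_eq_closed)
    show "emeasure M UNIV \<noteq> \<infinity>" for i :: nat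
      using prob_space.emeasure_space_1[OF M(1)] spaces by simp
    fix C :: "'a set" assume "C \<in> Collect closed"
    then have C: "closed C" by simp
    show "emeasure M C = emeasure N C"
    \<comment> \<open>\<open>infdist\<close> to the empty set is 0 by convention, so the
      approximating functions would be constantly 1; the empty set is treated apart.\<close>
    proof (cases "C = {}")
      case False
      have "(\<integral>\<^sup>+x. ennreal (max 0 (1 - real k * infdist x C)) \<partial>M)
          = (\<integral>\<^sup>+x. ennreal (max 0 (1 - real k * infdist x C)) \<partial>N)" for k
        by (rule eq) (auto intro!: continuous_intros simp: infdist_nonneg)
      with lim[OF C False M] lim[OF C False N] show ?thesis
        by (simp add: LIMSEQ_unique)
    qed simp
  qed auto
qed

text \<open>Equal characteristic functions give equal Gaussian smoothings at every scale 1 / (j +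
  1), and letting the scale tend to 0 recovers the integrals of continuous functions with values in
  [0, 1].\<close>

theorem charfun_unique:
  fixes M N :: "(real^'n) measure"
  assumes M: "prob_space M" "sets M = sets borel" and N: "prob_space N" "sets N = sets borel"
    and eq: "\<And>t. charfun M t = charfun N t"
  shows "M = N"
proof (rule measure_eqI_continuous[OF M N])
  fix f :: "real^'n \<Rightarrow> real"
  assume f: "continuous_on UNIV f" "\<And>x. 0 \<le> f x" "\<And>x. f x \<le> 1"
  have "complex_of_real (LINT x|M. exp (- (s\<^sup>2 * (norm (x - y))\<^sup>2) / 2))
      = complex_of_real (LINT x|N. exp (- (s\<^sup>2 * (norm (x - y))\<^sup>2) / 2))" for s y
    unfolding charfun_smoothing[OF M, symmetric] charfun_smoothing[OF N, symmetric] eq ..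
  then have "(LINT x|M. exp (- (s\<^sup>2 * (norm (x - y))\<^sup>2) / 2))
      = (LINT x|N. exp (- (s\<^sup>2 * (norm (x - y))\<^sup>2) / 2))" for s y
    by (simp only: of_real_eq_iff)
  then have *: "(\<integral>\<^sup>+x. (\<integral>\<^sup>+u. ennreal (f (x + (1 / real (Suc j)) *\<^sub>R u) * exp (- (norm u)\<^sup>2 / 2)) \<partial>lborel) \<partial>M)
    = (\<integral>\<^sup>+x. (\<integral>\<^sup>+u. ennreal (f (x + (1 / real (Suc j)) *\<^sub>R u) * exp (- (norm u)\<^sup>2 / 2)) \<partial>lborel) \<partial>N)" for j
    using smoothing_rescale[OF M f(1,2), of "real (Suc j)"]
      smoothing_rescale[OF N f(1,2), of "real (Suc j)"] by simp
  let ?c = "\<integral>\<^sup>+u. ennreal (exp (- (norm (u :: real^'n))\<^sup>2 / 2)) \<partial>lborel"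
  have "?c * (\<integral>\<^sup>+x. ennreal (f x) \<partial>M) = ?c * (\<integral>\<^sup>+x. ennreal (f x) \<partial>N)"
    using smoothing_tendsto[OF M f] smoothing_tendsto[OF N f] unfolding * by (rule LIMSEQ_unique)
  then show "(\<integral>\<^sup>+x. ennreal (f x) \<partial>M) = (\<integral>\<^sup>+x. ennreal (f x) \<partial>N)"
    using nn_integral_gaussian_kernel[where ?'a = "real^'n"]
    by (auto simp: ennreal_mult_cancel_left)
qed

lemma measurable_matrix_vector [measurable]: "(\<lambda>x. A *v x) \<in> borel_measurable borel"
  for A :: "real^'n^'m"
  by (intro borel_measurable_continuous_onI linear_continuous_on)
     (simp add: linear_conv_bounded_linear[symmetric])

lemma measurable_vec_nth [measurable]: "(\<lambda>x :: real^'n. x $ i) \<in> borel_measurable borel"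
  by (intro borel_measurable_continuous_onI continuous_intros)

lemma charfun_distr_linear:
  fixes A :: "real^'n^'m"
  assumes [measurable_cong]: "sets M = sets borel"
  shows "charfun (distr M borel (\<lambda>x. A *v x)) t = charfun M (transpose A *v t)"
  unfolding charfun_def
  by (subst integral_distr) (auto simp: inner_matrix_left)

subsection \<open>Second moments\<close>

text \<open>Not centred, so that the integral of a quadratic form is a trace without a correction
  for the mean. For the Gaussian laws of mean 0 it is the covariance.\<close>

definition second_moment :: "(real^'n) measure \<Rightarrow> real^'n^'n" where
  "second_moment M = (\<chi> i j. LINT x|M. x $ i * x $ j)"

lemma P2_D:
  assumes "M \<in> P2"
  shows "prob_space M" "sets M = sets borel" "integrable M (\<lambda>x. (norm x)\<^sup>2)" "space M = UNIV"
  using assms by (auto simp: P2_def dest: sets_eq_imp_space_eq)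

lemma P2_integrable_entry:
  fixes M :: "(real^'n) measure"
  assumes M: "M \<in> P2" shows "integrable M (\<lambda>x. x $ i * x $ j)"
proof (rule Bochner_Integration.integrable_bound[OF P2_D(3)[OF M]])
  note [measurable_cong] = P2_D(2)[OF M]
  show "(\<lambda>x. x $ i * x $ j) \<in> borel_measurable M" by measurable
  have "\<bar>x $ i * x $ j\<bar> \<le> (norm x)\<^sup>2" for x :: "real^'n"
    unfolding abs_mult power2_eq_square
    by (intro mult_mono component_le_norm_cart) auto
  then show "AE x in M. norm (x $ i * x $ j) \<le> norm ((norm x)\<^sup>2)" by simp
qed

lemma quadratic_form_sum: "x \<bullet> (A *v x) = (\<Sum>i\<in>UNIV. \<Sum>j\<in>UNIV. A $ i $ j * (x $ i * x $ j))"
  for A :: "real^'n^'n"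
  by (simp add: inner_vec_def matrix_vector_mult_def sum_distrib_left mult_ac)

lemma
  fixes M :: "(real^'n) measure"
  assumes M: "M \<in> P2"
  shows P2_integrable_quadratic: "integrable M (\<lambda>x. x \<bullet> (A *v x))"
    and P2_integral_quadratic: "(LINT x|M. x \<bullet> (A *v x)) = trace (A ** second_moment M)"
proof -
  show "integrable M (\<lambda>x. x \<bullet> (A *v x))"
    unfolding quadratic_form_sum
    by (intro Bochner_Integration.integrable_sum integrable_mult_right P2_integrable_entry[OF M])
  have "(LINT x|M. x \<bullet> (A *v x)) = (\<Sum>i\<in>UNIV. \<Sum>j\<in>UNIV. A $ i $ j * (LINT x|M. x $ i * x $ j))"
    unfolding quadratic_form_sum
    by (subst Bochner_Integration.integral_sum;
        (subst Bochner_Integration.integral_sum)?)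
       (auto intro!: Bochner_Integration.integrable_sum P2_integrable_entry[OF M])
  also have "\<dots> = trace (A ** second_moment M)"
    by (simp add: trace_def matrix_matrix_mult_def second_moment_def mult.commute mult.left_commute)
  finally show "(LINT x|M. x \<bullet> (A *v x)) = trace (A ** second_moment M)" .
qed

lemma transpose_second_moment: "transpose (second_moment M) = second_moment M"
  by (simp add: second_moment_def transpose_def vec_eq_iff mult.commute)

lemma P2_integral_inner_square:
  assumes M: "M \<in> P2"
  shows "integrable M (\<lambda>x. (t \<bullet> x)\<^sup>2)"
    and "(LINT x|M. (t \<bullet> x)\<^sup>2) = t \<bullet> (second_moment M *v t)"
proof -
  have *: "(t \<bullet> x)\<^sup>2 = x \<bullet> ((\<chi> i j. t $ i * t $ j) *v x)" for x
    by (simp add: rank_one_mult power2_eq_square inner_commute)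
  show "integrable M (\<lambda>x. (t \<bullet> x)\<^sup>2)" unfolding * by (rule P2_integrable_quadratic[OF M])
  show "(LINT x|M. (t \<bullet> x)\<^sup>2) = t \<bullet> (second_moment M *v t)"
    unfolding * P2_integral_quadratic[OF M]
    using trace_mul_sym[of "\<chi> i j. t $ i * t $ j" "second_moment M"] by (simp add: trace_mult_rank_one)
qed

lemma symmetric_eqI:
  fixes A B :: "real^'n^'n"
  assumes "transpose A = A" "transpose B = B" and eq: "\<And>x. x \<bullet> (A *v x) = x \<bullet> (B *v x)"
  shows "A = B"
proof -
  have "psd (A - B)" "psd (B - A)"
    using assms by (simp_all add: psd_def transpose_diff matrix_vector_mult_diff_rdistrib inner_diff_right)
  then have "(A - B) *v x = 0" for x
    using eq[of x] by (intro psd_diagonal_zero) (simp_all add: matrix_vector_mult_diff_rdistrib inner_diff_right)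
  then have "A - B = 0" by (simp add: matrix_eq)
  then show ?thesis by simp
qed

lemma P2_distr_linear:
  fixes A :: "real^'n^'m"
  assumes M: "M \<in> P2" shows "distr M borel (\<lambda>x. A *v x) \<in> P2"
proof -
  note [measurable_cong] = P2_D(2)[OF M]
  have "(norm (A *v x))\<^sup>2 = x \<bullet> ((transpose A ** A) *v x)" for x
    by (simp add: power2_norm_eq_inner inner_matrix_left matrix_vector_mul_assoc)
  then have "integrable M (\<lambda>x. (norm (A *v x))\<^sup>2)" using P2_integrable_quadratic[OF M] by simp
  then show ?thesis
    unfolding P2_def using P2_D(1)[OF M]
    by (auto simp: integrable_distr_eq intro: prob_space.prob_space_distr)
qed

lemma second_moment_distr_linear:
  fixes A :: "real^'n^'m"
  assumes M: "M \<in> P2"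
  shows "second_moment (distr M borel (\<lambda>x. A *v x)) = A ** second_moment M ** transpose A"
proof (rule symmetric_eqI)
  note [measurable_cong] = P2_D(2)[OF M]
  show "transpose (A ** second_moment M ** transpose A) = A ** second_moment M ** transpose A"
    by (simp add: matrix_transpose_mul transpose_second_moment matrix_mul_assoc)
  fix t
  have "t \<bullet> (second_moment (distr M borel (\<lambda>x. A *v x)) *v t) = (LINT x|distr M borel (\<lambda>x. A *v x). (t \<bullet> x)\<^sup>2)"
    by (simp add: P2_integral_inner_square[OF P2_distr_linear[OF M]])
  also have "\<dots> = (LINT x|M. ((transpose A *v t) \<bullet> x)\<^sup>2)"
    by (subst integral_distr) (auto simp: inner_matrix_left)
  also have "\<dots> = t \<bullet> ((A ** second_moment M ** transpose A) *v t)"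
    unfolding P2_integral_inner_square[OF M]
    by (simp add: inner_matrix_left matrix_vector_mul_assoc matrix_mul_assoc)
  finally show "t \<bullet> (second_moment (distr M borel (\<lambda>x. A *v x)) *v t)
      = t \<bullet> ((A ** second_moment M ** transpose A) *v t)" .
qed (rule transpose_second_moment)

text \<open>The integral of |A x|^2 is the trace of A^T (A K), where K is the second moment.\<close>

lemma P2_AE_kernel:
  fixes A :: "real^'n^'m"
  assumes M: "M \<in> P2" and A: "A ** second_moment M = 0"
  shows "AE x in M. A *v x = 0"
proof -
  have *: "(norm (A *v x))\<^sup>2 = x \<bullet> ((transpose A ** A) *v x)" for x
    by (simp add: power2_norm_eq_inner inner_matrix_left matrix_vector_mul_assoc)
  have "(LINT x|M. (norm (A *v x))\<^sup>2) = trace (transpose A ** (A ** second_moment M))"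
    unfolding * P2_integral_quadratic[OF M] by (simp add: matrix_mul_assoc)
  then have "(LINT x|M. (norm (A *v x))\<^sup>2) = 0" by (simp add: A trace_def)
  moreover have "integrable M (\<lambda>x. (norm (A *v x))\<^sup>2)"
    unfolding * by (rule P2_integrable_quadratic[OF M])
  ultimately have "AE x in M. (norm (A *v x))\<^sup>2 = 0"
    by (subst (asm) integral_nonneg_eq_0_iff_AE) auto
  then show ?thesis by simp
qed

subsection \<open>Gaussian measures\<close>

lemma
  fixes i j :: "'n::finite"
  defines "G \<equiv> std_gaussian :: (real^'n) measure"
  shows std_gaussian_integral_entry: "integrable G (\<lambda>x. x $ i * x $ j)"
      "(LINT x|G. x $ i * x $ j) = (if i = j then 1 else 0)"
    and std_gaussian_integral_nth: "integrable G (\<lambda>x. x $ i)" "(LINT x|G. x $ i) = 0"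
proof -
  let ?N = "std_normal_distribution"
  let ?P = "\<Pi>\<^sub>M i\<in>(UNIV::'n set). ?N"
  interpret product_sigma_finite "\<lambda>_::'n. ?N"
    by (simp add: product_sigma_finite_def prob_space_imp_sigma_finite prob_space_std_normal)
  interpret N: prob_space ?N by (rule prob_space_std_normal)
  have m: "integrable ?N (\<lambda>x. x)" "integrable ?N (\<lambda>x. x * x)" "(LINT x|?N. x) = 0" "(LINT x|?N. x * x) = 1"
    using integrable_std_normal_distribution_moment[of 1] integrable_std_normal_distribution_moment[of 2]
      integral_std_normal_distribution_moment_odd[of 1] std_normal_distribution_even_moments(1)[of 1]
    by (simp_all add: power2_eq_square)
  \<comment> \<open>One factor per coordinate, equal to 1 away from \<open>i\<close> and
    \<open>j\<close>, brings the integrand into the form of the product formula; for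
    \<open>i = j\<close> the two conditionals multiply to x * x.\<close>
  define f where "f k x = (if k = i then x else 1) * (if k = j then x else (1::real))" for k x
  have f: "integrable ?N (f k)" for k
    using m by (cases "k = i"; cases "k = j") (auto simp: f_def[abs_def])
  have prod_f: "(\<Prod>k\<in>UNIV. f k (z k)) = z i * z j" for z
    by (simp add: f_def prod.distrib prod.delta)
  have "integrable ?P (\<lambda>z. \<Prod>k\<in>UNIV. f k (z k))"
    by (rule product_integrable_prod) (auto intro: f)
  then show "integrable G (\<lambda>x. x $ i * x $ j)"
    by (simp add: G_def std_gaussian_def integrable_distr_eq prod_f)
  have "(LINT x|G. x $ i * x $ j) = (LINT z|?P. (\<Prod>k\<in>UNIV. f k (z k)))"
    by (simp add: G_def std_gaussian_def integral_distr prod_f)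
  also have "\<dots> = (\<Prod>k\<in>UNIV. (LINT x|?N. f k x))"
    by (rule product_integral_prod) (auto intro: f)
  also have "\<dots> = (if i = j then 1 else 0)"
  proof (cases "i = j")
    case True
    have "(LINT x|?N. f k x) = 1" for k
      using True m N.prob_space by (cases "k = i") (simp_all add: f_def[abs_def])
    then show ?thesis using True by simp
  next
    case False
    then have "(LINT x|?N. f i x) = 0" using m by (simp add: f_def[abs_def])
    then show ?thesis using False by (auto intro: prod_zero)
  qed
  finally show "(LINT x|G. x $ i * x $ j) = (if i = j then 1 else 0)" .
  define g where "g k x = (if k = i then x else (1::real))" for k x
  have g: "integrable ?N (g k)" for k
    using m by (cases "k = i") (auto simp: g_def[abs_def])
  have prod_g: "(\<Prod>k\<in>UNIV. g k (z k)) = z i" for z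
    by (simp add: g_def prod.delta)
  have "integrable ?P (\<lambda>z. \<Prod>k\<in>UNIV. g k (z k))"
    by (rule product_integrable_prod) (auto intro: g)
  then show "integrable G (\<lambda>x. x $ i)"
    by (simp add: G_def std_gaussian_def integrable_distr_eq prod_g)
  have "(LINT x|G. x $ i) = (LINT z|?P. (\<Prod>k\<in>UNIV. g k (z k)))"
    by (simp add: G_def std_gaussian_def integral_distr prod_g)
  also have "\<dots> = (\<Prod>k\<in>UNIV. (LINT x|?N. g k x))"
    by (rule product_integral_prod) (auto intro: g)
  also have "\<dots> = 0"
  proof -
    have "(LINT x|?N. g i x) = 0" using m by (simp add: g_def[abs_def])
    then show ?thesis by (auto intro: prod_zero)
  qed
  finally show "(LINT x|G. x $ i) = 0" .
qed

lemma std_gaussian_P2: "(std_gaussian :: (real^'n) measure) \<in> P2"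
proof -
  have "(norm x)\<^sup>2 = (\<Sum>i\<in>UNIV. x $ i * x $ i)" for x :: "real^'n"
    by (simp add: power2_norm_eq_inner inner_vec_def)
  then have "integrable (std_gaussian :: (real^'n) measure) (\<lambda>x. (norm x)\<^sup>2)"
    by (simp add: std_gaussian_integral_entry)
  then show ?thesis by (simp add: P2_def prob_space_std_gaussian)
qed

lemma second_moment_std_gaussian: "second_moment std_gaussian = mat 1"
  by (simp add: second_moment_def std_gaussian_integral_entry mat_def)

lemma gaussian_0_eq: "gaussian 0 S = distr std_gaussian borel (\<lambda>x. psd_sqrt S *v x)"
  unfolding gaussian_def std_gaussian_def
  by (subst distr_distr) (auto simp: o_def)

lemma gaussian_P2: "gaussian 0 S \<in> P2"
  unfolding gaussian_0_eq by (rule P2_distr_linear[OF std_gaussian_P2])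

lemmas gaussian_prob_space = P2_D(1)[OF gaussian_P2]
lemmas sets_gaussian [simp, measurable_cong] = P2_D(2)[OF gaussian_P2]

lemma second_moment_gaussian: "psd S \<Longrightarrow> second_moment (gaussian 0 S) = S"
  unfolding gaussian_0_eq
  by (simp add: second_moment_distr_linear std_gaussian_P2 second_moment_std_gaussian
      psd_transpose psd_psd_sqrt psd_sqrt_mult)

lemma charfun_gaussian:
  assumes "psd S"
  shows "charfun (gaussian 0 S) t = complex_of_real (exp (- (t \<bullet> (S *v t)) / 2))"
proof -
  let ?R = "psd_sqrt S"
  have "charfun (gaussian 0 S) t = complex_of_real (exp (- ((?R *v t) \<bullet> (?R *v t)) / 2))"
    unfolding gaussian_0_eq
    by (simp add: charfun_distr_linear charfun_std_gaussian psd_transpose psd_psd_sqrt assms)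
  also have "(?R *v t) \<bullet> (?R *v t) = t \<bullet> (S *v t)"
    by (simp add: inner_matrix_left psd_transpose psd_psd_sqrt assms matrix_vector_mul_assoc psd_sqrt_mult)
  finally show ?thesis .
qed

lemma gaussian_eqI:
  assumes "psd S" "prob_space N" "sets N = sets borel"
    and "\<And>t. charfun N t = complex_of_real (exp (- (t \<bullet> (S *v t)) / 2))"
  shows "N = gaussian 0 S"
  using assms by (intro charfun_unique) (simp_all add: gaussian_prob_space charfun_gaussian)

lemma distr_gaussian_linear:
  fixes A :: "real^'n^'m"
  assumes S: "psd S"
  shows "distr (gaussian 0 S) borel (\<lambda>x. A *v x) = gaussian 0 (A ** S ** transpose A)"
proof (rule gaussian_eqI)
  show "psd (A ** S ** transpose A)"
    using psd_congruence[OF S, of "transpose A"] by simp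
  show "prob_space (distr (gaussian 0 S) borel (\<lambda>x. A *v x))"
    by (rule prob_space.prob_space_distr[OF gaussian_prob_space]) simp
  show "charfun (distr (gaussian 0 S) borel (\<lambda>x. A *v x)) t
      = complex_of_real (exp (- (t \<bullet> ((A ** S ** transpose A) *v t)) / 2))" for t
    by (simp add: charfun_distr_linear charfun_gaussian[OF S] inner_matrix_left
        matrix_vector_mul_assoc matrix_mul_assoc)
qed simp

lemma covariance_gaussian:
  fixes S :: "real^'n^'n"
  assumes "psd S" shows "covariance_matrix (gaussian 0 S) = S"
proof -
  have "integrable (std_gaussian :: (real^'n) measure) (\<lambda>x. x)"
  proof (rule Bochner_Integration.integrable_bound)
    show "integrable (std_gaussian :: (real^'n) measure) (\<lambda>x. \<Sum>i\<in>UNIV. \<bar>x $ i\<bar>)"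
      by (simp add: std_gaussian_integral_nth)
    show "AE x in std_gaussian. norm x \<le> norm (\<Sum>i\<in>UNIV. \<bar>x $ i\<bar>)"
      by (auto intro!: AE_I2 norm_le_l1_cart order_trans[OF _ abs_ge_self])
  qed simp
  then have i: "integrable (std_gaussian :: (real^'n) measure) (\<lambda>x. x)" .
  have "(LINT x|std_gaussian. x) $ i = (LINT x|std_gaussian. x $ i)" for i :: 'n
    using integral_inner_left[OF i, of "axis i 1"] by (simp add: inner_axis)
  then have m: "(LINT x|(std_gaussian :: (real^'n) measure). x) = 0"
    by (simp add: vec_eq_iff std_gaussian_integral_nth)
  have "(LINT x|gaussian 0 S. x) = (LINT x|std_gaussian. psd_sqrt S *v x)"
    unfolding gaussian_0_eq by (subst integral_distr) auto
  also have "\<dots> = psd_sqrt S *v (LINT x|std_gaussian. x)"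
    by (rule integral_bounded_linear[OF _ i]) (simp add: linear_conv_bounded_linear[symmetric])
  finally have "(LINT x|gaussian 0 S. x) = 0" by (simp add: m)
  then show ?thesis
    using second_moment_gaussian[OF assms] by (simp add: covariance_matrix_def second_moment_def)
qed

subsection \<open>Convex order\<close>

lemma ext_integral_integrable:
  assumes "integrable M f" shows "ext_integral M f = ereal (integral\<^sup>L M f)"
  using assms by (rule integrableE) (simp add: ext_integral_def)

lemma convex_order_integral:
  assumes "convex_order \<mu> \<nu>" "convex_on UNIV f" "integrable \<mu> f" "integrable \<nu> f"
  shows "integral\<^sup>L \<mu> f \<le> integral\<^sup>L \<nu> f"
  using assms ext_integral_integrable[OF assms(3)] ext_integral_integrable[OF assms(4)]
  by (auto simp: convex_order_def)

lemma convex_order_trans: "convex_order \<mu> \<nu> \<Longrightarrow> convex_order \<nu> \<rho> \<Longrightarrow> convex_order \<mu> \<rho>"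
  unfolding convex_order_def by (meson order_trans)

text \<open>The origin lies between \<open>x\<close> and the point \<open>- x / norm x\<close> of the unit sphere, where \<open>f\<close> is
  bounded above.\<close>

lemma convex_on_linear_minorant:
  fixes f :: "'a::euclidean_space \<Rightarrow> real"
  assumes f: "convex_on UNIV f"
  obtains a b where "0 \<le> a" "0 \<le> b" "\<And>x. - (a + b * norm x) \<le> f x"
proof -
  have cont: "continuous_on UNIV f" using f by (intro convex_on_continuous) auto
  have "compact (f ` sphere 0 1)"
    by (intro compact_continuous_image continuous_on_subset[OF cont]) auto
  then have "bdd_above (f ` sphere 0 1)"
    by (intro bounded_imp_bdd_above compact_imp_bounded)
  then obtain C where "\<forall>y\<in>f ` sphere 0 1. y \<le> C" unfolding bdd_above_def by blast
  then have C: "f u \<le> C" if "norm u = 1" for u using that by simp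
  have "- (\<bar>f 0\<bar> + (\<bar>f 0\<bar> + \<bar>C\<bar>) * norm x) \<le> f x" for x
  proof (cases "x = 0")
    case False
    define r where "r = norm x"
    have r: "0 < r" using False by (simp add: r_def)
    define t where "t = r / (1 + r)"
    have t: "0 \<le> t" "t \<le> 1" "1 - t = 1 / (1 + r)" using r by (auto simp: t_def field_simps)
    have "(1 - t) *\<^sub>R x + t *\<^sub>R (- (1 / r) *\<^sub>R x) = ((1 - t) + t * - (1 / r)) *\<^sub>R x"
      by (simp only: scaleR_scaleR scaleR_left_distrib)
    also have "(1 - t) + t * - (1 / r) = 0" using r unfolding t(3) by (simp add: t_def)
    finally have z: "(1 - t) *\<^sub>R x + t *\<^sub>R (- (1 / r) *\<^sub>R x) = 0" by (simp only: scaleR_zero_left)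
    have "f 0 = f ((1 - t) *\<^sub>R x + t *\<^sub>R (- (1 / r) *\<^sub>R x))" by (simp only: z)
    also have "\<dots> \<le> (1 - t) * f x + t * f (- (1 / r) *\<^sub>R x)"
      using t by (intro convex_onD[OF f]) auto
    also have "\<dots> \<le> (1 - t) * f x + t * C"
      using t r by (intro add_left_mono mult_left_mono C) (auto simp: r_def)
    also have "\<dots> = (f x + r * C) / (1 + r)"
      unfolding t(3) by (simp add: t_def add_divide_distrib)
    finally have "(1 + r) * f 0 \<le> f x + r * C"
      using r by (simp add: pos_le_divide_eq mult.commute)
    moreover have "(1 + r) * - \<bar>f 0\<bar> \<le> (1 + r) * f 0"
      using r by (intro mult_left_mono) auto
    moreover have "r * C \<le> r * \<bar>C\<bar>" using r by simp
    ultimately show ?thesis unfolding r_def[symmetric] by (simp add: algebra_simps)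
  qed simp
  then show ?thesis by (intro that[of "\<bar>f 0\<bar>" "\<bar>f 0\<bar> + \<bar>C\<bar>"]) auto
qed

lemma P2_integrable_norm:
  assumes "M \<in> P2" shows "integrable M (\<lambda>x. norm x)"
proof -
  interpret prob_space M using assms by (simp add: P2_def)
  have [measurable_cong]: "sets M = sets borel" using assms by (simp add: P2_def)
  have "norm x \<le> 1 + (norm x)\<^sup>2" for x :: 'a
    using zero_le_power2[of "norm x - 1 / 2"] by (simp add: power2_diff) (simp add: power2_eq_square)
  note le = this
  show ?thesis
  proof (rule Bochner_Integration.integrable_bound)
    show "integrable M (\<lambda>x. 1 + (norm x)\<^sup>2)" using assms by (simp add: P2_def)
    show "(\<lambda>x. norm x) \<in> borel_measurable M" by measurable
    show "AE x in M. norm (norm x) \<le> norm (1 + (norm x)\<^sup>2)" by (rule AE_I2) (simp add: le)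
  qed
qed

text \<open>Convexity bounds f at the midpoint by the mean of f (X) and f (Y), and both integrate to
  the same value. An equally distributed pair thus takes the place of a martingale coupling with its
  conditional Jensen inequality.\<close>

lemma convex_order_midpoint:
  fixes X Y :: "'b \<Rightarrow> 'a::euclidean_space"
  assumes [measurable]: "X \<in> borel_measurable M" "Y \<in> borel_measurable M"
    and X: "distr M borel X = \<nu>" and Y: "distr M borel Y = \<nu>" and \<nu>: "\<nu> \<in> P2"
    and m: "distr M borel (\<lambda>w. (1 / 2) *\<^sub>R (X w + Y w)) = \<mu>" and \<mu>: "\<mu> \<in> P2"
  shows "convex_order \<mu> \<nu>"
  unfolding convex_order_def
proof (intro allI impI)
  fix f :: "'a \<Rightarrow> real" assume f: "convex_on UNIV f"
  have [measurable_cong]: "sets \<mu> = sets borel" "sets \<nu> = sets borel" using \<mu> \<nu> by (auto simp: P2_def)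
  have [measurable]: "f \<in> borel_measurable borel"
    using f by (intro borel_measurable_continuous_onI convex_on_continuous) auto
  obtain a b where ab: "0 \<le> a" "0 \<le> b" "\<And>x. - (a + b * norm x) \<le> f x"
    using convex_on_linear_minorant[OF f] by blast
  \<comment> \<open>The linear minorant makes the negative part integrable. So the right side is
    infinite when the positive part diverges, and otherwise f is integrable under both laws.\<close>
  have neg: "(\<integral>\<^sup>+x. ennreal (- f x) \<partial>\<rho>) \<noteq> \<infinity>" if \<rho>: "\<rho> \<in> P2" for \<rho> :: "'a measure"
  proof -
    interpret prob_space \<rho> using \<rho> by (simp add: P2_def)
    have "integrable \<rho> (\<lambda>x. a + b * norm x)" using P2_integrable_norm[OF \<rho>] by auto
    then have "(\<integral>\<^sup>+x. ennreal (a + b * norm x) \<partial>\<rho>) \<noteq> \<infinity>"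
      using ab by (auto simp: real_integrable_def)
    moreover have "(\<integral>\<^sup>+x. ennreal (- f x) \<partial>\<rho>) \<le> (\<integral>\<^sup>+x. ennreal (a + b * norm x) \<partial>\<rho>)"
    proof (intro nn_integral_mono ennreal_leI)
      show "- f x \<le> a + b * norm x" for x using ab(3)[of x] by simp
    qed
    ultimately show ?thesis by (auto simp: top_unique)
  qed
  show "ext_integral \<mu> f \<le> ext_integral \<nu> f"
  proof (cases "(\<integral>\<^sup>+x. ennreal (f x) \<partial>\<nu>) = \<infinity>")
    case True
    then show ?thesis using neg[OF \<nu>] by (simp add: ext_integral_def)
  next
    case False
    then have i\<nu>: "integrable \<nu> f" using neg[OF \<nu>] by (simp add: real_integrable_def)
    then have iX: "integrable M (\<lambda>w. f (X w))" and iY: "integrable M (\<lambda>w. f (Y w))"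
      using X Y integrable_distr[of X M borel f] integrable_distr[of Y M borel f] by auto
    let ?m = "\<lambda>w. (1 / 2) *\<^sub>R (X w + Y w)"
    have mid: "f (?m w) \<le> (f (X w) + f (Y w)) / 2" for w
      using convex_onD[OF f, of "1 / 2" "X w" "Y w"] by (simp add: scaleR_add_right)
    have "(\<integral>\<^sup>+x. ennreal (f x) \<partial>\<mu>) = (\<integral>\<^sup>+w. ennreal (f (?m w)) \<partial>M)"
      unfolding m[symmetric] by (rule nn_integral_distr) auto
    also have "\<dots> \<le> (\<integral>\<^sup>+w. ennreal ((f (X w) + f (Y w)) / 2) \<partial>M)"
      by (intro nn_integral_mono ennreal_leI mid)
    also have "\<dots> < \<infinity>"
    proof -
      have "integrable M (\<lambda>w. (f (X w) + f (Y w)) / 2)" using iX iY by auto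
      then show ?thesis by (auto simp: real_integrable_def less_top)
    qed
    finally have i\<mu>: "integrable \<mu> f" using neg[OF \<mu>] by (simp add: real_integrable_def)
    then have im: "integrable M (\<lambda>w. f (?m w))"
      using m integrable_distr[of ?m M borel f] by auto
    have "integral\<^sup>L \<mu> f = (LINT w|M. f (?m w))"
      unfolding m[symmetric] by (rule integral_distr) auto
    also have "\<dots> \<le> (LINT w|M. (f (X w) + f (Y w)) / 2)"
      using im iX iY mid by (intro integral_mono) auto
    also have "\<dots> = (integral\<^sup>L (distr M borel X) f + integral\<^sup>L (distr M borel Y) f) / 2"
      using iX iY by (simp add: integral_distr)
    also have "\<dots> = integral\<^sup>L \<nu> f" using X Y by simp
    finally show ?thesis by (simp add: ext_integral_integrable i\<mu> i\<nu>)
  qed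
qed

lemma convex_on_quadratic:
  assumes A: "psd A" shows "convex_on UNIV (\<lambda>x. x \<bullet> (A *v x))"
proof (rule convex_onI)
  fix t :: real and x y assume t: "0 < t" "t < 1"
  have "0 \<le> t * (1 - t) * ((x - y) \<bullet> (A *v (x - y)))"
    using t psd_nonneg[OF A] by simp
  also have "\<dots> = (1 - t) * (x \<bullet> (A *v x)) + t * (y \<bullet> (A *v y))
      - ((1 - t) *\<^sub>R x + t *\<^sub>R y) \<bullet> (A *v ((1 - t) *\<^sub>R x + t *\<^sub>R y))"
    using psd_inner_sym[OF A, of x y]
    by (simp add: matrix_vector_right_distrib matrix_vector_mult_diff_distrib matrix_vector_mult_scaleR
        inner_add_left inner_add_right inner_diff_left inner_diff_right) (simp add: algebra_simps)
  finally show "((1 - t) *\<^sub>R x + t *\<^sub>R y) \<bullet> (A *v ((1 - t) *\<^sub>R x + t *\<^sub>R y))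
      \<le> (1 - t) * (x \<bullet> (A *v x)) + t * (y \<bullet> (A *v y))" by simp
qed simp

lemma convex_order_quadratic:
  fixes \<mu> \<nu> :: "(real^'n) measure"
  assumes "convex_order \<mu> \<nu>" "\<mu> \<in> P2" "\<nu> \<in> P2" "psd A"
  shows "(LINT x|\<mu>. x \<bullet> (A *v x)) \<le> (LINT x|\<nu>. x \<bullet> (A *v x))"
  using assms by (intro convex_order_integral convex_on_quadratic P2_integrable_quadratic)

text \<open>The squares of linear functionals are convex test functions.\<close>

lemma convex_order_second_moment:
  fixes \<mu> \<nu> :: "(real^'n) measure"
  assumes "convex_order \<mu> \<nu>" "\<mu> \<in> P2" "\<nu> \<in> P2"
  shows "psd (second_moment \<nu> - second_moment \<mu>)"
proof -
  have "t \<bullet> (second_moment \<mu> *v t) \<le> t \<bullet> (second_moment \<nu> *v t)" for t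
    using convex_order_quadratic[OF assms psd_rank_one, of t]
      trace_mul_sym[of "\<chi> i j. t $ i * t $ j" "second_moment \<mu>"]
      trace_mul_sym[of "\<chi> i j. t $ i * t $ j" "second_moment \<nu>"]
    by (simp add: P2_integral_quadratic assms trace_mult_rank_one)
  then show ?thesis
    by (simp add: psd_def transpose_diff transpose_second_moment matrix_vector_mult_diff_rdistrib
        inner_diff_right)
qed

text \<open>The cosines with both phases \<open>c\<close> and \<open>c + \<pi>\<close> become convex after adding \<open>(t \<bullet> x)\<^sup>2 / 2\<close>.\<close>

lemma convex_order_eq_second_moment:
  fixes \<mu> \<nu> :: "(real^'n) measure"
  assumes ord: "convex_order \<mu> \<nu>" and \<mu>: "\<mu> \<in> P2" and \<nu>: "\<nu> \<in> P2"
    and eq: "second_moment \<mu> = second_moment \<nu>"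
  shows "\<mu> = \<nu>"
proof -
  have ic: "integrable \<rho> (\<lambda>x. cos (t \<bullet> x + c))" if \<rho>: "\<rho> \<in> P2" for \<rho> and t :: "real^'n" and c
  proof -
    interpret prob_space \<rho> by (rule P2_D(1)[OF \<rho>])
    note [measurable_cong] = P2_D(2)[OF \<rho>]
    show ?thesis by (rule integrable_const_bound[where B = 1]) auto
  qed
  have le: "(LINT x|\<mu>. cos (t \<bullet> x + c)) \<le> (LINT x|\<nu>. cos (t \<bullet> x + c))" for t :: "real^'n" and c
  proof -
    have "convex_on UNIV (\<lambda>s. s\<^sup>2 / 2 + cos (s + c))"
    proof (rule f''_ge0_imp_convex)
      show "((\<lambda>s. s\<^sup>2 / 2 + cos (s + c)) has_real_derivative s - sin (s + c)) (at s)" for s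
        by (auto intro!: derivative_eq_intros)
      show "((\<lambda>s. s - sin (s + c)) has_real_derivative 1 - cos (s + c)) (at s)" for s
        by (auto intro!: derivative_eq_intros)
    qed auto
    then have "convex_on UNIV (\<lambda>x. (t \<bullet> x)\<^sup>2 / 2 + cos (t \<bullet> x + c))"
      by (auto simp: convex_on_def inner_add_right)
    then have "(LINT x|\<mu>. (t \<bullet> x)\<^sup>2 / 2 + cos (t \<bullet> x + c)) \<le> (LINT x|\<nu>. (t \<bullet> x)\<^sup>2 / 2 + cos (t \<bullet> x + c))"
      using P2_integral_inner_square(1)[OF \<mu>] P2_integral_inner_square(1)[OF \<nu>] ic \<mu> \<nu>
      by (intro convex_order_integral[OF ord]) auto
    then show ?thesis
      using P2_integral_inner_square[OF \<mu>, of t] P2_integral_inner_square[OF \<nu>, of t] ic \<mu> \<nu> eq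
      by simp
  qed
  have cos_eq: "(LINT x|\<mu>. cos (t \<bullet> x + c)) = (LINT x|\<nu>. cos (t \<bullet> x + c))" for t :: "real^'n" and c
    using le[of t c] le[of t "c + pi"] by (simp add: add.assoc[symmetric])
  \<comment> \<open>The phase - pi / 2 turns the cosine into a sine, so \<open>cos_eq\<close> covers
    the real and the imaginary part.\<close>
  have cf: "charfun \<rho> t = Complex (LINT x|\<rho>. cos (t \<bullet> x + 0)) (LINT x|\<rho>. cos (t \<bullet> x + - pi / 2))"
    if \<rho>: "\<rho> \<in> P2" for \<rho> t
  proof -
    interpret prob_space \<rho> by (rule P2_D(1)[OF \<rho>])
    note [measurable_cong] = P2_D(2)[OF \<rho>]
    have "integrable \<rho> (\<lambda>x. iexp (t \<bullet> x))" by (rule integrable_iexp) auto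
    from integral_Re[OF this] integral_Im[OF this] show ?thesis
      by (simp add: charfun_def complex_eq_iff cos_diff Re_exp Im_exp)
  qed
  then have "charfun \<mu> t = charfun \<nu> t" for t by (simp only: cf[OF \<mu>] cf[OF \<nu>] cos_eq)
  then show ?thesis using P2_D[OF \<mu>] P2_D[OF \<nu>] by (intro charfun_unique)
qed

lemma charfun_pair:
  fixes M N :: "(real^'n) measure"
  assumes M: "prob_space M" "sets M = sets borel" and N: "prob_space N" "sets N = sets borel"
  shows "charfun (distr (M \<Otimes>\<^sub>M N) borel (\<lambda>(x, y). x + c *\<^sub>R y)) t = charfun M t * charfun N (c *\<^sub>R t)"
proof -
  interpret M: prob_space M by fact
  interpret N: prob_space N by fact
  interpret P: pair_prob_space M N ..
  note [measurable_cong] = M(2) N(2)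
  have "charfun (distr (M \<Otimes>\<^sub>M N) borel (\<lambda>(x, y). x + c *\<^sub>R y)) t
      = (CLINT p|M \<Otimes>\<^sub>M N. iexp (t \<bullet> (fst p + c *\<^sub>R snd p)))"
    unfolding charfun_def by (subst integral_distr) (auto simp: case_prod_beta)
  also have "\<dots> = (CLINT x|M. CLINT y|N. iexp (t \<bullet> (x + c *\<^sub>R y)))"
    by (subst P.integral_fst'[symmetric]) (auto intro!: P.integrable_const_bound[where B = 1])
  also have "\<dots> = (CLINT x|M. iexp (t \<bullet> x) * charfun N (c *\<^sub>R t))"
    unfolding charfun_def by (simp add: inner_add_right iexp_add distrib_left exp_add)
  also have "\<dots> = charfun M t * charfun N (c *\<^sub>R t)" by (simp add: charfun_def)
  finally show ?thesis .
qed

text \<open>For independent x of law N(0, S) and y of law N(0, S' - S), both x + y and x - y have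
  law N(0, S'), and their midpoint is x.\<close>

lemma convex_order_gaussian:
  assumes S: "psd S" and D: "psd (S' - S)"
  shows "convex_order (gaussian 0 S) (gaussian 0 S')"
proof (rule convex_order_midpoint)
  let ?D = "gaussian 0 (S' - S)"
  let ?M = "gaussian 0 S \<Otimes>\<^sub>M ?D"
  have S': "psd S'" using psd_add[OF S D] by simp
  have M: "prob_space ?M"
    by (intro prob_space_pair gaussian_prob_space)
  have *: "distr ?M borel (\<lambda>(x, y). x + c *\<^sub>R y) = gaussian 0 S'" if "c\<^sup>2 = 1" for c
  proof (rule gaussian_eqI[OF S'])
    show "prob_space (distr ?M borel (\<lambda>(x, y). x + c *\<^sub>R y))"
      by (rule prob_space.prob_space_distr[OF M]) measurable
    have cc: "c * (c * r) = r" for r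
      using that by (simp add: power2_eq_square mult.assoc[symmetric])
    show "charfun (distr ?M borel (\<lambda>(x, y). x + c *\<^sub>R y)) t
        = complex_of_real (exp (- (t \<bullet> (S' *v t)) / 2))" for t
      by (simp add: charfun_pair gaussian_prob_space charfun_gaussian S D matrix_vector_mult_scaleR
          of_real_mult[symmetric] mult_exp_exp del: of_real_mult)
         (simp add: matrix_vector_mult_diff_rdistrib inner_diff_right cc right_diff_distrib
            diff_divide_distrib)
  qed simp
  show "distr ?M borel (\<lambda>(x, y). x + 1 *\<^sub>R y) = gaussian 0 S'"
    and "distr ?M borel (\<lambda>(x, y). x + (- 1) *\<^sub>R y) = gaussian 0 S'" by (rule *, simp)+
  show "distr ?M borel (\<lambda>w. (1 / 2) *\<^sub>R ((case w of (x, y) \<Rightarrow> x + 1 *\<^sub>R y) + (case w of (x, y) \<Rightarrow> x + (- 1) *\<^sub>R y)))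
      = gaussian 0 S"
  proof -
    have "distr ?M borel (\<lambda>w. (1 / 2) *\<^sub>R ((case w of (x, y) \<Rightarrow> x + 1 *\<^sub>R y) + (case w of (x, y) \<Rightarrow> x + (- 1) *\<^sub>R y)))
        = distr ?M (gaussian 0 S) fst"
      by (rule distr_cong) (auto simp: scaleR_add_right[symmetric] scaleR_2[symmetric])
    also have "\<dots> = gaussian 0 S"
      by (rule prob_space.distr_pair_fst[OF gaussian_prob_space])
    finally show ?thesis .
  qed
qed (auto simp: gaussian_P2)

subsection \<open>Couplings and the Wasserstein distance\<close>

lemma coupling_D:
  fixes \<mu> \<nu> :: "'a::euclidean_space measure"
  assumes "\<pi> \<in> couplings \<mu> \<nu>"
  shows "sets \<pi> = sets borel" "distr \<pi> borel fst = \<mu>" "distr \<pi> borel snd = \<nu>"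
    "fst \<in> borel_measurable \<pi>" "snd \<in> borel_measurable \<pi>"
proof -
  show s: "sets \<pi> = sets borel" "distr \<pi> borel fst = \<mu>" "distr \<pi> borel snd = \<nu>"
    using assms by (auto simp: couplings_def)
  have "(fst :: 'a \<times> 'a \<Rightarrow> 'a) \<in> borel_measurable (borel \<Otimes>\<^sub>M borel)"
    and "(snd :: 'a \<times> 'a \<Rightarrow> 'a) \<in> borel_measurable (borel \<Otimes>\<^sub>M borel)"
    by measurable
  then show "fst \<in> borel_measurable \<pi>" "snd \<in> borel_measurable \<pi>"
    unfolding measurable_cong_sets[OF s(1) refl] borel_prod .
qed

lemma coupling_prob_space:
  assumes \<pi>: "\<pi> \<in> couplings \<mu> \<nu>" and "prob_space \<mu>" shows "prob_space \<pi>"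
  using assms coupling_D[OF \<pi>] by (metis prob_space_distrD)

lemma coupling_integral:
  fixes f :: "'a::euclidean_space \<Rightarrow> real"
  assumes \<pi>: "\<pi> \<in> couplings \<mu> \<nu>" and f: "f \<in> borel_measurable borel"
  shows "(LINT p|\<pi>. f (fst p)) = integral\<^sup>L \<mu> f" "(LINT p|\<pi>. f (snd p)) = integral\<^sup>L \<nu> f"
    and "integrable \<mu> f \<Longrightarrow> integrable \<pi> (\<lambda>p. f (fst p))"
    and "integrable \<nu> f \<Longrightarrow> integrable \<pi> (\<lambda>p. f (snd p))"
  using coupling_D[OF \<pi>] f
    integral_distr[of fst \<pi> borel f] integral_distr[of snd \<pi> borel f]
    integrable_distr[of fst \<pi> borel f] integrable_distr[of snd \<pi> borel f]
  by simp_all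

lemma coupling_pair_measure:
  assumes "\<mu> \<in> P2" "\<nu> \<in> P2" shows "\<mu> \<Otimes>\<^sub>M \<nu> \<in> couplings \<mu> \<nu>"
proof -
  have s [measurable_cong]: "sets \<mu> = sets borel" "sets \<nu> = sets borel"
    and p: "prob_space \<mu>" "prob_space \<nu>" using assms by (auto simp: P2_def)
  interpret pair_prob_space \<mu> \<nu>
    using p by (simp add: pair_prob_space_def pair_sigma_finite_def prob_space_imp_sigma_finite)
  have "distr (\<mu> \<Otimes>\<^sub>M \<nu>) borel fst = distr (\<mu> \<Otimes>\<^sub>M \<nu>) \<mu> fst"
    by (rule distr_cong) (auto simp: s)
  also have "\<dots> = \<mu>" using prob_space.distr_pair_fst[OF p(2)] .
  finally have 1: "distr (\<mu> \<Otimes>\<^sub>M \<nu>) borel fst = \<mu>" .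
  have "distr (\<mu> \<Otimes>\<^sub>M \<nu>) borel snd = distr (\<nu> \<Otimes>\<^sub>M \<mu>) borel fst"
    by (subst distr_pair_swap, subst distr_distr) (auto simp: o_def case_prod_beta)
  also have "\<dots> = distr (\<nu> \<Otimes>\<^sub>M \<mu>) \<nu> fst"
    by (rule distr_cong) (auto simp: s)
  also have "\<dots> = \<nu>" using prob_space.distr_pair_fst[OF p(1)] .
  finally have 2: "distr (\<mu> \<Otimes>\<^sub>M \<nu>) borel snd = \<nu>" .
  have "sets (\<mu> \<Otimes>\<^sub>M \<nu>) = sets (borel \<Otimes>\<^sub>M borel)" by (rule sets_pair_measure_cong) (rule s)+
  also have "\<dots> = sets borel" by (simp only: borel_prod)
  finally show ?thesis using 1 2 by (simp add: couplings_def)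
qed

definition transport_cost :: "('a::euclidean_space \<times> 'a) measure \<Rightarrow> real" where
  "transport_cost \<pi> = (LINT (x, y)|\<pi>. (norm (x - y))\<^sup>2)"

lemma transport_cost_bdd_below: "bdd_below (transport_cost ` C)"
  by (rule bdd_belowI[of _ 0]) (auto simp: transport_cost_def intro!: integral_nonneg_AE)

lemma W2_eq: "W2 \<mu> \<nu> = sqrt (INF \<pi>\<in>couplings \<mu> \<nu>. transport_cost \<pi>)"
  by (simp add: W2_def transport_cost_def)

lemma W2_le:
  assumes "\<pi> \<in> couplings \<mu> \<nu>" shows "W2 \<mu> \<nu> \<le> sqrt (transport_cost \<pi>)"
  unfolding W2_eq by (intro real_sqrt_le_mono cINF_lower transport_cost_bdd_below assms)

lemma W2_ge:
  assumes "\<mu> \<in> P2" "\<nu> \<in> P2" and "\<And>\<pi>. \<pi> \<in> couplings \<mu> \<nu> \<Longrightarrow> c \<le> transport_cost \<pi>"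
  shows "sqrt c \<le> W2 \<mu> \<nu>"
  unfolding W2_eq using coupling_pair_measure[OF assms(1,2)] assms(3)
  by (intro real_sqrt_le_mono cINF_greatest) auto

text \<open>Couplings of arbitrarily small excess cost stand in for an optimal one.\<close>

lemma W2_less_coupling:
  assumes "\<mu> \<in> P2" "\<nu> \<in> P2" "W2 \<mu> \<nu> \<le> sqrt c" "0 < d"
  obtains \<pi> where "\<pi> \<in> couplings \<mu> \<nu>" "transport_cost \<pi> < c + d"
proof -
  have "(INF \<pi>\<in>couplings \<mu> \<nu>. transport_cost \<pi>) < c + d"
    using assms(3,4) unfolding W2_eq by simp
  moreover have "couplings \<mu> \<nu> \<noteq> {}" using coupling_pair_measure[OF assms(1,2)] by blast
  ultimately show ?thesis
    using that by (subst (asm) cINF_less_iff) (auto intro: transport_cost_bdd_below)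
qed

lemma P2_coupling_integrable:
  assumes \<pi>: "\<pi> \<in> couplings \<mu> \<nu>" and \<mu>: "\<mu> \<in> P2" and \<nu>: "\<nu> \<in> P2"
  shows "integrable \<pi> (\<lambda>p. (norm (fst p - snd p))\<^sup>2)"
proof (rule Bochner_Integration.integrable_bound)
  note [measurable] = coupling_D(4,5)[OF \<pi>]
  show "integrable \<pi> (\<lambda>p. 2 * (norm (fst p))\<^sup>2 + 2 * (norm (snd p))\<^sup>2)"
    using \<mu> \<nu> coupling_integral(3,4)[OF \<pi>, of "\<lambda>x. (norm x)\<^sup>2"] by (auto simp: P2_def)
  show "(\<lambda>p. (norm (fst p - snd p))\<^sup>2) \<in> borel_measurable \<pi>" by measurable
  have "(norm (x - y))\<^sup>2 \<le> 2 * (norm x)\<^sup>2 + 2 * (norm y)\<^sup>2" for x y :: 'a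
    using zero_le_power2[of "norm (x + y)"]
    by (simp add: power2_norm_eq_inner inner_diff_left inner_diff_right inner_add_left inner_add_right
        inner_commute)
  then show "AE p in \<pi>. norm ((norm (fst p - snd p))\<^sup>2) \<le> norm (2 * (norm (fst p))\<^sup>2 + 2 * (norm (snd p))\<^sup>2)"
    by simp
qed

text \<open>The map a -> exp (i a) is 1-Lipschitz; this converts closeness in mean of two random
  vectors into closeness of their characteristic functions.\<close>

lemma norm_iexp_diff_le: "cmod (iexp a - iexp b) \<le> \<bar>a - b\<bar>"
proof -
  have "iexp a - iexp b = iexp b * (iexp (a - b) - 1)"
    by (simp add: right_diff_distrib iexp_add[symmetric] of_real_diff[symmetric] del: of_real_diff)
  then have "cmod (iexp a - iexp b) = cmod (iexp (a - b) - 1)" by (simp add: norm_mult)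
  also have "\<dots> \<le> \<bar>a - b\<bar>" using iexp_approx1[of "a - b" 0] by simp
  finally show ?thesis .
qed

subsection \<open>Optimality by duality\<close>

text \<open>The Karush-Kuhn-Tucker conditions of the projection problem. \<open>T ** W\<close> is
  the orthogonal projection onto a subspace that contains the range of \<open>S\<^sub>\<nu>\<close>,
  and \<open>T\<close> and \<open>W\<close> are inverse to each other on it. This subspace may be
  proper, so the same results serve the full-rank problem, where it is everything, and the
  degenerate one.\<close>

locale kkt =
  fixes S\<^sub>\<mu> S\<^sub>\<nu> S\<^sub>s T W :: "real^'n^'n"
  assumes psd_\<mu>: "psd S\<^sub>\<mu>" and psd_\<nu>: "psd S\<^sub>\<nu>" and psd_T: "psd T" and psd_W: "psd W"
    and W_le_1: "psd (mat 1 - W)" and feasible: "psd (S\<^sub>s - S\<^sub>\<mu>)"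
    and WTW: "W ** T ** W = W" and TW_WT: "T ** W = W ** T"
    and support: "T ** W ** S\<^sub>\<nu> = S\<^sub>\<nu>" and T_ge: "psd (T - T ** W)"
    and complementary: "(mat 1 - W) ** (S\<^sub>s - S\<^sub>\<mu>) = 0"
    and transport: "W ** S\<^sub>s ** W = S\<^sub>\<nu>"
begin

abbreviation "\<mu> \<equiv> gaussian 0 S\<^sub>\<mu>"
abbreviation "\<nu> \<equiv> gaussian 0 S\<^sub>\<nu>"

text \<open>The dual objective: a lower bound for the cost of every coupling of \<nu> with a law of
  \<open>P2\<close> that dominates \<mu>.\<close>

definition "dual_value = (LINT x|\<nu>. x \<bullet> ((mat 1 - T) *v x)) + (LINT y|\<mu>. y \<bullet> ((mat 1 - W) *v y))"

text \<open>The slack in the pointwise duality inequality; it vanishes where x = W y.\<close>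

definition "gap p = (fst p - W *v snd p) \<bullet> (T *v (fst p - W *v snd p))" for p :: "(real^'n) \<times> (real^'n)"

lemma psd_s: "psd S\<^sub>s"
  using psd_add[OF psd_\<mu> feasible] by simp

lemma gap_nonneg: "0 \<le> gap p"
  unfolding gap_def by (rule psd_nonneg[OF psd_T])

lemma transpose_TW: "transpose (T ** W) = T ** W"
  by (simp add: matrix_transpose_mul psd_transpose psd_T psd_W TW_WT)

lemma cost_pointwise:
  assumes x: "T ** W *v x = x"
  shows "(norm (x - y))\<^sup>2 = x \<bullet> ((mat 1 - T) *v x) + gap (x, y) + y \<bullet> ((mat 1 - W) *v y)"
proof -
  \<comment> \<open>T (W y) is the orthogonal projection of y on the subspace containing x, so both
    cross terms equal x . y.\<close>
  have 1: "x \<bullet> (T *v (W *v y)) = x \<bullet> y"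
    using inner_matrix_left[of "T ** W" x y] by (simp add: x transpose_TW matrix_vector_mul_assoc)
  have 2: "(W *v y) \<bullet> (T *v x) = x \<bullet> y"
    using psd_inner_sym[OF psd_T, of "W *v y" x] 1 by simp
  have 3: "(W *v y) \<bullet> (T *v (W *v y)) = y \<bullet> (W *v y)"
    by (simp add: inner_matrix_left psd_transpose[OF psd_W] matrix_vector_mul_assoc matrix_mul_assoc WTW)
  show ?thesis
    by (simp add: gap_def matrix_vector_mult_diff_distrib matrix_vector_mult_diff_rdistrib
        inner_diff_left inner_diff_right 1 2 3 power2_norm_eq_inner inner_commute[of y x])
qed

text \<open>The vector x - W y lies in the range of the projection \<open>T ** W\<close>, where T >=
  1. A small gap therefore means that x is close to W y.\<close>

lemma gap_ge:
  assumes x: "T ** W *v x = x" shows "(norm (x - W *v y))\<^sup>2 \<le> gap (x, y)"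
proof -
  have "T ** W *v (W *v y) = W *v y"
    by (simp add: matrix_vector_mul_assoc TW_WT WTW matrix_mul_assoc)
  then have "T ** W *v (x - W *v y) = x - W *v y"
    by (simp add: matrix_vector_mult_diff_distrib x)
  then show ?thesis
    using psd_nonneg[OF T_ge, of "x - W *v y"]
    by (simp add: gap_def matrix_vector_mult_diff_rdistrib inner_diff_right power2_norm_eq_inner)
qed

lemma AE_support:
  assumes \<pi>: "\<pi> \<in> couplings \<nu> \<eta>" shows "AE p in \<pi>. T ** W *v fst p = fst p"
proof -
  have "(mat 1 - T ** W) ** S\<^sub>\<nu> = 0" by (simp add: matrix_diff_rdistrib support)
  then have "AE x in \<nu>. (mat 1 - T ** W) *v x = 0"
    by (intro P2_AE_kernel[OF gaussian_P2]) (simp add: second_moment_gaussian psd_\<nu>)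
  then have "AE x in distr \<pi> borel fst. T ** W *v x = x"
    unfolding coupling_D(2)[OF \<pi>] by (simp add: matrix_vector_mult_diff_rdistrib) (simp add: eq_commute)
  then show ?thesis by (rule AE_distrD[OF coupling_D(4)[OF \<pi>]])
qed

lemma
  assumes \<pi>: "\<pi> \<in> couplings \<nu> \<eta>" and \<eta>: "\<eta> \<in> P2"
  shows gap_integrable: "integrable \<pi> gap"
    and cost_eq: "transport_cost \<pi> = (LINT x|\<nu>. x \<bullet> ((mat 1 - T) *v x)) + integral\<^sup>L \<pi> gap
      + (LINT y|\<eta>. y \<bullet> ((mat 1 - W) *v y))"
proof -
  note [measurable] = coupling_D(4,5)[OF \<pi>]
  have [measurable]: "gap \<in> borel_measurable \<pi>" unfolding gap_def[abs_def] by measurable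
  let ?f = "\<lambda>x. x \<bullet> ((mat 1 - T) *v x)" and ?g = "\<lambda>y. y \<bullet> ((mat 1 - W) *v y)"
  have c: "integrable \<pi> (\<lambda>p. (norm (fst p - snd p))\<^sup>2)"
    by (rule P2_coupling_integrable[OF \<pi> gaussian_P2 \<eta>])
  have f: "integrable \<pi> (\<lambda>p. ?f (fst p))"
    by (intro coupling_integral(3)[OF \<pi>] P2_integrable_quadratic gaussian_P2) measurable
  have g: "integrable \<pi> (\<lambda>p. ?g (snd p))"
    by (intro coupling_integral(4)[OF \<pi>] P2_integrable_quadratic \<eta>) measurable
  have ae: "AE p in \<pi>. (norm (fst p - snd p))\<^sup>2 - ?f (fst p) - ?g (snd p) = gap p"
    using AE_support[OF \<pi>] by eventually_elim (simp add: cost_pointwise)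
  have i: "integrable \<pi> (\<lambda>p. (norm (fst p - snd p))\<^sup>2 - ?f (fst p) - ?g (snd p))"
    using c f g by simp
  show "integrable \<pi> gap" by (rule integrable_cong_AE_imp[OF i _ ae]) measurable
  have "integral\<^sup>L \<pi> gap = (LINT p|\<pi>. (norm (fst p - snd p))\<^sup>2 - ?f (fst p) - ?g (snd p))"
    using ae by (intro integral_cong_AE) (auto elim: AE_mp)
  also have "\<dots> = transport_cost \<pi> - (LINT p|\<pi>. ?f (fst p)) - (LINT p|\<pi>. ?g (snd p))"
    using c f g by (simp add: transport_cost_def case_prod_unfold)
  also have "(LINT p|\<pi>. ?f (fst p)) = integral\<^sup>L \<nu> ?f"
    by (rule coupling_integral(1)[OF \<pi>]) measurable
  also have "(LINT p|\<pi>. ?g (snd p)) = integral\<^sup>L \<eta> ?g"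
    by (rule coupling_integral(2)[OF \<pi>]) measurable
  finally show "transport_cost \<pi> = integral\<^sup>L \<nu> ?f + integral\<^sup>L \<pi> gap + integral\<^sup>L \<eta> ?g" by simp
qed

lemma W2_lower_bound:
  assumes \<eta>: "\<eta> \<in> P2" "convex_order \<mu> \<eta>" shows "sqrt dual_value \<le> W2 \<nu> \<eta>"
proof (rule W2_ge[OF gaussian_P2 \<eta>(1)])
  fix \<pi> assume \<pi>: "\<pi> \<in> couplings \<nu> \<eta>"
  have "0 \<le> integral\<^sup>L \<pi> gap" by (simp add: gap_nonneg)
  moreover have "(LINT y|\<mu>. y \<bullet> ((mat 1 - W) *v y)) \<le> (LINT y|\<eta>. y \<bullet> ((mat 1 - W) *v y))"
    by (rule convex_order_quadratic[OF \<eta>(2) gaussian_P2 \<eta>(1) W_le_1])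
  ultimately show "dual_value \<le> transport_cost \<pi>"
    by (simp add: cost_eq[OF \<pi> \<eta>(1)] dual_value_def)
qed

lemma trace_complementary: "trace ((mat 1 - W) ** S\<^sub>s) = trace ((mat 1 - W) ** S\<^sub>\<mu>)"
  using complementary by (simp add: matrix_diff_ldistrib)

text \<open>The coupling (W y, y) has gap 0, and complementary slackness makes the convex term the
  same as under \<mu>; primal and dual values coincide.\<close>

lemma W2_upper_bound:
  assumes \<eta>: "\<eta> \<in> P2" "distr \<eta> borel (\<lambda>y. W *v y) = \<nu>" "second_moment \<eta> = S\<^sub>s"
  shows "W2 \<nu> \<eta> \<le> sqrt dual_value"
proof -
  note [measurable_cong] = P2_D(2)[OF \<eta>(1)]
  define \<pi> where "\<pi> = distr \<eta> (borel \<Otimes>\<^sub>M borel) (\<lambda>y. (W *v y, y))"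
  have [measurable]: "(\<lambda>y. (W *v y, y)) \<in> \<eta> \<rightarrow>\<^sub>M borel \<Otimes>\<^sub>M borel" by measurable
  have "distr \<pi> borel fst = \<nu>"
    unfolding \<pi>_def using \<eta>(2) by (subst distr_distr) (auto simp: o_def)
  moreover have "distr \<pi> borel snd = \<eta>"
    unfolding \<pi>_def using P2_D(2)[OF \<eta>(1)] by (subst distr_distr) (auto simp: o_def intro: distr_id2)
  moreover have "sets \<pi> = sets borel" by (simp add: \<pi>_def borel_prod)
  ultimately have \<pi>: "\<pi> \<in> couplings \<nu> \<eta>" by (simp add: couplings_def)
  have "gap \<in> borel_measurable (borel \<Otimes>\<^sub>M borel)" unfolding gap_def[abs_def] by measurable
  then have "integral\<^sup>L \<pi> gap = 0"
    unfolding \<pi>_def by (subst integral_distr) (auto simp: gap_def)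
  then have "transport_cost \<pi> = dual_value"
    unfolding cost_eq[OF \<pi> \<eta>(1)] dual_value_def
    by (simp add: P2_integral_quadratic gaussian_P2 \<eta> second_moment_gaussian psd_\<mu> trace_complementary)
  then show ?thesis using W2_le[OF \<pi>] by simp
qed

lemma projectionI:
  assumes \<eta>: "\<eta> \<in> P2" "convex_order \<mu> \<eta>"
    and "distr \<eta> borel (\<lambda>y. W *v y) = \<nu>" "second_moment \<eta> = S\<^sub>s"
  shows "\<eta> \<in> W2_projections \<nu> \<mu>"
  using W2_lower_bound W2_upper_bound[OF \<eta>(1) assms(3,4)] \<eta>
  by (auto simp: W2_projections_def intro: order_trans)

lemma gaussian_projection: "gaussian 0 S\<^sub>s \<in> W2_projections \<nu> \<mu>"
proof (rule projectionI)
  show "convex_order \<mu> (gaussian 0 S\<^sub>s)" by (rule convex_order_gaussian[OF psd_\<mu> feasible])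
  show "distr (gaussian 0 S\<^sub>s) borel (\<lambda>y. W *v y) = \<nu>"
    by (simp add: distr_gaussian_linear psd_s psd_transpose psd_W transport)
qed (simp_all add: gaussian_P2 second_moment_gaussian psd_s)

text \<open>The Gaussian candidate attains the dual value, so a projection has no excess cost: its
  convex term is tight and its near-optimal couplings have gap tending to 0. The gap gives the law
  of W y, and the tight term then gives the second moment.\<close>

lemma projectionD:
  assumes proj: "\<eta> \<in> W2_projections \<nu> \<mu>"
  shows "\<eta> \<in> P2" "convex_order \<mu> \<eta>"
    and "distr \<eta> borel (\<lambda>y. W *v y) = \<nu>" "second_moment \<eta> = S\<^sub>s"
proof -
  show \<eta>: "\<eta> \<in> P2" and ord: "convex_order \<mu> \<eta>" using proj by (auto simp: W2_projections_def)
  note [measurable_cong] = P2_D(2)[OF \<eta>]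
  have "W2 \<nu> \<eta> \<le> W2 \<nu> (gaussian 0 S\<^sub>s)"
    using proj gaussian_projection by (auto simp: W2_projections_def)
  also have "\<dots> \<le> sqrt dual_value"
    by (intro W2_upper_bound)
       (simp_all add: gaussian_P2 second_moment_gaussian psd_s distr_gaussian_linear psd_transpose psd_W transport)
  finally have W2: "W2 \<nu> \<eta> \<le> sqrt dual_value" .
  let ?g = "\<lambda>y. y \<bullet> ((mat 1 - W) *v y)"
  have g: "integral\<^sup>L \<mu> ?g \<le> integral\<^sup>L \<eta> ?g"
    by (rule convex_order_quadratic[OF ord gaussian_P2 \<eta> W_le_1])
  have approx: "\<exists>\<pi>\<in>couplings \<nu> \<eta>. integral\<^sup>L \<pi> gap < d \<and> integral\<^sup>L \<eta> ?g - integral\<^sup>L \<mu> ?g < d" if "0 < d" for d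
  proof -
    obtain \<pi> where \<pi>: "\<pi> \<in> couplings \<nu> \<eta>" "transport_cost \<pi> < dual_value + d"
      using W2_less_coupling[OF gaussian_P2 \<eta> W2 \<open>0 < d\<close>] .
    have "0 \<le> integral\<^sup>L \<pi> gap" by (simp add: gap_nonneg)
    moreover have "integral\<^sup>L \<pi> gap + (integral\<^sup>L \<eta> ?g - integral\<^sup>L \<mu> ?g) < d"
      using \<pi>(2) by (simp add: cost_eq[OF \<pi>(1) \<eta>] dual_value_def)
    ultimately have "integral\<^sup>L \<pi> gap < d \<and> integral\<^sup>L \<eta> ?g - integral\<^sup>L \<mu> ?g < d"
      using g by linarith
    then show ?thesis using \<pi>(1) by blast
  qed
  have "integral\<^sup>L \<eta> ?g - integral\<^sup>L \<mu> ?g \<le> 0 + d" if "0 < d" for d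
    using approx[OF that] by fastforce
  then have "integral\<^sup>L \<eta> ?g - integral\<^sup>L \<mu> ?g \<le> 0" by (rule field_le_epsilon)
  then have geq: "integral\<^sup>L \<eta> ?g = integral\<^sup>L \<mu> ?g" using g by simp
  \<comment> \<open>Along near-optimal couplings W y approaches x in mean square. The laws of x and
    of W y do not depend on the coupling, so they agree.\<close>
  have "charfun (distr \<eta> borel (\<lambda>y. W *v y)) t = charfun \<nu> t" for t
  proof -
    have "cmod (charfun \<nu> t - charfun (distr \<eta> borel (\<lambda>y. W *v y)) t) \<le> norm t * d" if d: "0 < d" for d
    proof -
      obtain \<pi> where \<pi>: "\<pi> \<in> couplings \<nu> \<eta>" and small: "integral\<^sup>L \<pi> gap < d\<^sup>2"
        using approx[of "d\<^sup>2"] d by auto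
      interpret prob_space \<pi> by (rule coupling_prob_space[OF \<pi> gaussian_prob_space])
      note [measurable] = coupling_D(4,5)[OF \<pi>]
      let ?W = "\<lambda>p. W *v snd p"
      have [measurable]: "?W \<in> borel_measurable \<pi>" by measurable
      have i: "integrable \<pi> (\<lambda>p. iexp (t \<bullet> fst p))" "integrable \<pi> (\<lambda>p. iexp (t \<bullet> ?W p))"
        by (auto intro!: integrable_iexp)
      have "charfun \<nu> t = (CLINT p|\<pi>. iexp (t \<bullet> fst p))"
        unfolding charfun_def coupling_D(2)[OF \<pi>, symmetric] by (subst integral_distr) auto
      moreover have "charfun (distr \<eta> borel (\<lambda>y. W *v y)) t = (CLINT p|\<pi>. iexp (t \<bullet> ?W p))"
        unfolding charfun_def
        by (subst integral_distr, measurable, subst coupling_D(3)[OF \<pi>, symmetric], subst integral_distr) auto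
      ultimately have "cmod (charfun \<nu> t - charfun (distr \<eta> borel (\<lambda>y. W *v y)) t)
          = cmod (CLINT p|\<pi>. iexp (t \<bullet> fst p) - iexp (t \<bullet> ?W p))"
        using i by simp
      also have "\<dots> \<le> (LINT p|\<pi>. cmod (iexp (t \<bullet> fst p) - iexp (t \<bullet> ?W p)))"
        by (rule integral_norm_bound)
      \<comment> \<open>Young's inequality r <= d / 2 + r^2 / (2 d) makes the bound linear in the
        gap, so only its integral enters; this is below d^2, and the total is at most norm t *
        d.\<close>
      also have "\<dots> \<le> (LINT p|\<pi>. norm t * (d / 2 + gap p / (2 * d)))"
      proof (rule integral_mono_AE)
        show "integrable \<pi> (\<lambda>p. cmod (iexp (t \<bullet> fst p) - iexp (t \<bullet> ?W p)))" using i by auto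
        show "integrable \<pi> (\<lambda>p. norm t * (d / 2 + gap p / (2 * d)))"
          using gap_integrable[OF \<pi> \<eta>] by auto
        show "AE p in \<pi>. cmod (iexp (t \<bullet> fst p) - iexp (t \<bullet> ?W p)) \<le> norm t * (d / 2 + gap p / (2 * d))"
          using AE_support[OF \<pi>]
        proof eventually_elim
          case (elim p)
          define r where "r = norm (fst p - ?W p)"
          have "r\<^sup>2 \<le> gap p" using gap_ge[OF elim, of "snd p"] by (simp add: r_def)
          moreover have "2 * d * r \<le> d\<^sup>2 + r\<^sup>2" using sum_squares_bound[of d r] by simp
          ultimately have r: "r \<le> d / 2 + gap p / (2 * d)" using d by (simp add: field_simps power2_eq_square)
          have "cmod (iexp (t \<bullet> fst p) - iexp (t \<bullet> ?W p)) \<le> \<bar>t \<bullet> (fst p - ?W p)\<bar>"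
            using norm_iexp_diff_le[of "t \<bullet> fst p" "t \<bullet> ?W p"] by (simp add: inner_diff_right)
          also have "\<dots> \<le> norm t * r" unfolding r_def by (rule Cauchy_Schwarz_ineq2)
          also have "\<dots> \<le> norm t * (d / 2 + gap p / (2 * d))" by (rule mult_left_mono[OF r]) simp
          finally show ?case .
        qed
      qed
      also have "\<dots> = norm t * (d / 2 + integral\<^sup>L \<pi> gap / (2 * d))"
        using gap_integrable[OF \<pi> \<eta>] by (simp add: prob_space)
      also have "\<dots> \<le> norm t * d"
        using small d by (intro mult_left_mono) (simp_all add: field_simps power2_eq_square)
      finally show ?thesis .
    qed
    note bound = this
    have "cmod (charfun \<nu> t - charfun (distr \<eta> borel (\<lambda>y. W *v y)) t) \<le> 0 + e" if e: "0 < e" for e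
    proof -
      have pos: "0 < norm t + 1" by (simp add: add_nonneg_pos)
      then have "norm t * e \<le> e * (norm t + 1)" using e by (simp add: distrib_left)
      then have "norm t * (e / (norm t + 1)) \<le> e" using pos by (simp add: pos_divide_le_eq)
      moreover have "0 < e / (norm t + 1)" using e pos by simp
      ultimately show ?thesis using bound by fastforce
    qed
    then have "cmod (charfun \<nu> t - charfun (distr \<eta> borel (\<lambda>y. W *v y)) t) \<le> 0" by (rule field_le_epsilon)
    then show ?thesis by simp
  qed
  then show W: "distr \<eta> borel (\<lambda>y. W *v y) = \<nu>"
    using P2_D[OF P2_distr_linear[OF \<eta>, of W]] P2_D[OF gaussian_P2[of S\<^sub>\<nu>]] by (intro charfun_unique)
  let ?K = "second_moment \<eta>"
  have WKW: "W ** ?K ** W = S\<^sub>\<nu>"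
    using second_moment_distr_linear[OF \<eta>, of W] second_moment_gaussian[OF psd_\<nu>]
    by (simp add: W psd_transpose psd_W)
  have "psd (?K - S\<^sub>\<mu>)"
    using convex_order_second_moment[OF ord gaussian_P2 \<eta>] by (simp add: second_moment_gaussian psd_\<mu>)
  moreover have "trace ((mat 1 - W) ** (?K - S\<^sub>\<mu>)) = 0"
    using geq by (simp add: P2_integral_quadratic \<eta> gaussian_P2 second_moment_gaussian psd_\<mu>
        matrix_diff_ldistrib trace_sub)
  ultimately have "(mat 1 - W) ** (?K - S\<^sub>\<mu>) = 0" by (intro psd_trace_mult(2) W_le_1)
  \<comment> \<open>The difference of the two second moments is fixed by \<open>W\<close> from the
    left and, being symmetric, from the right; but \<open>W\<close> maps both moments to
    \<open>S\<^sub>\<nu>\<close>, so the sandwiched difference is 0.\<close>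
  with complementary have "(mat 1 - W) ** (?K - S\<^sub>s) = 0" by (simp add: matrix_diff_ldistrib)
  then have E: "W ** (?K - S\<^sub>s) = ?K - S\<^sub>s" by (simp add: matrix_diff_rdistrib)
  then have "transpose (W ** (?K - S\<^sub>s)) = transpose (?K - S\<^sub>s)" by simp
  then have "(?K - S\<^sub>s) ** W = ?K - S\<^sub>s"
    by (simp add: matrix_transpose_mul transpose_diff transpose_second_moment psd_transpose psd_s psd_W)
  then have "?K - S\<^sub>s = W ** (?K - S\<^sub>s) ** W" by (simp add: E)
  also have "\<dots> = 0" by (simp add: matrix_diff_ldistrib matrix_diff_rdistrib WKW transport)
  finally show "?K = S\<^sub>s" by simp
qed

lemma projections_eq_factor:
  assumes B: "B ** W ** S\<^sub>s = S\<^sub>s"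
  shows "W2_projections \<nu> \<mu> = {gaussian 0 S\<^sub>s}"
proof -
  have "\<eta> = distr \<nu> borel (\<lambda>x. B *v x)" if proj: "\<eta> \<in> W2_projections \<nu> \<mu>" for \<eta>
  proof -
    note \<eta> = projectionD[OF proj]
    note [measurable_cong] = P2_D(2)[OF \<eta>(1)]
    \<comment> \<open>A matrix that annihilates the second moment annihilates almost every
      point.\<close>
    have "(mat 1 - B ** W) ** second_moment \<eta> = 0" by (simp add: \<eta>(4) matrix_diff_rdistrib B)
    then have "AE y in \<eta>. (mat 1 - B ** W) *v y = 0" by (rule P2_AE_kernel[OF \<eta>(1)])
    then have ae: "AE y in \<eta>. B *v (W *v y) = y"
      by eventually_elim (simp add: matrix_vector_mult_diff_rdistrib matrix_vector_mul_assoc)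
    have "distr \<nu> borel (\<lambda>x. B *v x) = distr \<eta> borel (\<lambda>y. B *v (W *v y))"
      unfolding \<eta>(3)[symmetric] by (subst distr_distr) (auto simp: o_def)
    also have "\<dots> = distr \<eta> borel (\<lambda>y. y)"
      by (rule distr_cong_AE[OF refl refl ae]) measurable
    also have "\<dots> = \<eta>" using P2_D(2)[OF \<eta>(1)] by (intro distr_id2) simp
    finally show ?thesis by simp
  qed
  note unique = this
  show ?thesis
  proof (intro equalityI subsetI)
    fix \<eta> assume "\<eta> \<in> W2_projections \<nu> \<mu>"
    from unique[OF this] unique[OF gaussian_projection] show "\<eta> \<in> {gaussian 0 S\<^sub>s}" by simp
  qed (use gaussian_projection in simp)
qed

lemma projections_eq_self:
  assumes "S\<^sub>s = S\<^sub>\<mu>"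
  shows "W2_projections \<nu> \<mu> = {gaussian 0 S\<^sub>s}"
proof -
  have "\<eta> = \<mu>" if proj: "\<eta> \<in> W2_projections \<nu> \<mu>" for \<eta>
  proof -
    note \<eta> = projectionD[OF proj]
    have "second_moment \<mu> = second_moment \<eta>" by (simp add: \<eta>(4) assms second_moment_gaussian psd_\<mu>)
    then show ?thesis
      using convex_order_eq_second_moment[OF \<eta>(2) gaussian_P2 \<eta>(1)] by simp
  qed
    note unique = this
  show ?thesis
  proof (intro equalityI subsetI)
    fix \<eta> assume "\<eta> \<in> W2_projections \<nu> \<mu>"
    from unique[OF this] show "\<eta> \<in> {gaussian 0 S\<^sub>s}" by (simp add: assms)
  qed (use gaussian_projection in simp)
qed

end

subsection \<open>A second projection\<close>

lemma
  fixes g :: "'a \<Rightarrow> bool \<Rightarrow> 'b::{banach, second_countable_topology}"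
  assumes N: "prob_space N" and g: "\<And>b. integrable N (\<lambda>x. g x b)"
  defines "B \<equiv> measure_pmf (pmf_of_set (UNIV :: bool set))"
  shows integrable_pair_bool: "integrable (N \<Otimes>\<^sub>M B) (\<lambda>(x, b). g x b)"
    and integral_pair_bool: "(\<integral>(x, b). g x b \<partial>(N \<Otimes>\<^sub>M B))
      = (1 / 2) *\<^sub>R ((\<integral>x. g x True \<partial>N) + (\<integral>x. g x False \<partial>N))"
proof -
  interpret N: prob_space N by fact
  interpret B: prob_space B unfolding B_def by (rule prob_space_measure_pmf)
  interpret P: pair_prob_space N B ..
  have [measurable]: "(\<lambda>x. g x True) \<in> borel_measurable N" "(\<lambda>x. g x False) \<in> borel_measurable N"
    using g by auto
  have [measurable_cong]: "sets B = sets (count_space UNIV)" by (simp add: B_def)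
  have "(\<lambda>(x, b). g x b) = (\<lambda>(x, b). if b then g x True else g x False)" by (auto simp: fun_eq_iff)
  then have m: "(\<lambda>(x, b). g x b) \<in> borel_measurable (N \<Otimes>\<^sub>M B)" by simp
  have iB: "(\<integral>b. h b \<partial>B) = (1 / 2) *\<^sub>R (h True + h False)" for h :: "bool \<Rightarrow> 'c::{banach, second_countable_topology}"
    unfolding B_def by (subst integral_measure_pmf[of UNIV]) (auto simp: UNIV_bool scaleR_add_right add.commute)
  show int: "integrable (N \<Otimes>\<^sub>M B) (\<lambda>(x, b). g x b)"
  proof (rule P.Fubini_integrable[OF m])
    show "integrable N (\<lambda>x. \<integral>b. norm (case (x, b) of (x, b) \<Rightarrow> g x b) \<partial>B)"
      using g by (simp add: iB)
    show "AE x in N. integrable B (\<lambda>b. case (x, b) of (x, b) \<Rightarrow> g x b)"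
      unfolding B_def by (intro AE_I2 integrable_measure_pmf_finite) simp
  qed
  have "(\<integral>(x, b). g x b \<partial>(N \<Otimes>\<^sub>M B)) = (\<integral>x. (\<integral>b. g x b \<partial>B) \<partial>N)"
    using P.integral_fst'[OF int] by simp
  also have "\<dots> = (1 / 2) *\<^sub>R ((\<integral>x. g x True \<partial>N) + (\<integral>x. g x False \<partial>N))"
    using g by (simp add: iB)
  finally show "(\<integral>(x, b). g x b \<partial>(N \<Otimes>\<^sub>M B))
      = (1 / 2) *\<^sub>R ((\<integral>x. g x True \<partial>N) + (\<integral>x. g x False \<partial>N))" .
qed

lemma transpose_rank_one: "transpose (\<chi> i j. v $ i * w $ j) = (\<chi> i j. w $ i * v $ j)"
  for v w :: "real^'n"
  by (simp add: transpose_def vec_eq_iff mult.commute)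

definition signed_shift :: "real^'n \<Rightarrow> real^'n \<Rightarrow> real \<Rightarrow> real^'n^'n" where
  "signed_shift v l s = mat 1 + s *\<^sub>R (\<chi> i j. v $ i * l $ j)"

text \<open>The law of \<open>x \<plusminus> (l \<bullet> x) v\<close> with \<open>x\<close> distributed as \<open>N(0, M)\<close> and a fair independent sign, a
  mixture of two Gaussians. The average of the two signs is \<open>x\<close>, which gives the convex order.\<close>

definition sign_mixture :: "real^'n^'n \<Rightarrow> real^'n \<Rightarrow> real^'n \<Rightarrow> (real^'n) measure" where
  "sign_mixture M v l = distr (gaussian 0 M \<Otimes>\<^sub>M measure_pmf (pmf_of_set UNIV)) borel
     (\<lambda>(x, b). signed_shift v l (if b then 1 else - 1) *v x)"

lemma measurable_sign_mixture [measurable]: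
  "(\<lambda>(x, b). signed_shift v l (if b then r else s) *v x)
     \<in> borel_measurable (gaussian 0 M \<Otimes>\<^sub>M measure_pmf (pmf_of_set (UNIV :: bool set)))"
proof -
  have "(\<lambda>(x, b). signed_shift v l (if b then r else s) *v x)
      = (\<lambda>(x, b). if b then signed_shift v l r *v x else signed_shift v l s *v x)" by auto
  then show ?thesis by simp
qed

context
  fixes M :: "real^'n^'n" and v l :: "real^'n"
  assumes M: "psd M" and l: "l \<bullet> (M *v l) = 1"
begin

private abbreviation "k \<equiv> M *v l"
private abbreviation "S \<equiv> M + (\<chi> i j. v $ i * v $ j)"
private abbreviation "B \<equiv> measure_pmf (pmf_of_set (UNIV :: bool set))"
private abbreviation "A \<equiv> signed_shift v l"

text \<open>As matrices, A(s) M A(s)^T = S + s (v k^T + k v^T) with k = M l. The normalisation l . M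
  l = 1 produces the rank-one part v v^T of S; the sign appears only in the cross term.\<close>

lemma signed_shift_form:
  assumes "s * s = 1"
  shows "t \<bullet> ((A s ** M ** transpose (A s)) *v t) = t \<bullet> (S *v t) + 2 * s * ((t \<bullet> v) * (t \<bullet> k))"
proof -
  define w where "w = transpose (A s) *v t"
  have w: "w = t + (s * (t \<bullet> v)) *\<^sub>R l"
    by (simp add: w_def signed_shift_def transpose_add transpose_scalar transpose_rank_one
        matrix_vector_mult_add_rdistrib scaleR_matrix_vector_assoc[symmetric] rank_one_mult inner_commute)
  have "t \<bullet> ((A s ** M ** transpose (A s)) *v t) = w \<bullet> (M *v w)"
    by (simp add: w_def inner_matrix_left matrix_vector_mul_assoc matrix_mul_assoc)
  also have "\<dots> = t \<bullet> (M *v t) + 2 * (s * (t \<bullet> v)) * (t \<bullet> k) + (s * s) * (t \<bullet> v)\<^sup>2"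
    using psd_inner_sym[OF M, of l t] l unfolding w
    by (simp add: matrix_vector_right_distrib matrix_vector_mult_scaleR inner_add_left inner_add_right
        power2_eq_square algebra_simps)
  also have "\<dots> = t \<bullet> (S *v t) + 2 * s * ((t \<bullet> v) * (t \<bullet> k))"
    by (simp add: assms matrix_vector_mult_add_rdistrib rank_one_mult inner_add_right
        power2_eq_square inner_commute)
  finally show ?thesis .
qed

lemma charfun_signed_shift:
  assumes "s * s = 1"
  shows "(CLINT x|gaussian 0 M. iexp (t \<bullet> (A s *v x)))
    = complex_of_real (exp (- (t \<bullet> (S *v t)) / 2 - s * ((t \<bullet> v) * (t \<bullet> k))))"
proof -
  have "(CLINT x|gaussian 0 M. iexp (t \<bullet> (A s *v x))) = charfun (distr (gaussian 0 M) borel (\<lambda>x. A s *v x)) t"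
    unfolding charfun_def by (subst integral_distr) auto
  also have "\<dots> = complex_of_real (exp (- (t \<bullet> ((A s ** M ** transpose (A s)) *v t)) / 2))"
    using psd_congruence[OF M, of "transpose (A s)"] by (simp add: distr_gaussian_linear M charfun_gaussian)
  also have "- (t \<bullet> ((A s ** M ** transpose (A s)) *v t)) / 2
      = - (t \<bullet> (S *v t)) / 2 - s * ((t \<bullet> v) * (t \<bullet> k))"
    by (simp only: signed_shift_form[OF assms]) simp
  finally show ?thesis .
qed

text \<open>Averaging over the sign turns the exponential of the cross term into a cosh, which is
  even. The parameter \<open>r\<close> is kept because the convex order needs both assignments of
  signs to the coin, and evenness shows that they give the same law.\<close>

lemma charfun_sign_pair:
  assumes "r * r = 1"
  shows "charfun (distr (gaussian 0 M \<Otimes>\<^sub>M B) borel (\<lambda>(x, b). A (if b then r else - r) *v x)) t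
    = complex_of_real (exp (- (t \<bullet> (S *v t)) / 2) * cosh ((t \<bullet> v) * (t \<bullet> k)))"
proof -
  let ?c = "(t \<bullet> v) * (t \<bullet> k)"
  have "charfun (distr (gaussian 0 M \<Otimes>\<^sub>M B) borel (\<lambda>(x, b). A (if b then r else - r) *v x)) t
      = (CLINT (x, b)|gaussian 0 M \<Otimes>\<^sub>M B. iexp (t \<bullet> (A (if b then r else - r) *v x)))"
    unfolding charfun_def by (subst integral_distr) (auto simp: case_prod_unfold)
  also have "\<dots> = (1 / 2) *\<^sub>R ((CLINT x|gaussian 0 M. iexp (t \<bullet> (A (if True then r else - r) *v x)))
      + (CLINT x|gaussian 0 M. iexp (t \<bullet> (A (if False then r else - r) *v x))))"
    by (rule integral_pair_bool[OF gaussian_prob_space])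
       (auto intro!: prob_space.integrable_iexp[OF gaussian_prob_space])
  also have "\<dots> = complex_of_real ((exp (- (t \<bullet> (S *v t)) / 2 - r * ?c) + exp (- (t \<bullet> (S *v t)) / 2 - (- r) * ?c)) / 2)"
    using charfun_signed_shift[of r t] charfun_signed_shift[of "- r" t] assms
    by (simp add: scaleR_conv_of_real)
  also have "(exp (- (t \<bullet> (S *v t)) / 2 - r * ?c) + exp (- (t \<bullet> (S *v t)) / 2 - (- r) * ?c)) / 2
      = exp (- (t \<bullet> (S *v t)) / 2) * cosh ?c"
  proof -
    define q where "q = - (t \<bullet> (S *v t)) / 2"
    have "r = 1 \<or> r = - 1" using assms by (simp add: square_eq_1_iff)
    then have "exp (q - r * ?c) + exp (q - (- r) * ?c) = exp q * (exp ?c + exp (- ?c))"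
      by (auto simp: exp_diff exp_add exp_minus field_simps)
    then show ?thesis unfolding q_def[symmetric] cosh_field_def by simp
  qed
  finally show ?thesis .
qed

lemma charfun_sign_mixture:
  "charfun (sign_mixture M v l) t
    = complex_of_real (exp (- (t \<bullet> (S *v t)) / 2) * cosh ((t \<bullet> v) * (t \<bullet> k)))"
  unfolding sign_mixture_def using charfun_sign_pair[of 1 t] by simp

lemma prob_space_sign_pair: "prob_space (gaussian 0 M \<Otimes>\<^sub>M B)"
  by (intro prob_space_pair gaussian_prob_space prob_space_measure_pmf)

lemma
  fixes f :: "real^'n \<Rightarrow> real"
  assumes f: "f \<in> borel_measurable borel" and i: "\<And>s. integrable (gaussian 0 M) (\<lambda>x. f (A s *v x))"
  shows integrable_sign_mixture: "integrable (sign_mixture M v l) f"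
    and integral_sign_mixture: "integral\<^sup>L (sign_mixture M v l) f
      = ((LINT x|gaussian 0 M. f (A 1 *v x)) + (LINT x|gaussian 0 M. f (A (- 1) *v x))) / 2"
proof -
  let ?g = "\<lambda>x b. f (A (if b then 1 else - 1) *v x)"
  note [measurable] = f
  have eq: "(\<lambda>p. f (case p of (x, b) \<Rightarrow> A (if b then 1 else - 1) *v x)) = (\<lambda>(x, b). ?g x b)"
    by auto
  show "integrable (sign_mixture M v l) f"
    unfolding sign_mixture_def
    by (subst integrable_distr_eq) (auto simp: eq intro: integrable_pair_bool[OF gaussian_prob_space i])
  have "integral\<^sup>L (sign_mixture M v l) f = (LINT (x, b)|(gaussian 0 M \<Otimes>\<^sub>M B). ?g x b)"
    unfolding sign_mixture_def by (subst integral_distr) (auto simp: eq)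
  then show "integral\<^sup>L (sign_mixture M v l) f
      = ((LINT x|gaussian 0 M. f (A 1 *v x)) + (LINT x|gaussian 0 M. f (A (- 1) *v x))) / 2"
    using integral_pair_bool[OF gaussian_prob_space i, of "\<lambda>b. if b then 1 else - 1"] by simp
qed

lemma sign_mixture_P2: "sign_mixture M v l \<in> P2"
proof -
  have "integrable (sign_mixture M v l) (\<lambda>x. (norm x)\<^sup>2)"
  proof (rule integrable_sign_mixture)
    show "integrable (gaussian 0 M) (\<lambda>x. (norm (A s *v x))\<^sup>2)" for s
      using P2_D(3)[OF P2_distr_linear[OF gaussian_P2[of M], of "A s"]] by (simp add: integrable_distr_eq)
  qed measurable
  then show ?thesis
    unfolding P2_def using prob_space.prob_space_distr[OF prob_space_sign_pair measurable_sign_mixture, of v l 1 "- 1"]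
    by (auto simp: sign_mixture_def)
qed

lemma second_moment_sign_mixture: "second_moment (sign_mixture M v l) = S"
proof (rule symmetric_eqI[OF transpose_second_moment])
  show "transpose S = S"
    by (simp add: transpose_add psd_transpose M transpose_rank_one)
  fix t
  have i: "integrable (gaussian 0 M) (\<lambda>x. (t \<bullet> (A s *v x))\<^sup>2)"
    and e: "(LINT x|gaussian 0 M. (t \<bullet> (A s *v x))\<^sup>2) = t \<bullet> ((A s ** M ** transpose (A s)) *v t)" for s
  proof -
    have *: "t \<bullet> (A s *v x) = (transpose (A s) *v t) \<bullet> x" for x by (simp add: inner_matrix_left)
    show "integrable (gaussian 0 M) (\<lambda>x. (t \<bullet> (A s *v x))\<^sup>2)"
      unfolding * by (rule P2_integral_inner_square(1)[OF gaussian_P2])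
    show "(LINT x|gaussian 0 M. (t \<bullet> (A s *v x))\<^sup>2) = t \<bullet> ((A s ** M ** transpose (A s)) *v t)"
      unfolding * P2_integral_inner_square(2)[OF gaussian_P2] second_moment_gaussian[OF M]
      by (simp add: inner_matrix_left matrix_vector_mul_assoc matrix_mul_assoc)
  qed
  have "t \<bullet> (second_moment (sign_mixture M v l) *v t) = (LINT x|sign_mixture M v l. (t \<bullet> x)\<^sup>2)"
    by (simp add: P2_integral_inner_square(2)[OF sign_mixture_P2])
  also have "\<dots> = t \<bullet> (S *v t)"
    by (subst integral_sign_mixture[OF _ i]) (simp_all only: e signed_shift_form, auto)
  finally show "t \<bullet> (second_moment (sign_mixture M v l) *v t) = t \<bullet> (S *v t)" .
qed

lemma convex_order_sign_mixture: "convex_order (gaussian 0 M) (sign_mixture M v l)"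
proof (rule convex_order_midpoint)
  let ?X = "\<lambda>r (x, b). A (if b then r else - r) *v x"
  have law: "distr (gaussian 0 M \<Otimes>\<^sub>M B) borel (?X r) = sign_mixture M v l" if "r * r = 1" for r
    using P2_D[OF sign_mixture_P2]
      prob_space.prob_space_distr[OF prob_space_sign_pair measurable_sign_mixture, of v l r "- r"] that
    by (intro charfun_unique) (simp_all add: charfun_sign_pair charfun_sign_mixture)
  show "distr (gaussian 0 M \<Otimes>\<^sub>M B) borel (?X 1) = sign_mixture M v l"
    and "distr (gaussian 0 M \<Otimes>\<^sub>M B) borel (?X (- 1)) = sign_mixture M v l"
    by (rule law, simp)+
  have "(1 / 2) *\<^sub>R (?X 1 p + ?X (- 1) p) = fst p" for p
    by (cases p) (auto simp: signed_shift_def matrix_vector_mult_add_rdistrib matrix_vector_mult_diff_rdistrib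
        scaleR_matrix_vector_assoc[symmetric] scaleR_2[symmetric])
  then have "distr (gaussian 0 M \<Otimes>\<^sub>M B) borel (\<lambda>p. (1 / 2) *\<^sub>R (?X 1 p + ?X (- 1) p))
      = distr (gaussian 0 M \<Otimes>\<^sub>M B) (gaussian 0 M) fst"
    by (intro distr_cong) auto
  also have "\<dots> = gaussian 0 M"
    by (rule prob_space.distr_pair_fst[OF prob_space_measure_pmf])
  finally show "distr (gaussian 0 M \<Otimes>\<^sub>M B) borel (\<lambda>p. (1 / 2) *\<^sub>R (?X 1 p + ?X (- 1) p)) = gaussian 0 M" .
qed (auto simp: gaussian_P2 sign_mixture_P2 intro: measurable_sign_mixture)

lemma sign_mixture_neq_gaussian:
  assumes "v \<noteq> 0" "k \<noteq> 0" "v \<bullet> k = 0" "psd S"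
  shows "sign_mixture M v l \<noteq> gaussian 0 S"
proof
  assume eq: "sign_mixture M v l = gaussian 0 S"
  \<comment> \<open>With v orthogonal to k this point makes the argument of cosh equal to |v|^2
    |k|^2.\<close>
  let ?t = "v + k"
  let ?c = "(?t \<bullet> v) * (?t \<bullet> k)"
  have "complex_of_real (exp (- (?t \<bullet> (S *v ?t)) / 2) * cosh ?c) = complex_of_real (exp (- (?t \<bullet> (S *v ?t)) / 2))"
    using charfun_sign_mixture[of ?t] charfun_gaussian[OF assms(4), of ?t] unfolding eq by simp
  then have "exp (- (?t \<bullet> (S *v ?t)) / 2) * cosh ?c = exp (- (?t \<bullet> (S *v ?t)) / 2)"
    by (simp only: of_real_eq_iff)
  then have "cosh ?c = 1" by simp
  moreover have "?c \<noteq> 0"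
    using assms by (simp add: inner_add_left inner_commute[of k v])
  ultimately show False using cosh_real_one_iff by blast
qed

end

subsection \<open>Rank and uniqueness\<close>

text \<open>The kernel of \<open>A\<close> is the orthogonal complement of the range of its
  transpose, whose dimension is the rank of \<open>A\<close>.\<close>

lemma dim_kernel: "dim {x. A *v x = 0} + rank A = CARD('n)" for A :: "real^'n^'m"
proof -
  have "{y \<in> UNIV. \<forall>x\<in>range (\<lambda>x. transpose A *v x). orthogonal x y} = {x. A *v x = 0}"
  proof (intro equalityI subsetI CollectI)
    fix y assume "y \<in> {y \<in> UNIV. \<forall>x\<in>range (\<lambda>x. transpose A *v x). orthogonal x y}"
    then have "y \<bullet> (transpose A *v (A *v y)) = 0" by (auto simp: orthogonal_def inner_commute)
    then have "(A *v y) \<bullet> (A *v y) = 0" by (simp only: inner_matrix_left)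
    then show "A *v y = 0" by simp
  qed (auto simp: orthogonal_def inner_matrix_left)
  then show ?thesis
    using dim_subspace_orthogonal_to_vectors[of "range (\<lambda>x. transpose A *v x)" UNIV]
      rank_dim_range[of "transpose A"] rank_transpose[of A]
    by (simp add: linear_subspace_image subspace_UNIV)
qed

lemma subspace_kernel_matrix: "subspace {x. A *v x = 0}" for A :: "real^'n^'m"
  by (simp add: subspace_def matrix_vector_right_distrib matrix_vector_mult_scaleR)

lemma rank_le_kernel:
  fixes A :: "real^'n^'m" and B :: "real^'n^'k"
  assumes "\<And>x. A *v x = 0 \<Longrightarrow> B *v x = 0" shows "rank B \<le> rank A"
proof -
  have "dim {x. A *v x = 0} \<le> dim {x. B *v x = 0}" using assms by (intro dim_subset) auto
  then show ?thesis using dim_kernel[of A] dim_kernel[of B] by linarith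
qed

text \<open>The rank assumption makes the kernels of S and W S agree, so W is injective on the range
  of S and has a linear left inverse there.\<close>

lemma rank_mult_left_inverse:
  fixes S :: "real^'n^'n" and W :: "real^'n^'m"
  assumes "rank S \<le> rank (W ** S)"
  obtains B where "B ** W ** S = S"
proof -
  have "{x. S *v x = 0} = {x. W ** S *v x = 0}"
  proof (rule subspace_dim_equal)
    show "{x. S *v x = 0} \<subseteq> {x. W ** S *v x = 0}" by (auto simp: matrix_vector_mul_assoc[symmetric])
    show "dim {x. W ** S *v x = 0} \<le> dim {x. S *v x = 0}"
      using dim_kernel[of S] dim_kernel[of "W ** S"] assms by simp
  qed (rule subspace_kernel_matrix)+
  then have ker: "S *v x = 0" if "W *v (S *v x) = 0" for x
    using that by (auto simp: matrix_vector_mul_assoc)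
  have "inj_on (\<lambda>x. W *v x) (range (\<lambda>x. S *v x))"
  proof (rule inj_onI)
    fix y z assume "y \<in> range (\<lambda>x. S *v x)" "z \<in> range (\<lambda>x. S *v x)" and eq: "W *v y = W *v z"
    then obtain a b where ab: "y = S *v a" "z = S *v b" by auto
    have "W *v (S *v (a - b)) = 0" using eq by (simp add: ab matrix_vector_mult_diff_distrib)
    from ker[OF this] show "y = z" by (simp add: ab matrix_vector_mult_diff_distrib)
  qed
  moreover have "subspace (range (\<lambda>x. S *v x))" by (simp add: linear_subspace_image subspace_UNIV)
  ultimately obtain g where g: "linear g" "\<And>y. y \<in> range (\<lambda>x. S *v x) \<Longrightarrow> g (W *v y) = y"
    using linear_exists_left_inverse_on[of "\<lambda>x. W *v x" "range (\<lambda>x. S *v x)"] by auto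
  have "(matrix g ** W ** S) *v x = S *v x" for x
    using g by (simp add: matrix_vector_mul_assoc[symmetric] matrix_works)
  then have "matrix g ** W ** S = S" by (simp add: matrix_eq)
  then show ?thesis by (rule that)
qed

context kkt
begin

lemma projections_not_unique:
  assumes neq: "S\<^sub>s \<noteq> S\<^sub>\<mu>" and rank: "rank W < rank S\<^sub>s"
  shows "W2_projections \<nu> \<mu> \<noteq> {gaussian 0 S\<^sub>s}"
proof -
  define D where "D = S\<^sub>s - S\<^sub>\<mu>"
  have D: "psd D" unfolding D_def by (rule feasible)
  obtain u where u: "D *v u \<noteq> 0"
    using neq by (auto simp: D_def matrix_eq matrix_vector_mult_diff_rdistrib)
  define a where "a = u \<bullet> (D *v u)"
  have a: "0 < a"
    using psd_nonneg[OF D, of u] psd_diagonal_zero[OF D, of u] u by (auto simp: a_def less_le)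
  \<comment> \<open>The factor 2 keeps v v^T below D / 2. Then M >= S_mu + D / 2, so every kernel
    vector of M is one of \<open>S\<^sub>s\<close>, and M is large enough in rank to supply the
    direction k below.\<close>
  define v where "v = (1 / sqrt (2 * a)) *\<^sub>R (D *v u)"
  define M where "M = S\<^sub>s - (\<chi> i j. v $ i * v $ j)"
  have v: "v \<noteq> 0" using u a by (simp add: v_def)
  have v_le: "(v \<bullet> x)\<^sup>2 \<le> x \<bullet> (D *v x) / 2" for x
  proof -
    have "(v \<bullet> x)\<^sup>2 = (x \<bullet> (D *v u))\<^sup>2 / (2 * a)"
      using a by (simp add: v_def power_divide inner_commute)
    also have "\<dots> \<le> x \<bullet> (D *v x) / 2"
      using psd_cauchy_schwarz[OF D, of x u] a by (simp add: a_def[symmetric] field_simps)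
    finally show ?thesis .
  qed
  have M_form: "x \<bullet> (M *v x) = x \<bullet> (S\<^sub>\<mu> *v x) + x \<bullet> (D *v x) - (v \<bullet> x)\<^sup>2" for x
    by (simp add: M_def D_def matrix_vector_mult_diff_rdistrib rank_one_mult inner_diff_right
        power2_eq_square inner_commute)
  have M_sym: "transpose M = M"
    by (simp add: M_def transpose_diff transpose_rank_one psd_transpose psd_s)
  have M: "psd M"
    unfolding psd_def using M_sym M_form v_le psd_nonneg[OF psd_\<mu>] psd_nonneg[OF D]
    by (smt (verit, ccfv_threshold) field_sum_of_halves)
  have M_ge: "psd (M - S\<^sub>\<mu>)"
    unfolding psd_def
    using M_sym M_form v_le psd_nonneg[OF D]
    by (simp add: transpose_diff psd_transpose psd_\<mu> matrix_vector_mult_diff_rdistrib inner_diff_right)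
       (smt (verit, ccfv_threshold) field_sum_of_halves)
  have M_ker: "S\<^sub>s *v x = 0" if "M *v x = 0" for x
  proof (rule psd_diagonal_zero[OF psd_s])
    have "x \<bullet> (S\<^sub>s *v x) = x \<bullet> (S\<^sub>\<mu> *v x) + x \<bullet> (D *v x)"
      by (simp add: D_def matrix_vector_mult_diff_rdistrib inner_diff_right)
    moreover have "x \<bullet> (S\<^sub>\<mu> *v x) + x \<bullet> (D *v x) - (v \<bullet> x)\<^sup>2 = 0" using M_form[of x] that by simp
    ultimately show "x \<bullet> (S\<^sub>s *v x) = 0"
      using v_le[of x] psd_nonneg[OF psd_\<mu>, of x] psd_nonneg[OF D, of x] by linarith
  qed
  \<comment> \<open>Otherwise the kernel of W M would lie in that of \<open>S\<^sub>s\<close>, and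
    the rank of \<open>S\<^sub>s\<close> would be at most that of W.\<close>
  obtain x where x: "W *v (M *v x) = 0" "M *v x \<noteq> 0"
  proof -
    have "\<not> (\<forall>x. (W ** M) *v x = 0 \<longrightarrow> S\<^sub>s *v x = 0)"
      using rank rank_le_kernel[of "W ** M" "S\<^sub>s"] rank_mul_le_left[of W M] by auto
    then show ?thesis using that M_ker by (auto simp: matrix_vector_mul_assoc)
  qed
  define q where "q = x \<bullet> (M *v x)"
  have q: "0 < q"
    using psd_nonneg[OF M, of x] psd_diagonal_zero[OF M, of x] x(2) by (auto simp: q_def less_le)
  define l where "l = (1 / sqrt q) *\<^sub>R x"
  have l: "l \<bullet> (M *v l) = 1" using q by (simp add: l_def matrix_vector_mult_scaleR q_def[symmetric])
  let ?k = "M *v l"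
  have k: "W *v ?k = 0" "?k \<noteq> 0" using x q by (simp_all add: l_def matrix_vector_mult_scaleR)
  have S: "M + (\<chi> i j. v $ i * v $ j) = S\<^sub>s" by (simp add: M_def)
  \<comment> \<open>v lies in the range of D, which W fixes, while W annihilates k; as W is
    symmetric, v and k are orthogonal.\<close>
  have "W ** D = D" using complementary by (simp add: D_def matrix_diff_rdistrib)
  then have "v = W *v v" by (simp add: v_def matrix_vector_mult_scaleR matrix_vector_mul_assoc)
  then have vk: "v \<bullet> ?k = 0"
    using k(1) inner_matrix_left[of W v ?k] by (simp add: psd_transpose psd_W)
  let ?\<eta> = "sign_mixture M v l"
  note \<eta> = sign_mixture_P2[OF M l, of v]
  have "?\<eta> \<in> W2_projections \<nu> \<mu>"
  proof (rule projectionI[OF \<eta>])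
    show "convex_order \<mu> ?\<eta>"
      by (rule convex_order_trans[OF convex_order_gaussian[OF psd_\<mu> M_ge] convex_order_sign_mixture[OF M l]])
    show "second_moment ?\<eta> = S\<^sub>s" by (simp add: second_moment_sign_mixture[OF M l] S)
    show "distr ?\<eta> borel (\<lambda>y. W *v y) = \<nu>"
    proof (rule gaussian_eqI[OF psd_\<nu>])
      fix t
      \<comment> \<open>The image under W sees the characteristic function only at points W t, where
        the argument of cosh is 0: the mixture becomes Gaussian after W.\<close>
      have "(W *v t) \<bullet> ?k = 0" by (simp add: inner_matrix_left psd_transpose psd_W k(1))
      moreover have "(W *v t) \<bullet> (S\<^sub>s *v (W *v t)) = t \<bullet> (S\<^sub>\<nu> *v t)"
        unfolding transport[symmetric]
        by (simp add: inner_matrix_left psd_transpose psd_W matrix_vector_mul_assoc matrix_mul_assoc)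
      ultimately show "charfun (distr ?\<eta> borel (\<lambda>y. W *v y)) t = complex_of_real (exp (- (t \<bullet> (S\<^sub>\<nu> *v t)) / 2))"
        using P2_D(2)[OF \<eta>]
        by (simp add: charfun_distr_linear psd_transpose psd_W charfun_sign_mixture[OF M l] S)
    qed (use P2_D[OF P2_distr_linear[OF \<eta>, of W]] in auto)
  qed
  moreover have "?\<eta> \<noteq> gaussian 0 S\<^sub>s"
    using sign_mixture_neq_gaussian[OF M l v k(2) vk] psd_s by (simp add: S)
  ultimately show ?thesis by auto
qed

text \<open>From \<open>transport\<close>, rank S_nu <= rank (W S_s) <= rank S_s. Equality at the
  ends provides the left inverse of W; if it fails, the bound on rank W gives the strict inequality
  that \<open>projections_not_unique\<close> asks for.\<close>

theorem projections_unique_iff: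
  assumes "rank W \<le> rank S\<^sub>\<nu>"
  shows "W2_projections \<nu> \<mu> = {gaussian 0 S\<^sub>s} \<longleftrightarrow> rank S\<^sub>s = rank S\<^sub>\<nu> \<or> S\<^sub>s = S\<^sub>\<mu>"
proof -
  have le: "rank S\<^sub>\<nu> \<le> rank (W ** S\<^sub>s)" "rank (W ** S\<^sub>s) \<le> rank S\<^sub>s"
    using rank_mul_le_left[of "W ** S\<^sub>s" W] rank_mul_le_right[of W "S\<^sub>s"] by (simp_all add: transport)
  have "W2_projections \<nu> \<mu> = {gaussian 0 S\<^sub>s}" if "rank S\<^sub>s = rank S\<^sub>\<nu>"
  proof -
    have "rank S\<^sub>s \<le> rank (W ** S\<^sub>s)" using le that by simp
    then obtain B where "B ** W ** S\<^sub>s = S\<^sub>s" by (rule rank_mult_left_inverse)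
    then show ?thesis by (rule projections_eq_factor)
  qed
  moreover have "W2_projections \<nu> \<mu> \<noteq> {gaussian 0 S\<^sub>s}" if "rank S\<^sub>s \<noteq> rank S\<^sub>\<nu>" "S\<^sub>s \<noteq> S\<^sub>\<mu>"
    using that le assms by (intro projections_not_unique) auto
  ultimately show ?thesis using projections_eq_self by blast
qed

end

subsection \<open>The two instances of the duality certificate\<close>

lemma inverse_psd_ge_1:
  fixes T W :: "real^'m^'m"
  assumes T: "psd (T - mat 1)" and inv: "T ** W = mat 1" "W ** T = mat 1"
  shows "psd T" "transpose W = W" "psd W" "psd (mat 1 - W)"
proof -
  show T0: "psd T" using psd_add[OF T psd_mat1] by simp
  have "transpose W ** T = mat 1"
    using arg_cong[OF inv(1), of transpose] by (simp add: matrix_transpose_mul psd_transpose[OF T0])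
  then show W: "transpose W = W"
    using inv by (metis matrix_mul_assoc matrix_mul_lid matrix_mul_rid)
  have "psd (transpose W ** T ** W)" by (rule psd_congruence[OF T0])
  then show "psd W" by (simp add: W inv)
  \<comment> \<open>T T - T = (T - 1)^2 + (T - 1) is positive semi-definite, and multiplying by
    \<open>W\<close> on both sides turns it into 1 - W.\<close>
  have "psd (transpose (T - mat 1) ** mat 1 ** (T - mat 1))" by (rule psd_congruence[OF psd_mat1])
  then have "psd ((T - mat 1) ** (T - mat 1) + (T - mat 1))"
    using psd_add[OF _ T] by (simp add: psd_transpose[OF T])
  also have "(T - mat 1) ** (T - mat 1) + (T - mat 1) = T ** T - T"
    by (simp add: matrix_diff_ldistrib matrix_diff_rdistrib)
  finally have "psd (transpose W ** (T ** T - T) ** W)" by (rule psd_congruence)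
  moreover have "W ** (T ** T) ** W = mat 1"
    using inv by (simp add: matrix_mul_assoc)
  ultimately show "psd (mat 1 - W)"
    by (simp add: W matrix_diff_ldistrib matrix_diff_rdistrib inv)
qed

text \<open>The transported matrices vanish on the complement of the range of V, so 1 - V W V^T = (1
  - V V^T) + V (1 - W) V^T, and V^T V = 1 reduces the other conditions to dimension m. Only the
  compressed block of S is changed, from S1 to G, which is the shape of \<Sigma>_star.\<close>

lemma kkt_isometry:
  fixes V :: "real^'m^'n" and S :: "real^'n^'n" and L G T W :: "real^'m^'m"
  defines "S1 \<equiv> transpose V ** S ** V"
  assumes V: "transpose V ** V = mat 1" and S: "psd S" and L: "psd L"
    and T: "psd (T - mat 1)" and inv: "T ** W = mat 1" "W ** T = mat 1"
    and G: "G = T ** L ** T" and feasible: "psd (G - S1)"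
    and complementary: "(mat 1 - W) ** (G - S1) = 0"
  shows "kkt S (V ** L ** transpose V) (S + V ** (G - S1) ** transpose V)
    (V ** T ** transpose V) (V ** W ** transpose V)"
proof
  note TW = inverse_psd_ge_1[OF T inv]
  have VV: "A ** transpose V ** V = A" for A :: "real^'m^'k"
    by (simp add: matrix_mul_assoc[symmetric] V)
  have psd_V: "psd (V ** A ** transpose V)" if "psd A" for A
    using psd_congruence[OF that, of "transpose V"] by simp
  have TW_V: "V ** T ** transpose V ** (V ** W ** transpose V) = V ** transpose V"
    "V ** W ** transpose V ** (V ** T ** transpose V) = V ** transpose V"
    by (simp_all add: matrix_mul_assoc VV) (simp_all add: matrix_mul_assoc[symmetric] inv)
  show "psd S" by (rule S)
  show "psd (V ** L ** transpose V)" "psd (V ** T ** transpose V)" "psd (V ** W ** transpose V)"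
    by (intro psd_V L TW)+
  show "psd (S + V ** (G - S1) ** transpose V - S)" using psd_V[OF feasible] by simp
  show "psd (mat 1 - V ** W ** transpose V)"
  proof -
    let ?P = "mat 1 - V ** transpose V"
    have "transpose ?P = ?P" by (simp add: transpose_diff matrix_transpose_mul)
    moreover have "?P ** ?P = ?P"
      by (simp add: matrix_diff_ldistrib matrix_diff_rdistrib matrix_mul_assoc VV)
    ultimately have "psd ?P" using psd_congruence[OF psd_mat1, of ?P] by simp
    then have "psd (?P + V ** (mat 1 - W) ** transpose V)" by (intro psd_add psd_V TW)
    then show ?thesis by (simp add: matrix_diff_ldistrib matrix_diff_rdistrib)
  qed
  show "V ** W ** transpose V ** (V ** T ** transpose V) ** (V ** W ** transpose V) = V ** W ** transpose V"
    unfolding TW_V by (simp add: matrix_mul_assoc VV)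
  show "V ** T ** transpose V ** (V ** W ** transpose V) = V ** W ** transpose V ** (V ** T ** transpose V)"
    unfolding TW_V ..
  show "V ** T ** transpose V ** (V ** W ** transpose V) ** (V ** L ** transpose V) = V ** L ** transpose V"
    unfolding TW_V by (simp add: matrix_mul_assoc VV)
  show "psd (V ** T ** transpose V - V ** T ** transpose V ** (V ** W ** transpose V))"
    unfolding TW_V using psd_V[OF T] by (simp add: matrix_diff_ldistrib matrix_diff_rdistrib)
  show "(mat 1 - V ** W ** transpose V) ** (S + V ** (G - S1) ** transpose V - S) = 0"
  proof -
    have "(mat 1 - V ** W ** transpose V) ** (V ** (G - S1) ** transpose V)
        = V ** ((mat 1 - W) ** (G - S1)) ** transpose V"
      by (simp add: matrix_diff_ldistrib matrix_diff_rdistrib matrix_mul_assoc VV)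
    then show ?thesis by (simp add: complementary)
  qed
  show "V ** W ** transpose V ** (S + V ** (G - S1) ** transpose V) ** (V ** W ** transpose V)
      = V ** L ** transpose V"
  proof -
    have "transpose V ** (S + V ** (G - S1) ** transpose V) ** V = G"
      by (simp add: matrix_add_ldistrib matrix_add_rdistrib matrix_mul_assoc VV V S1_def)
    note compress = this
    have "W ** G ** W = (W ** T) ** L ** (T ** W)" by (simp add: G matrix_mul_assoc)
    then have WGW: "W ** G ** W = L" by (simp add: inv)
    have "V ** W ** transpose V ** X ** (V ** W ** transpose V)
        = V ** (W ** (transpose V ** X ** V) ** W) ** transpose V" for X
      by (simp add: matrix_mul_assoc)
    then show ?thesis by (simp only: compress WGW)
  qed
qed

text \<open>The case V = 1: here y = T (W y), so the factor criterion applies. It yields the value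
  of \<open>J2\<close>, and it shows that two certificates for the same data lead to the same
  covariance.\<close>

lemma nondegenerate_projections:
  fixes S L G T W :: "real^'m^'m"
  assumes S: "psd S" and L: "psd L"
    and T: "psd (T - mat 1)" and inv: "T ** W = mat 1" "W ** T = mat 1"
    and G: "G = T ** L ** T" and feasible: "psd (G - S)"
    and complementary: "(mat 1 - W) ** (G - S) = 0"
  shows "W2_projections (gaussian 0 L) (gaussian 0 S) = {gaussian 0 G}"
proof -
  interpret kkt S L G T W
    using kkt_isometry[of "mat 1" S L T W G, OF _ S L T inv G] feasible complementary by simp
  show ?thesis by (rule projections_eq_factor[of T]) (simp add: inv)
qed

lemma psd_diag_matrix_inverse_sqrt:
  fixes l :: "'m::finite \<Rightarrow> real"
  assumes l: "\<And>i. 0 < l i"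
  obtains R K :: "real^'m^'m" where "psd R" "R ** R = diag_matrix l" "psd K" "R ** K = mat 1" "K ** R = mat 1"
proof -
  have mult: "diag_matrix a ** diag_matrix b = diag_matrix (\<lambda>i. a i * b i)" for a b :: "'m \<Rightarrow> real"
    by (simp add: matrix_eq vec_eq_iff matrix_vector_mul_assoc[symmetric] diag_matrix_mult_vec)
  have one: "diag_matrix (\<lambda>_. 1) = (mat 1 :: real^'m^'m)" by (simp add: diag_matrix_def mat_def)
  have l0: "0 \<le> l i" "l i \<noteq> 0" for i using l[of i] by simp_all
  let ?R = "diag_matrix (\<lambda>i. sqrt (l i)) :: real^'m^'m"
  let ?K = "diag_matrix (\<lambda>i. 1 / sqrt (l i)) :: real^'m^'m"
  have "psd ?R" "psd ?K" by (rule psd_diag_matrix, simp add: l0)+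
  moreover have "?R ** ?R = diag_matrix l" by (simp add: mult l0)
  moreover have "?R ** ?K = mat 1" "?K ** ?R = mat 1"
    by (simp_all add: mult l0 one)
  ultimately show ?thesis by (intro that)
qed

text \<open>The certificate \<open>T = R\<inverse> C R\<inverse>\<close> with \<open>C = (R S R)\<close> to the power \<open>1/2\<close> solves \<open>T L T = S\<close>; it is
  admissible exactly when \<open>L \<le> C\<close>.\<close>

lemma projection_trivial_iff:
  fixes S L G T W R K :: "real^'m^'m"
  assumes S: "psd S" and T: "psd (T - mat 1)" and inv: "T ** W = mat 1" "W ** T = mat 1"
    and G: "G = T ** L ** T" and feasible: "psd (G - S)"
    and complementary: "(mat 1 - W) ** (G - S) = 0"
    and R: "psd R" "R ** R = L" and K: "psd K" "R ** K = mat 1" "K ** R = mat 1"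
  shows "G = S \<longleftrightarrow> psd (psd_sqrt (R ** S ** R) - L)"
proof
  note TW = inverse_psd_ge_1[OF T inv]
  have L: "psd L" using psd_congruence[OF psd_mat1, of R] R by (simp add: psd_transpose)
  have RSR: "psd (R ** S ** R)" using psd_congruence[OF S, of R] by (simp add: psd_transpose R)
  {
    assume "G = S"
    have "(R ** T ** R) ** (R ** T ** R) = R ** (T ** (R ** R) ** T) ** R"
      by (simp add: matrix_mul_assoc)
    also have "\<dots> = R ** S ** R" using \<open>G = S\<close> G by (simp add: R)
    finally have "(R ** T ** R) ** (R ** T ** R) = R ** S ** R" .
    moreover have "psd (R ** T ** R)" using psd_congruence[OF TW(1), of R] by (simp add: psd_transpose R)
    ultimately have "psd_sqrt (R ** S ** R) = R ** T ** R" by (intro psd_sqrt_eqI)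
    moreover have "psd (R ** (T - mat 1) ** R)"
      using psd_congruence[OF T, of R] by (simp add: psd_transpose R)
    ultimately show "psd (psd_sqrt (R ** S ** R) - L)"
      by (simp add: matrix_diff_ldistrib matrix_diff_rdistrib R)
  }
  {
    let ?C = "psd_sqrt (R ** S ** R)"
    assume C: "psd (?C - L)"
    define T' where "T' = K ** ?C ** K"
    have KLK: "K ** L ** K = mat 1"
      unfolding R(2)[symmetric] by (simp add: matrix_mul_assoc K)
    have "psd (K ** (?C - L) ** K)" using psd_congruence[OF C, of K] by (simp add: psd_transpose K)
    then have T': "psd (T' - mat 1)"
      by (simp add: T'_def matrix_diff_ldistrib matrix_diff_rdistrib KLK)
    have KRA: "A ** K ** R = A" "A ** R ** K = A" for A :: "real^'m^'m"
      by (simp_all add: matrix_mul_assoc[symmetric] K)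
    have "T' ** L ** T' = K ** (?C ** ?C) ** K"
      unfolding T'_def R(2)[symmetric] by (simp add: matrix_mul_assoc KRA)
    also have "\<dots> = S"
      unfolding psd_sqrt_mult[OF RSR] by (simp add: matrix_mul_assoc KRA K)
    finally have eq: "S = T' ** L ** T'" by simp
    \<comment> \<open>T' certifies the covariance S and T certifies G for the same problem, so
      uniqueness of the projection equates them.\<close>
    have "W2_projections (gaussian 0 L) (gaussian 0 S) = {gaussian 0 S}"
      by (rule nondegenerate_projections[OF S L T' psd_ge_1_inverse(1,2)[OF T'] eq]) (simp_all add: psd_0)
    moreover have "W2_projections (gaussian 0 L) (gaussian 0 S) = {gaussian 0 G}"
      by (rule nondegenerate_projections[OF S L T inv G feasible complementary])
    ultimately have "gaussian 0 G = gaussian 0 S" by simp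
    moreover have "psd G" using psd_add[OF S feasible] by simp
    ultimately show "G = S" using second_moment_gaussian S by metis
  }
qed

text \<open>The certificate is found in dimension m, where it gives \<Gamma> = T L T, and is then
  transported by V. The second alternative of \<open>projections_unique_iff\<close> and the Loewner
  condition are each shown equivalent to the single equation G = S.\<close>

theorem proposition3p3:
  fixes \<Sigma>\<^sub>\<mu> \<Sigma>\<^sub>\<nu> \<Sigma>\<^sub>s Q :: "real^'n::finite^'n"
    and \<Gamma> :: "real^'m::finite^'m"
    and e :: "'m \<Rightarrow> 'n"
    and l :: "'n \<Rightarrow> real"
  assumes "2 \<le> CARD('n)"
    and "psd \<Sigma>\<^sub>\<mu>" and "psd \<Sigma>\<^sub>\<nu>"
    and "rank \<Sigma>\<^sub>\<nu> = CARD('m)" and "1 \<le> CARD('m)" and "CARD('m) < CARD('n)"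
    and "inj e"
    and "orthogonal_matrix Q"
    and "\<forall>i. 0 < l (e i)" and "\<forall>k. k \<notin> range e \<longrightarrow> l k = 0"
    and "\<Sigma>\<^sub>\<nu> = Q ** diag_matrix l ** transpose Q"
    and "\<Gamma> = covariance_matrix
              (J2 (gaussian 0 (diag_matrix (\<lambda>i. l (e i))))
                  (gaussian 0 (principal_submatrix e (transpose Q ** \<Sigma>\<^sub>\<mu> ** Q))))"
    and "principal_submatrix e (transpose Q ** \<Sigma>\<^sub>s ** Q) = \<Gamma>"
    and "\<forall>i j. \<not> (i \<in> range e \<and> j \<in> range e) \<longrightarrow>
              (transpose Q ** \<Sigma>\<^sub>s ** Q) $ i $ j = (transpose Q ** \<Sigma>\<^sub>\<mu> ** Q) $ i $ j"
  shows "W2_projections (gaussian 0 \<Sigma>\<^sub>\<nu>) (gaussian 0 \<Sigma>\<^sub>\<mu>) = {gaussian 0 \<Sigma>\<^sub>s}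
     \<longleftrightarrow> rank \<Sigma>\<^sub>s = rank \<Sigma>\<^sub>\<nu> \<or>
         loewner_le \<Sigma>\<^sub>\<nu> (psd_sqrt (psd_sqrt \<Sigma>\<^sub>\<nu> ** \<Sigma>\<^sub>\<mu> ** psd_sqrt \<Sigma>\<^sub>\<nu>))"
proof -
  \<comment> \<open>With \<open>U\<close>, taking a principal submatrix is the congruence U^T A U
    and padding by zeros is U A U^T, so the entrywise hypotheses become matrix identities.\<close>
  define U :: "real^'m^'n" where "U = (\<chi> k i. if k = e i then 1 else 0)"
  define V where "V = Q ** U"
  define L where "L = diag_matrix (\<lambda>i. l (e i))"
  define S where "S = transpose V ** \<Sigma>\<^sub>\<mu> ** V"
  have inj: "e i = e j \<longleftrightarrow> i = j" for i j using \<open>inj e\<close> by (auto simp: inj_def)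
  have QQ: "transpose Q ** Q = mat 1" "Q ** transpose Q = mat 1"
    using \<open>orthogonal_matrix Q\<close> by (auto simp: orthogonal_matrix_def)
  have U1: "(\<Sum>k\<in>UNIV. U $ k $ i * f k) = f (e i)" "(\<Sum>k\<in>UNIV. f k * U $ k $ i) = f (e i)"
    for f :: "'n \<Rightarrow> real" and i
  proof -
    have "U $ k $ i * f k = (if k = e i then f k else 0)" for k by (simp add: U_def)
    then show "(\<Sum>k\<in>UNIV. U $ k $ i * f k) = f (e i)" "(\<Sum>k\<in>UNIV. f k * U $ k $ i) = f (e i)"
      by (simp_all add: mult.commute[of "f _"])
  qed
  have U2: "(\<Sum>k\<in>UNIV. U $ i $ k * f k) = (if i \<in> range e then f (inv e i) else 0)"
    "(\<Sum>k\<in>UNIV. f k * U $ i $ k) = (if i \<in> range e then f (inv e i) else 0)"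
    for f :: "'m \<Rightarrow> real" and i
  proof -
    have "U $ i $ k * f k = (if k = inv e i then if i \<in> range e then f k else 0 else 0)" for k
      using \<open>inj e\<close> by (auto simp: U_def)
    then show "(\<Sum>k\<in>UNIV. U $ i $ k * f k) = (if i \<in> range e then f (inv e i) else 0)"
      "(\<Sum>k\<in>UNIV. f k * U $ i $ k) = (if i \<in> range e then f (inv e i) else 0)"
      by (simp_all add: mult.commute[of "f _"])
  qed
  have sub: "principal_submatrix e A = transpose U ** A ** U" for A
    by (simp add: principal_submatrix_def matrix_matrix_mult_def transpose_def vec_eq_iff U1)
  have UU: "transpose U ** U = mat 1"
    by (simp add: matrix_matrix_mult_def transpose_def vec_eq_iff U1) (simp add: U_def mat_def inj)
  have block: "(U ** A ** transpose U) $ i $ j =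
      (if i \<in> range e \<and> j \<in> range e then A $ inv e i $ inv e j else 0)" for A i j
    by (simp add: matrix_matrix_mult_def transpose_def U2)
  have VV: "transpose V ** V = mat 1"
  proof -
    have "transpose V ** V = transpose U ** (transpose Q ** Q) ** U"
      by (simp add: V_def matrix_transpose_mul matrix_mul_assoc)
    then show ?thesis by (simp add: QQ UU)
  qed
  have S_sub: "principal_submatrix e (transpose Q ** \<Sigma>\<^sub>\<mu> ** Q) = S"
    by (simp add: sub S_def V_def matrix_transpose_mul matrix_mul_assoc)
  have \<nu>: "\<Sigma>\<^sub>\<nu> = V ** L ** transpose V"
  proof -
    have "diag_matrix l = U ** L ** transpose U"
      using \<open>inj e\<close> assms(10) by (auto simp: vec_eq_iff block L_def diag_matrix_def inj)
    then show ?thesis using assms(11) by (simp add: V_def matrix_transpose_mul matrix_mul_assoc)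
  qed
  have S: "psd S" unfolding S_def by (rule psd_congruence[OF assms(2)])
  have L: "psd L" unfolding L_def using assms(9) by (intro psd_diag_matrix) (simp add: less_imp_le)
  obtain T W where T: "psd (T - mat 1)" "T ** W = mat 1" "W ** T = mat 1"
    and N: "psd (L - W ** S ** W)" "(T - mat 1) ** (L - W ** S ** W) = 0"
    using dual_optimum[OF S, of "\<lambda>i. l (e i)"] assms(9) unfolding L_def by auto
  note TW = inverse_psd_ge_1[OF T]
  define G where "G = T ** L ** T"
  have GS: "G - S = T ** (L - W ** S ** W) ** T"
    by (simp add: G_def matrix_diff_ldistrib matrix_diff_rdistrib matrix_mul_assoc T)
       (simp add: matrix_mul_assoc[symmetric] T)
  have GS_psd: "psd (G - S)"
    using psd_congruence[OF N(1), of T] by (simp add: GS psd_transpose TW)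
  have GS_compl: "(mat 1 - W) ** (G - S) = 0"
  proof -
    have "(mat 1 - W) ** T = T - mat 1" by (simp add: matrix_diff_rdistrib T)
    then show ?thesis using N(2) by (simp add: GS matrix_mul_assoc)
  qed
  \<comment> \<open>The set of projections is a singleton, so the definite description in
    \<open>J2\<close> has its intended value.\<close>
  have "J2 (gaussian 0 L) (gaussian 0 S) = gaussian 0 G"
    using nondegenerate_projections[OF S L T G_def GS_psd GS_compl] by (simp add: J2_def)
  then have \<Gamma>: "\<Gamma> = G"
    using assms(12) psd_add[OF S GS_psd] by (simp add: S_sub L_def[symmetric] covariance_gaussian)
  have s: "\<Sigma>\<^sub>s = \<Sigma>\<^sub>\<mu> + V ** (G - S) ** transpose V"
  proof -
    have "transpose Q ** \<Sigma>\<^sub>s ** Q = transpose Q ** \<Sigma>\<^sub>\<mu> ** Q + U ** (G - S) ** transpose U"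
    proof -
      have "(transpose Q ** \<Sigma>\<^sub>s ** Q) $ e i $ e j = G $ i $ j" for i j
        using assms(13) by (simp add: \<Gamma> principal_submatrix_def vec_eq_iff)
      moreover have "(transpose Q ** \<Sigma>\<^sub>\<mu> ** Q) $ e i $ e j = S $ i $ j" for i j
        using S_sub by (simp add: principal_submatrix_def vec_eq_iff)
      ultimately show ?thesis
        using assms(14) \<open>inj e\<close> by (auto simp: vec_eq_iff block)
    qed
    then have "Q ** (transpose Q ** \<Sigma>\<^sub>s ** Q) ** transpose Q
        = Q ** (transpose Q ** \<Sigma>\<^sub>\<mu> ** Q + U ** (G - S) ** transpose U) ** transpose Q" by simp
    moreover have "Q ** (transpose Q ** A ** Q) ** transpose Q = A" for A
    proof -
      have "Q ** (transpose Q ** A ** Q) ** transpose Q = (Q ** transpose Q) ** A ** (Q ** transpose Q)"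
        by (simp add: matrix_mul_assoc)
      then show ?thesis by (simp add: QQ)
    qed
    moreover have "Q ** (U ** (G - S) ** transpose U) ** transpose Q = V ** (G - S) ** transpose V"
      by (simp add: V_def matrix_transpose_mul matrix_mul_assoc)
    ultimately show ?thesis by (simp only: matrix_add_ldistrib matrix_add_rdistrib)
  qed
  interpret kkt "\<Sigma>\<^sub>\<mu>" "\<Sigma>\<^sub>\<nu>" "\<Sigma>\<^sub>s" "V ** T ** transpose V" "V ** W ** transpose V"
    unfolding \<nu> s S_def
    by (rule kkt_isometry[OF VV assms(2) L T G_def]) (use GS_psd GS_compl in \<open>simp_all add: S_def\<close>)
  \<comment> \<open>The matrix factors through dimension m, which is the rank of
    \<open>\<Sigma>\<^sub>\<nu>\<close>.\<close>
  have "rank (V ** W ** transpose V) \<le> rank \<Sigma>\<^sub>\<nu>"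
    using rank_mul_le_left[of "V ** W" "transpose V"] rank_bound[of "V ** W"] assms(4) by simp
  then have unique: "W2_projections (gaussian 0 \<Sigma>\<^sub>\<nu>) (gaussian 0 \<Sigma>\<^sub>\<mu>) = {gaussian 0 \<Sigma>\<^sub>s}
      \<longleftrightarrow> rank \<Sigma>\<^sub>s = rank \<Sigma>\<^sub>\<nu> \<or> \<Sigma>\<^sub>s = \<Sigma>\<^sub>\<mu>"
    by (rule projections_unique_iff)
  have compress: "transpose V ** (V ** A ** transpose V) ** V = A" for A
  proof -
    have "transpose V ** (V ** A ** transpose V) ** V = (transpose V ** V) ** A ** (transpose V ** V)"
      by (simp add: matrix_mul_assoc)
    then show ?thesis by (simp add: VV)
  qed
  have "\<Sigma>\<^sub>s = \<Sigma>\<^sub>\<mu> \<longleftrightarrow> G = S"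
  proof
    assume "\<Sigma>\<^sub>s = \<Sigma>\<^sub>\<mu>"
    then have "V ** (G - S) ** transpose V = 0" by (simp add: s)
    then have "G - S = 0" using compress[of "G - S"] by simp
    then show "G = S" by simp
  qed (simp add: s)
  moreover have "loewner_le \<Sigma>\<^sub>\<nu> (psd_sqrt (psd_sqrt \<Sigma>\<^sub>\<nu> ** \<Sigma>\<^sub>\<mu> ** psd_sqrt \<Sigma>\<^sub>\<nu>)) \<longleftrightarrow> G = S"
  proof -
    obtain R K :: "real^'m^'m" where R: "psd R" "R ** R = L" "psd K" "R ** K = mat 1" "K ** R = mat 1"
      using psd_diag_matrix_inverse_sqrt[of "\<lambda>i. l (e i)"] assms(9) unfolding L_def by metis
    have psd_V: "psd (V ** A ** transpose V)" if "psd A" for A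
      using psd_congruence[OF that, of "transpose V"] by simp
    have mult_V: "V ** A ** transpose V ** (V ** B ** transpose V) = V ** (A ** B) ** transpose V" for A B
    proof -
      have "V ** A ** transpose V ** (V ** B ** transpose V) = V ** (A ** (transpose V ** V) ** B) ** transpose V"
        by (simp add: matrix_mul_assoc)
      then show ?thesis by (simp add: VV)
    qed
    let ?C = "psd_sqrt (R ** S ** R)"
    have C: "psd ?C" "?C ** ?C = R ** S ** R"
      using psd_congruence[OF S, of R] R by (simp_all add: psd_transpose psd_psd_sqrt psd_sqrt_mult)
    \<comment> \<open>The map A -> V A V^T respects products and positivity, so uniqueness of roots
      transfers both square roots to dimension m.\<close>
    have "psd_sqrt \<Sigma>\<^sub>\<nu> = V ** R ** transpose V"
      by (intro psd_sqrt_eqI psd_V R) (simp add: mult_V R \<nu>)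
    then have "psd_sqrt \<Sigma>\<^sub>\<nu> ** \<Sigma>\<^sub>\<mu> ** psd_sqrt \<Sigma>\<^sub>\<nu> = V ** (R ** S ** R) ** transpose V"
      by (simp add: S_def matrix_mul_assoc)
    then have "psd_sqrt (psd_sqrt \<Sigma>\<^sub>\<nu> ** \<Sigma>\<^sub>\<mu> ** psd_sqrt \<Sigma>\<^sub>\<nu>) = V ** ?C ** transpose V"
      by (intro psd_sqrt_eqI psd_V C) (simp add: mult_V C)
    then have "loewner_le \<Sigma>\<^sub>\<nu> (psd_sqrt (psd_sqrt \<Sigma>\<^sub>\<nu> ** \<Sigma>\<^sub>\<mu> ** psd_sqrt \<Sigma>\<^sub>\<nu>))
        \<longleftrightarrow> psd (V ** (?C - L) ** transpose V)"
      by (simp add: loewner_le_def \<nu> matrix_diff_ldistrib matrix_diff_rdistrib)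
    also have "\<dots> \<longleftrightarrow> psd (?C - L)"
      using psd_V[of "?C - L"] psd_congruence[of "V ** (?C - L) ** transpose V" V] by (auto simp: compress)
    also have "\<dots> \<longleftrightarrow> G = S"
      using projection_trivial_iff[OF S T G_def GS_psd GS_compl R] by simp
    finally show ?thesis .
  qed
  ultimately show ?thesis using unique by simp
qed

end
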